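(* Suppose that $G$ is the fundamental group of a finite graph of groups whose edge groups are finite and whose vertex groups satisfy property (VRC). Then $G$ also satisfies property (VRC).
   Context: A subgroup $H$ of a group $K$ is a retract of $K$ if there is a homomorphism $\rho: K \to H$ which restricts to the identity map on $H$. A subgroup $H$ of a group $G$ is a virtual retract of $G$ if there exists a subgroup $K \leqslant G$ with $|G:K|<\infty$, $H \subseteq K$, and $H$ a retract of $K$. A group $G$ has property (VRC) if every cyclic subgroup of $G$ is a virtual retract of $G$. Graphs of groups and their fundamental groups are understood in the sense of Bass–Serre theory. *)

theory Defs
  imports
    "HOL-Algebra.Elementary_Groups"
    "Graph_Theory.Arc_Walk"
    "Graph_Theory.Bidirected_Digraph"
    "Graph_Theory.Digraph_Component"
begin

section \<open>Virtual retracts and property (VRC)\<close>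

definition group_retract :: "'a set \<Rightarrow> ('a, 'm) monoid_scheme \<Rightarrow> bool" where
  "group_retract H K \<longleftrightarrow>
     subgroup H K \<and> (\<exists>\<rho> \<in> hom K (K\<lparr>carrier := H\<rparr>). \<forall>h\<in>H. \<rho> h = h)"

definition virtual_retract :: "'a set \<Rightarrow> ('a, 'm) monoid_scheme \<Rightarrow> bool" where
  "virtual_retract H G \<longleftrightarrow>
     subgroup H G \<and>
     (\<exists>K. subgroup K G \<and> finite (rcosets\<^bsub>G\<^esub> K) \<and> H \<subseteq> K \<and> group_retract H (G\<lparr>carrier := K\<rparr>))"

definition VRC :: "('a, 'm) monoid_scheme \<Rightarrow> bool" where
  "VRC G \<longleftrightarrow>
     (\<forall>H. subgroup H G \<and> cyclic_group (G\<lparr>carrier := H\<rparr>) \<longrightarrow> virtual_retract H G)"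


section \<open>Graphs of groups\<close>

text \<open>
  A graph in the sense of Serre is a \<^locale>\<open>bidirected_digraph\<close>: every geometric edge is a pair
  of oppositely oriented arcs that are swapped by the fixed-point free involution \<open>einv\<close>. Loops and
  multiple edges are allowed. The edge group \<open>G\<^sub>e\<close> embeds into the vertex group at the head of \<open>e\<close>;
  since \<open>e\<close> and its inverse have the same edge group, the embedding of \<open>G\<^sub>e\<close> at the tail
  of \<open>e\<close> is the one attached to the inverse of \<open>e\<close>.
\<close>

record ('v, 'e, 'g, 'h) graph_of_groups_data =
  base_graph :: "('v, 'e) pre_digraph"
  einv :: "'e \<Rightarrow> 'e"
  vertex_group :: "'v \<Rightarrow> 'g monoid"
  edge_group :: "'e \<Rightarrow> 'h monoid"
  edge_map :: "'e \<Rightarrow> 'h \<Rightarrow> 'g"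

locale graph_of_groups =
  bidirected_digraph "base_graph A" "einv A"
  for A :: "('v, 'e, 'g, 'h) graph_of_groups_data" +
  assumes connected_base: "connected (base_graph A)"
    and vertex_group: "v \<in> verts (base_graph A) \<Longrightarrow> group (vertex_group A v)"
    and edge_group: "e \<in> arcs (base_graph A) \<Longrightarrow> group (edge_group A e)"
    and edge_group_einv: "e \<in> arcs (base_graph A) \<Longrightarrow> edge_group A (einv A e) = edge_group A e"
    and edge_map: "e \<in> arcs (base_graph A) \<Longrightarrow>
      edge_map A e \<in> mon (edge_group A e) (vertex_group A (head (base_graph A) e))"

locale finite_graph_of_groups = graph_of_groups A + fin_digraph "base_graph A"
  for A :: "('v, 'e, 'g, 'h) graph_of_groups_data"


section \<open>The path group and the fundamental group\<close>

text \<open>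
  The path group \<open>F(A)\<close> is generated by all vertex groups and all edges, subject to
  \<open>e\<inverse> = einv e\<close> and \<open>e \<phi>\<^sub>e(a) e\<inverse> = \<phi>\<^bsub>einv e\<^esub>(a)\<close> for \<open>a\<close> in the edge group \<open>G\<^sub>e\<close>. It is realised as a
  quotient of the free monoid of words in the vertex group elements and the edges; no formal
  inverses are needed since every letter already has an inverse letter.
\<close>

datatype ('v, 'e, 'g) letter = Vertex_El 'v 'g | Edge 'e

definition letters :: "('v, 'e, 'g, 'h) graph_of_groups_data \<Rightarrow> ('v, 'e, 'g) letter set" where
  "letters A =
     {Vertex_El v g | v g. v \<in> verts (base_graph A) \<and> g \<in> carrier (vertex_group A v)} \<union>
     Edge ` arcs (base_graph A)"

inductive_set path_relations ::
    "('v, 'e, 'g, 'h) graph_of_groups_data \<Rightarrow>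
     (('v, 'e, 'g) letter list \<times> ('v, 'e, 'g) letter list) set"
  for A where
  vertex_one: "v \<in> verts (base_graph A) \<Longrightarrow>
    ([Vertex_El v \<one>\<^bsub>vertex_group A v\<^esub>], []) \<in> path_relations A"
| vertex_mult: "v \<in> verts (base_graph A) \<Longrightarrow>
    g \<in> carrier (vertex_group A v) \<Longrightarrow> h \<in> carrier (vertex_group A v) \<Longrightarrow>
    ([Vertex_El v g, Vertex_El v h], [Vertex_El v (g \<otimes>\<^bsub>vertex_group A v\<^esub> h)]) \<in> path_relations A"
| edge_inverse: "e \<in> arcs (base_graph A) \<Longrightarrow>
    ([Edge e, Edge (einv A e)], []) \<in> path_relations A"
| edge_conj: "e \<in> arcs (base_graph A) \<Longrightarrow> a \<in> carrier (edge_group A e) \<Longrightarrow>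
    ([Edge e, Vertex_El (head (base_graph A) e) (edge_map A e a), Edge (einv A e)],
     [Vertex_El (tail (base_graph A) e) (edge_map A (einv A e) a)]) \<in> path_relations A"

text \<open>The congruence on words generated by the defining relations.\<close>

inductive_set path_cong ::
    "('v, 'e, 'g, 'h) graph_of_groups_data \<Rightarrow>
     (('v, 'e, 'g) letter list \<times> ('v, 'e, 'g) letter list) set"
  for A where
  step: "(l, r) \<in> path_relations A \<Longrightarrow> x \<in> lists (letters A) \<Longrightarrow> y \<in> lists (letters A) \<Longrightarrow>
    (x @ l @ y, x @ r @ y) \<in> path_cong A"
| refl: "x \<in> lists (letters A) \<Longrightarrow> (x, x) \<in> path_cong A"
| sym: "(x, y) \<in> path_cong A \<Longrightarrow> (y, x) \<in> path_cong A"
| trans: "(x, y) \<in> path_cong A \<Longrightarrow> (y, z) \<in> path_cong A \<Longrightarrow> (x, z) \<in> path_cong A"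

definition path_group ::
    "('v, 'e, 'g, 'h) graph_of_groups_data \<Rightarrow> ('v, 'e, 'g) letter list set monoid" where
  "path_group A =
     \<lparr>carrier = lists (letters A) // path_cong A,
      monoid.mult = (\<lambda>X Y. \<Union>x\<in>X. \<Union>y\<in>Y. path_cong A `` {x @ y}),
      monoid.one = path_cong A `` {[]}\<rparr>"

context graph_of_groups
begin

lemma edge_map_closed:
  assumes "e \<in> arcs (base_graph A)" "a \<in> carrier (edge_group A e)"
  shows "edge_map A e a \<in> carrier (vertex_group A (head (base_graph A) e))"
  using edge_map[OF assms(1)] assms(2) by (auto simp: mon_def hom_def)

lemma path_relations_letters:
  assumes "(l, r) \<in> path_relations A"
  shows "l \<in> lists (letters A)" "r \<in> lists (letters A)"
proof -
  have "l \<in> lists (letters A) \<and> r \<in> lists (letters A)"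
    using assms
  proof cases
    case (vertex_one v)
    then show ?thesis using vertex_group by (auto simp: letters_def group.is_monoid monoid.one_closed)
  next
    case (vertex_mult v g h)
    then show ?thesis using vertex_group by (auto simp: letters_def group.is_monoid monoid.m_closed)
  next
    case (edge_inverse e)
    then show ?thesis by (auto simp: letters_def)
  next
    case (edge_conj e a)
    then show ?thesis
      using edge_map_closed[of e a] edge_map_closed[of "einv A e" a]
      by (auto simp: letters_def edge_group_einv)
  qed
  then show "l \<in> lists (letters A)" "r \<in> lists (letters A)" by auto
qed

lemma path_cong_letters:
  "(x, y) \<in> path_cong A \<Longrightarrow> x \<in> lists (letters A) \<and> y \<in> lists (letters A)"
proof (induction rule: path_cong.induct)
  case (step l r x y)
  then show ?case using path_relations_letters[OF step(1)] by auto
qed auto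

lemma equiv_path_cong: "equiv (lists (letters A)) (path_cong A)"
proof (rule equivI)
  show "path_cong A \<subseteq> lists (letters A) \<times> lists (letters A)"
    using path_cong_letters by auto
  show "refl_on (lists (letters A)) (path_cong A)"
    by (auto simp: refl_on_def intro: path_cong.refl)
  show "Relation.sym (path_cong A)" by (auto simp: Relation.sym_def intro: path_cong.sym)
  show "Relation.trans (path_cong A)" by (auto simp: Relation.trans_def intro: path_cong.trans)
qed

lemma path_cong_append_left:
  assumes "(x, y) \<in> path_cong A" "u \<in> lists (letters A)"
  shows "(u @ x, u @ y) \<in> path_cong A"
  using assms
proof (induction rule: path_cong.induct)
  case (step l r x y)
  then show ?case using path_cong.step[of l r A "u @ x" y] by auto
next
  case (refl x)
  then show ?case by (intro path_cong.refl) auto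
qed (auto intro: path_cong.intros)

lemma path_cong_append_right:
  assumes "(x, y) \<in> path_cong A" "u \<in> lists (letters A)"
  shows "(x @ u, y @ u) \<in> path_cong A"
  using assms
proof (induction rule: path_cong.induct)
  case (step l r x y)
  then show ?case using path_cong.step[of l r A x "y @ u"] by auto
next
  case (refl x)
  then show ?case by (intro path_cong.refl) auto
qed (auto intro: path_cong.intros)

lemma path_cong_append:
  assumes "(x, y) \<in> path_cong A" "(x', y') \<in> path_cong A"
  shows "(x @ x', y @ y') \<in> path_cong A"
  using assms path_cong_append_left path_cong_append_right path_cong_letters
  by (meson path_cong.trans)

lemma path_group_mult:
  assumes "x \<in> lists (letters A)" "y \<in> lists (letters A)"
  shows "path_cong A `` {x} \<otimes>\<^bsub>path_group A\<^esub> path_cong A `` {y} = path_cong A `` {x @ y}"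
proof -
  have "congruent2 (path_cong A) (path_cong A) (\<lambda>x y. path_cong A `` {x @ y})"
    by (auto simp: congruent2_def intro!: equiv_class_eq[OF equiv_path_cong] path_cong_append)
  from UN_equiv_class2[OF equiv_path_cong equiv_path_cong this assms]
  show ?thesis by (simp add: path_group_def)
qed

lemma path_group_one: "\<one>\<^bsub>path_group A\<^esub> = path_cong A `` {[]}"
  by (simp add: path_group_def)

lemma path_group_carrier:
  "carrier (path_group A) = {path_cong A `` {x} | x. x \<in> lists (letters A)}"
  by (auto simp: path_group_def quotient_def)

lemma letter_inverse:
  assumes "s \<in> letters A"
  obtains t where "t \<in> letters A" "([t, s], []) \<in> path_cong A"
proof -
  consider v g where "s = Vertex_El v g" "v \<in> verts (base_graph A)" "g \<in> carrier (vertex_group A v)"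
    | e where "s = Edge e" "e \<in> arcs (base_graph A)"
    using assms by (auto simp: letters_def)
  then show thesis
  proof cases
    case (1 v g)
    interpret V: group "vertex_group A v" using 1 vertex_group by simp
    let ?t = "Vertex_El v (inv\<^bsub>vertex_group A v\<^esub> g)"
    have "([?t, s], [Vertex_El v \<one>\<^bsub>vertex_group A v\<^esub>]) \<in> path_cong A"
      using path_cong.step[OF path_relations.vertex_mult
          [of v A "inv\<^bsub>vertex_group A v\<^esub> g" g], of "[]" "[]"] 1 by simp
    moreover have "([Vertex_El v \<one>\<^bsub>vertex_group A v\<^esub>], []) \<in> path_cong A"
      using path_cong.step[OF path_relations.vertex_one[of v A], of "[]" "[]"] 1 by simp
    ultimately have "([?t, s], []) \<in> path_cong A" by (rule path_cong.trans)
    moreover have "?t \<in> letters A" using 1 by (auto simp: letters_def)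
    ultimately show ?thesis using that by blast
  next
    case (2 e)
    have "([Edge (einv A e), s], []) \<in> path_cong A"
      using path_cong.step[OF path_relations.edge_inverse[of "einv A e" A], of "[]" "[]"] 2 by simp
    moreover have "Edge (einv A e) \<in> letters A" using 2 by (auto simp: letters_def)
    ultimately show ?thesis using that by blast
  qed
qed

lemma word_inverse:
  assumes "x \<in> lists (letters A)"
  shows "\<exists>y \<in> lists (letters A). (y @ x, []) \<in> path_cong A"
  using assms
proof (induction x)
  case Nil
  then show ?case by (auto intro!: bexI[of _ "[]"] path_cong.refl)
next
  case (Cons s x)
  then have x: "x \<in> lists (letters A)" by auto
  from Cons x obtain y where y: "y \<in> lists (letters A)" "(y @ x, []) \<in> path_cong A" by auto
  from Cons obtain t where t: "t \<in> letters A" "([t, s], []) \<in> path_cong A"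
    using letter_inverse[of s] by auto
  have "(y @ [t, s] @ x, y @ [] @ x) \<in> path_cong A"
    using t y x by (intro path_cong_append_left path_cong_append_right) auto
  then have "((y @ [t]) @ s # x, []) \<in> path_cong A"
    using y path_cong.trans by fastforce
  then show ?case using y t by (intro bexI[of _ "y @ [t]"]) auto
qed

lemma group_path_group: "group (path_group A)"
proof (rule groupI)
  fix X assume "X \<in> carrier (path_group A)"
  then obtain x where x: "x \<in> lists (letters A)" "X = path_cong A `` {x}"
    by (auto simp: path_group_carrier)
  from word_inverse[OF x(1)] obtain y where
    y: "y \<in> lists (letters A)" "(y @ x, []) \<in> path_cong A" by auto
  then have "path_cong A `` {y} \<otimes>\<^bsub>path_group A\<^esub> X = \<one>\<^bsub>path_group A\<^esub>"
    using x path_group_mult path_group_one equiv_class_eq[OF equiv_path_cong] by simp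
  then show "\<exists>Y\<in>carrier (path_group A). Y \<otimes>\<^bsub>path_group A\<^esub> X = \<one>\<^bsub>path_group A\<^esub>"
    using y by (auto simp: path_group_carrier)
next
  show "\<one>\<^bsub>path_group A\<^esub> \<in> carrier (path_group A)"
    by (auto simp: path_group_carrier path_group_one intro!: exI[of _ "[]"])
next
  fix X Y assume "X \<in> carrier (path_group A)" "Y \<in> carrier (path_group A)"
  then obtain x y where xy: "x \<in> lists (letters A)" "X = path_cong A `` {x}"
      "y \<in> lists (letters A)" "Y = path_cong A `` {y}"
    by (auto simp: path_group_carrier)
  then have "X \<otimes>\<^bsub>path_group A\<^esub> Y = path_cong A `` {x @ y}" "x @ y \<in> lists (letters A)"
    by (simp_all add: path_group_mult)
  then show "X \<otimes>\<^bsub>path_group A\<^esub> Y \<in> carrier (path_group A)"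
    unfolding path_group_carrier by blast
next
  fix X Y Z
  assume "X \<in> carrier (path_group A)" "Y \<in> carrier (path_group A)" "Z \<in> carrier (path_group A)"
  then show "X \<otimes>\<^bsub>path_group A\<^esub> Y \<otimes>\<^bsub>path_group A\<^esub> Z = X \<otimes>\<^bsub>path_group A\<^esub> (Y \<otimes>\<^bsub>path_group A\<^esub> Z)"
    by (auto simp: path_group_carrier path_group_mult simp flip: in_lists_conv_set)
next
  fix X assume "X \<in> carrier (path_group A)"
  then show "\<one>\<^bsub>path_group A\<^esub> \<otimes>\<^bsub>path_group A\<^esub> X = X"
    by (auto simp: path_group_carrier path_group_one path_group_mult simp flip: in_lists_conv_set)
qed

end

text \<open>
  A path of the graph of groups is an edge path \<open>e\<^sub>1, \<dots>, e\<^sub>n\<close> starting at a vertex \<open>v\<close> together with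
  elements \<open>g\<^sub>0\<close> of the vertex group at \<open>v\<close> and \<open>g\<^sub>i\<close> of the vertex group at the head of \<open>e\<^sub>i\<close>. The
  pair \<open>(e\<^sub>i, g\<^sub>i)\<close> is an entry of the list \<open>p\<close>, and the associated word is \<open>g\<^sub>0 e\<^sub>1 g\<^sub>1 \<dots> e\<^sub>n g\<^sub>n\<close>.
\<close>

definition path_word ::
    "('v, 'e, 'g, 'h) graph_of_groups_data \<Rightarrow> 'v \<Rightarrow> 'g \<Rightarrow> ('e \<times> 'g) list \<Rightarrow> ('v, 'e, 'g) letter list"
  where
  "path_word A v g p =
     Vertex_El v g # concat (map (\<lambda>(e, h). [Edge e, Vertex_El (head (base_graph A) e) h]) p)"

definition is_path ::
    "('v, 'e, 'g, 'h) graph_of_groups_data \<Rightarrow> 'v \<Rightarrow> 'g \<Rightarrow> ('e \<times> 'g) list \<Rightarrow> 'v \<Rightarrow> bool" where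
  "is_path A v g p w \<longleftrightarrow>
     pre_digraph.awalk (base_graph A) v (map fst p) w \<and>
     g \<in> carrier (vertex_group A v) \<and>
     (\<forall>(e, h) \<in> set p. h \<in> carrier (vertex_group A (head (base_graph A) e)))"

text \<open>
  The fundamental group based at \<open>v\<close> is the subgroup of the path group consisting of the elements
  represented by closed paths at \<open>v\<close>. Up to isomorphism it does not depend on \<open>v\<close>.
\<close>

definition fundamental_group ::
    "('v, 'e, 'g, 'h) graph_of_groups_data \<Rightarrow> 'v \<Rightarrow> ('v, 'e, 'g) letter list set monoid" where
  "fundamental_group A v =
     (path_group A)\<lparr>carrier := {path_cong A `` {path_word A v g p} | g p. is_path A v g p v}\<rparr>"

context graph_of_groups
begin

lemma path_word_Cons:
  "path_word A u g ((e, k) # p) = [Vertex_El u g, Edge e] @ path_word A (head (base_graph A) e) k p"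
  by (simp add: path_word_def)

lemma is_path_Nil:
  "is_path A u g [] v \<longleftrightarrow> u = v \<and> v \<in> verts (base_graph A) \<and> g \<in> carrier (vertex_group A v)"
  by (auto simp: is_path_def awalk_Nil_iff)

lemma is_path_Cons:
  "is_path A u g ((e, k) # p) v \<longleftrightarrow>
     e \<in> arcs (base_graph A) \<and> tail (base_graph A) e = u \<and> g \<in> carrier (vertex_group A u) \<and>
     is_path A (head (base_graph A) e) k p v"
  by (auto simp: is_path_def awalk_Cons_iff)

lemma is_path_start:
  "is_path A u g p v \<Longrightarrow> u \<in> verts (base_graph A)"
  by (auto simp: is_path_def awalk_def)

lemma path_word_letters:
  "is_path A u g p v \<Longrightarrow> path_word A u g p \<in> lists (letters A)"
proof (induction p arbitrary: u g)
  case Nil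
  then show ?case by (auto simp: is_path_Nil path_word_def letters_def)
next
  case (Cons ek p)
  obtain e k where ek: "ek = (e, k)" by force
  have "u \<in> verts (base_graph A)" using Cons is_path_start by blast
  with Cons show ?case by (auto simp: ek is_path_Cons path_word_Cons letters_def)
qed

lemma path_word_mult:
  assumes "is_path A u g p v" "is_path A v h q w"
  shows "\<exists>k r. is_path A u k r w \<and>
    (path_word A u g p @ path_word A v h q, path_word A u k r) \<in> path_cong A"
  using assms(1)
proof (induction p arbitrary: u g)
  case Nil
  then have u: "u = v" "v \<in> verts (base_graph A)" and g: "g \<in> carrier (vertex_group A v)"
    by (auto simp: is_path_Nil)
  interpret V: group "vertex_group A v" using u vertex_group by simp
  have h: "h \<in> carrier (vertex_group A v)" using assms(2) by (simp add: is_path_def)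
  define t where "t = concat (map (\<lambda>(e, h). [Edge e, Vertex_El (head (base_graph A) e) h]) q)"
  have pw: "path_word A v x q = [Vertex_El v x] @ t" for x by (simp add: path_word_def t_def)
  have "t \<in> lists (letters A)" using path_word_letters[OF assms(2)] by (simp add: pw)
  then have "([] @ [Vertex_El v g, Vertex_El v h] @ t,
      [] @ [Vertex_El v (g \<otimes>\<^bsub>vertex_group A v\<^esub> h)] @ t) \<in> path_cong A"
    using u g h by (intro path_cong.step path_relations.vertex_mult) auto
  then have "(path_word A u g [] @ path_word A v h q,
      path_word A u (g \<otimes>\<^bsub>vertex_group A v\<^esub> h) q) \<in> path_cong A"
    by (simp add: pw u) (simp add: path_word_def)
  moreover have "is_path A u (g \<otimes>\<^bsub>vertex_group A v\<^esub> h) q w"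
    using assms(2) u g h by (simp add: is_path_def)
  ultimately show ?case by blast
next
  case (Cons ek p)
  obtain e k where ek: "ek = (e, k)" by force
  let ?y = "head (base_graph A) e"
  from Cons.prems have e: "e \<in> arcs (base_graph A)" "tail (base_graph A) e = u"
    "g \<in> carrier (vertex_group A u)" "is_path A ?y k p v" by (auto simp: ek is_path_Cons)
  from Cons.IH[OF e(4)] obtain l r where r: "is_path A ?y l r w"
    "(path_word A ?y k p @ path_word A v h q, path_word A ?y l r) \<in> path_cong A" by auto
  have "[Vertex_El u g, Edge e] \<in> lists (letters A)"
    using e by (auto simp: letters_def)
  from path_cong_append_left[OF r(2) this] r(1) e show ?case
    by (intro exI[of _ g] exI[of _ "(e, l) # r"]) (simp add: ek path_word_Cons is_path_Cons)
qed

lemma path_word_inverse: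
  assumes "is_path A u g p v"
  shows "\<exists>k r. is_path A v k r u \<and>
    (path_word A v k r @ path_word A u g p, []) \<in> path_cong A"
  using assms
proof (induction p arbitrary: u g)
  case Nil
  then have u: "u = v" "v \<in> verts (base_graph A)" and g: "g \<in> carrier (vertex_group A v)"
    by (auto simp: is_path_Nil)
  interpret V: group "vertex_group A v" using u vertex_group by simp
  let ?i = "inv\<^bsub>vertex_group A v\<^esub> g"
  have "([] @ [Vertex_El v ?i, Vertex_El v g] @ [],
      [] @ [Vertex_El v (?i \<otimes>\<^bsub>vertex_group A v\<^esub> g)] @ []) \<in> path_cong A"
    using u g by (intro path_cong.step path_relations.vertex_mult) auto
  moreover have "([] @ [Vertex_El v \<one>\<^bsub>vertex_group A v\<^esub>] @ [], [] @ [] @ []) \<in> path_cong A"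
    using u by (intro path_cong.step path_relations.vertex_one) auto
  ultimately have "([Vertex_El v ?i, Vertex_El v g], []) \<in> path_cong A"
    using g path_cong.trans by fastforce
  then show ?case using u g
    by (intro exI[of _ ?i] exI[of _ "[]"]) (simp add: is_path_Nil path_word_def)
next
  case (Cons ek p)
  obtain e k where ek: "ek = (e, k)" by force
  let ?y = "head (base_graph A) e"
  from Cons.prems have e: "e \<in> arcs (base_graph A)" "tail (base_graph A) e = u"
    "g \<in> carrier (vertex_group A u)" "is_path A ?y k p v" by (auto simp: ek is_path_Cons)
  then have verts: "u \<in> verts (base_graph A)" "?y \<in> verts (base_graph A)" by auto
  interpret U: group "vertex_group A u" using verts vertex_group by simp
  interpret Y: group "vertex_group A ?y" using verts vertex_group by simp
  let ?i = "inv\<^bsub>vertex_group A u\<^esub> g"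
  let ?s = "[(einv A e, ?i)]"
  let ?tail = "path_word A ?y k p"
  from Cons.IH[OF e(4)] obtain l r where r: "is_path A v l r ?y"
    "(path_word A v l r @ ?tail, []) \<in> path_cong A" by auto
  have s: "is_path A ?y \<one>\<^bsub>vertex_group A ?y\<^esub> ?s u"
    using e verts by (simp add: is_path_Cons is_path_Nil)
  from path_word_mult[OF r(1) s] obtain l' r' where r': "is_path A v l' r' u"
    "(path_word A v l r @ path_word A ?y \<one>\<^bsub>vertex_group A ?y\<^esub> ?s, path_word A v l' r') \<in> path_cong A"
    by auto
  have letters: "?tail \<in> lists (letters A)" "path_word A v l r \<in> lists (letters A)"
    "path_word A u g (ek # p) \<in> lists (letters A)"
    using path_word_letters e(4) r(1) Cons.prems by auto
  have l1: "Vertex_El ?y \<one>\<^bsub>vertex_group A ?y\<^esub> \<in> letters A" "Edge (einv A e) \<in> letters A"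
    "Edge e \<in> letters A"
    using e verts by (auto simp: letters_def)
  have a1: "([Vertex_El u ?i, Vertex_El u g], []) \<in> path_cong A"
  proof -
    have "([] @ [Vertex_El u ?i, Vertex_El u g] @ [],
        [] @ [Vertex_El u (?i \<otimes>\<^bsub>vertex_group A u\<^esub> g)] @ []) \<in> path_cong A"
      using verts e by (intro path_cong.step path_relations.vertex_mult) auto
    moreover have "([] @ [Vertex_El u \<one>\<^bsub>vertex_group A u\<^esub>] @ [], [] @ [] @ []) \<in> path_cong A"
      using verts by (intro path_cong.step path_relations.vertex_one) auto
    ultimately show ?thesis using U.l_inv[OF e(3)] by (metis append_Nil append_Nil2 path_cong.trans)
  qed
  have a2: "([Edge (einv A e), Edge e], []) \<in> path_cong A"
    using path_cong.step[OF path_relations.edge_inverse[of "einv A e" A], of "[]" "[]"] e by simp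
  have a3: "([Vertex_El ?y \<one>\<^bsub>vertex_group A ?y\<^esub>], []) \<in> path_cong A"
    using path_cong.step[OF path_relations.vertex_one[of ?y A], of "[]" "[]"] verts by simp
  have b1: "([Edge (einv A e)] @ [Vertex_El u ?i, Vertex_El u g] @ [Edge e],
      [Edge (einv A e)] @ [] @ [Edge e]) \<in> path_cong A"
    using a1 l1 by (intro path_cong_append_left path_cong_append_right) auto
  then have b2: "([Edge (einv A e)] @ [Vertex_El u ?i, Vertex_El u g] @ [Edge e], []) \<in> path_cong A"
    using a2 path_cong.trans by fastforce
  from path_cong_append[OF a3 this]
  have "([Vertex_El ?y \<one>\<^bsub>vertex_group A ?y\<^esub>, Edge (einv A e), Vertex_El u ?i, Vertex_El u g, Edge e],
      []) \<in> path_cong A" by simp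
  then have "(path_word A v l r @ [Vertex_El ?y \<one>\<^bsub>vertex_group A ?y\<^esub>, Edge (einv A e),
      Vertex_El u ?i, Vertex_El u g, Edge e] @ ?tail, path_word A v l r @ [] @ ?tail) \<in> path_cong A"
    using letters by (intro path_cong_append_left path_cong_append_right) auto
  then have "((path_word A v l r @ path_word A ?y \<one>\<^bsub>vertex_group A ?y\<^esub> ?s) @ path_word A u g (ek # p),
      path_word A v l r @ ?tail) \<in> path_cong A"
    using e by (simp add: ek path_word_Cons) (simp add: path_word_def)
  moreover have "((path_word A v l r @ path_word A ?y \<one>\<^bsub>vertex_group A ?y\<^esub> ?s) @ path_word A u g (ek # p),
      path_word A v l' r' @ path_word A u g (ek # p)) \<in> path_cong A"
    using r'(2) letters by (intro path_cong_append_right)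
  ultimately have "(path_word A v l' r' @ path_word A u g (ek # p), []) \<in> path_cong A"
    using r(2) by (meson path_cong.sym path_cong.trans)
  with r'(1) show ?case by blast
qed

lemma subgroup_fundamental_group:
  assumes "v \<in> verts (base_graph A)"
  shows "subgroup (carrier (fundamental_group A v)) (path_group A)"
proof -
  interpret P: group "path_group A" by (rule group_path_group)
  interpret V: group "vertex_group A v" using assms vertex_group by simp
  let ?H = "{path_cong A `` {path_word A v g p} | g p. is_path A v g p v}"
  have "subgroup ?H (path_group A)"
  proof (rule P.subgroupI)
    show "?H \<subseteq> carrier (path_group A)"
      using path_word_letters unfolding path_group_carrier by blast
    have "is_path A v \<one>\<^bsub>vertex_group A v\<^esub> [] v" using assms by (simp add: is_path_Nil)
    then show "?H \<noteq> {}" by blast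
  next
    fix X assume "X \<in> ?H"
    then obtain g p where X: "X = path_cong A `` {path_word A v g p}" "is_path A v g p v" by blast
    from path_word_inverse[OF X(2)] obtain k r where r: "is_path A v k r v"
      "(path_word A v k r @ path_word A v g p, []) \<in> path_cong A" by blast
    let ?Y = "path_cong A `` {path_word A v k r}"
    have "?Y \<otimes>\<^bsub>path_group A\<^esub> X = \<one>\<^bsub>path_group A\<^esub>"
      using path_word_letters X r equiv_class_eq[OF equiv_path_cong r(2)]
      by (simp add: path_group_mult path_group_one)
    moreover have "X \<in> carrier (path_group A)" "?Y \<in> carrier (path_group A)"
      using path_word_letters X r unfolding path_group_carrier by blast+
    ultimately have "inv\<^bsub>path_group A\<^esub> X = ?Y" by (simp add: P.inv_equality)
    then show "inv\<^bsub>path_group A\<^esub> X \<in> ?H" using r by blast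
  next
    fix X Y assume "X \<in> ?H" "Y \<in> ?H"
    then obtain g p h q where X: "X = path_cong A `` {path_word A v g p}" "is_path A v g p v"
      and Y: "Y = path_cong A `` {path_word A v h q}" "is_path A v h q v" by blast
    from path_word_mult[OF X(2) Y(2)] obtain k r where r: "is_path A v k r v"
      "(path_word A v g p @ path_word A v h q, path_word A v k r) \<in> path_cong A" by blast
    have "X \<otimes>\<^bsub>path_group A\<^esub> Y = path_cong A `` {path_word A v k r}"
      using path_word_letters X Y equiv_class_eq[OF equiv_path_cong r(2)]
      by (simp add: path_group_mult)
    then show "X \<otimes>\<^bsub>path_group A\<^esub> Y \<in> ?H" using r by blast
  qed
  then show ?thesis by (simp add: fundamental_group_def)
qed

lemma group_fundamental_group:
  assumes "v \<in> verts (base_graph A)"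
  shows "group (fundamental_group A v)"
  using group.subgroup_imp_group[OF group_path_group subgroup_fundamental_group[OF assms]]
  by (simp add: fundamental_group_def)

end

end

theory Submission
  imports Defs
begin

text \<open>
  The idea is to let everything act on sets \<open>X \<times> \<int>\<close> with \<open>X\<close> finite, by maps commuting with the shift of
  \<open>\<int>\<close>. If such an action of a group is faithful on the powers of \<open>g\<close>, then \<open>\<langle>g\<rangle>\<close> is a virtual retract:
  the kernel \<open>N\<close> of the action on \<open>X\<close> has finite index, and either it meets \<open>\<langle>g\<rangle>\<close> trivially or one of
  the translation lengths \<open>N \<rightarrow> \<int>\<close> is nonzero on a power of \<open>g\<close>. Conversely, a retraction of a
  finite-index subgroup onto \<open>\<langle>g\<rangle>\<close> induces such an action, and property (VRC) also gives residual
  finiteness, so that finitely many nontrivial elements can be made to move all points of \<open>X\<close>.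

  Let the vertex groups act in this way on a common \<open>X \<times> \<int>\<close>, the edge groups freely on \<open>X\<close>. Any two free
  actions of a finite edge group are isomorphic, since all orbits have the same size; choosing an isomorphism
  for each edge extends the actions to the path group. For an element of a vertex group any choice will
  do. Any other element is conjugate to a vertex element or to a reduced cycle \<open>e\<^sub>1 g\<^sub>1 \<dots> e\<^sub>n g\<^sub>n\<close>, and for the
  latter the isomorphisms can be chosen such that the cycle sends some \<open>(x, k)\<close> to \<open>(x, k + 1)\<close>.
\<close>

section \<open>Subgroups of finite index and virtual retracts\<close>

text \<open>The factor \<open>\<int>\<close> is what keeps infinite order visible: permutations of a
  finite set alone would only give finite quotients, in which some power of \<open>g\<close> always
  dies.

  The obstacle is gluing along an edge. The two vertex actions, restricted to the edge group, need
  not be isomorphic as permutation actions. Freeness together with equal size removes this. Equal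
  size comes from a product of sets over all vertices, in which each vertex group moves only its own
  coordinate. Freeness comes from residual finiteness, and finiteness of the edge groups makes it a
  condition on finitely many elements.

  For a reduced cycle the isomorphisms are prescribed at some points, and such prescriptions can
  clash when the cycle traverses an edge repeatedly. Hence the points are placed on \<open>n\<close>
  invariant levels, one for each edge of the cycle. The only clash left on a single level comes from
  consecutive edges \<open>e\<close>, \<open>einv A e\<close>. It is excluded by letting the
  elements \<open>b g\<^sub>i\<close>, with \<open>b\<close> in the image of the edge group, move
  all points of \<open>X\<close>; reducedness says that these elements are nontrivial.\<close>

definition finite_index :: "'a set \<Rightarrow> ('a, 'm) monoid_scheme \<Rightarrow> bool" where
  "finite_index K G \<longleftrightarrow> subgroup K G \<and> finite (rcosets\<^bsub>G\<^esub> K)"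

definition additive_on :: "('a, 'm) monoid_scheme \<Rightarrow> 'a set \<Rightarrow> ('a \<Rightarrow> int) \<Rightarrow> bool" where
  "additive_on G K f \<longleftrightarrow> (\<forall>a\<in>K. \<forall>b\<in>K. f (a \<otimes>\<^bsub>G\<^esub> b) = f a + f b)"

lemma finite_range_mod: "finite (range (\<lambda>i::int. i mod c))" if "c \<noteq> 0"
proof (rule finite_subset)
  show "range (\<lambda>i::int. i mod c) \<subseteq> {-\<bar>c\<bar>..\<bar>c\<bar>}"
  proof safe
    fix i :: int
    have "\<bar>i mod c\<bar> < \<bar>c\<bar>" using that by (rule abs_mod_less)
    then show "i mod c \<in> {-\<bar>c\<bar>..\<bar>c\<bar>}" by auto
  qed
qed simp

context group
begin

lemma rcos_eq_iff:
  assumes "subgroup K G" "a \<in> carrier G" "b \<in> carrier G"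
  shows "K #> a = K #> b \<longleftrightarrow> a \<otimes> inv b \<in> K"
proof
  assume "K #> a = K #> b"
  then have "a \<in> K #> b" using rcos_self assms by metis
  then obtain k where "k \<in> K" "a = k \<otimes> b" by (auto simp: r_coset_def)
  then show "a \<otimes> inv b \<in> K"
    using assms subgroup.mem_carrier by (fastforce simp: m_assoc)
next
  assume *: "a \<otimes> inv b \<in> K"
  have "a = (a \<otimes> inv b) \<otimes> b" using assms by (simp add: m_assoc)
  then have "a \<in> K #> b" using * by (auto simp: r_coset_def)
  then show "K #> a = K #> b" using repr_independence assms by metis
qed

lemma finite_index_subgroup: "finite_index K G \<Longrightarrow> subgroup K G"
  by (simp add: finite_index_def)

text \<open>One element chosen from each fibre of \<open>q\<close> represents every coset. This form
  suits the maps at hand, such as induced permutations, whose fibres lie in cosets without being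
  cosets.\<close>

lemma finite_indexI:
  assumes "subgroup K G" "finite F" "q \<in> carrier G \<rightarrow> F"
    and "\<And>a b. a \<in> carrier G \<Longrightarrow> b \<in> carrier G \<Longrightarrow> q a = q b \<Longrightarrow> a \<otimes> inv b \<in> K"
  shows "finite_index K G"
proof -
  have "rcosets K \<subseteq> (\<lambda>s. K #> (SOME a. a \<in> carrier G \<and> q a = s)) ` F"
  proof
    fix C assume "C \<in> rcosets K"
    then obtain a where a: "a \<in> carrier G" "C = K #> a" by (auto simp: RCOSETS_def)
    define b where "b = (SOME b. b \<in> carrier G \<and> q b = q a)"
    have "b \<in> carrier G \<and> q b = q a" unfolding b_def by (rule someI) (use a in auto)
    then have "C = K #> b" using a assms rcos_eq_iff by metis
    moreover have "q a \<in> F" using a assms by auto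
    ultimately show "C \<in> (\<lambda>s. K #> (SOME a. a \<in> carrier G \<and> q a = s)) ` F"
      unfolding b_def by blast
  qed
  then have "finite (rcosets K)" using assms(2) finite_surj by metis
  then show ?thesis using assms(1) by (simp add: finite_index_def)
qed

lemma finite_index_trans:
  assumes K: "finite_index K G" and M: "subgroup M G" "M \<subseteq> K" and F: "finite F" "q \<in> K \<rightarrow> F"
    and eq: "\<And>a b. a \<in> K \<Longrightarrow> b \<in> K \<Longrightarrow> q a = q b \<Longrightarrow> a \<otimes> inv b \<in> M"
  shows "finite_index M G"
proof -
  have sK: "subgroup K G" and fK: "finite (rcosets K)" using K by (auto simp: finite_index_def)
  \<comment> \<open>The representative depends on the coset only. Elements \<open>a\<close> and
    \<open>b\<close> of the same coset therefore share it, and it cancels in the quotient of their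
    \<open>K\<close>-parts.\<close>
  define r where "r x = (SOME y. y \<in> K #> x)" for x
  have r: "r x \<in> carrier G" "x \<otimes> inv (r x) \<in> K" if "x \<in> carrier G" for x
  proof -
    have "r x \<in> K #> x" unfolding r_def by (rule someI) (rule rcos_self[OF that sK])
    then show "r x \<in> carrier G" "x \<otimes> inv (r x) \<in> K"
      using that sK rcos_eq_iff[OF sK that, of "r x"] repr_independence[OF _ that sK]
        r_coset_subset_G[OF subgroup.subset[OF sK] that] by auto
  qed
  show ?thesis
  proof (rule finite_indexI[OF M(1), of "(rcosets K) \<times> F" "\<lambda>x. (K #> x, q (x \<otimes> inv (r x)))"])
    show "finite ((rcosets K) \<times> F)" using fK F by simp
    show "(\<lambda>x. (K #> x, q (x \<otimes> inv (r x)))) \<in> carrier G \<rightarrow> (rcosets K) \<times> F"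
      using r F rcosetsI[OF subgroup.subset[OF sK]] by auto
  next
    fix a b assume ab: "a \<in> carrier G" "b \<in> carrier G"
      and e: "(K #> a, q (a \<otimes> inv (r a))) = (K #> b, q (b \<otimes> inv (r b)))"
    then have rr: "r a = r b" by (simp add: r_def)
    have "(a \<otimes> inv (r a)) \<otimes> inv (b \<otimes> inv (r b)) \<in> M"
      using e r ab by (intro eq) auto
    moreover have "(a \<otimes> inv (r a)) \<otimes> inv (b \<otimes> inv (r b)) = a \<otimes> inv b"
    proof -
      have "inv (r b) \<otimes> (r b \<otimes> inv b) = inv b" using ab r by (simp flip: m_assoc)
      then show ?thesis using ab r by (simp add: rr inv_mult_group m_assoc)
    qed
    ultimately show "a \<otimes> inv b \<in> M" by simp
  qed
qed

lemma finite_index_superset: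
  assumes "finite_index M G" "subgroup K G" "M \<subseteq> K"
  shows "finite_index K G"
proof (rule finite_indexI[OF assms(2), of "rcosets M" "\<lambda>x. M #> x"])
  have M: "subgroup M G" using assms by (simp add: finite_index_def)
  show "finite (rcosets M)" using assms by (simp add: finite_index_def)
  show "(\<lambda>x. M #> x) \<in> carrier G \<rightarrow> rcosets M" using rcosetsI[OF subgroup.subset[OF M]] by auto
  show "a \<otimes> inv b \<in> K" if "a \<in> carrier G" "b \<in> carrier G" "M #> a = M #> b" for a b
    using rcos_eq_iff[OF M] that assms(3) by auto
qed

lemma finite_index_Int:
  assumes "finite_index K G" "finite_index M G"
  shows "finite_index (K \<inter> M) G"
proof (rule finite_index_trans[OF assms(1), of _ "rcosets M" "\<lambda>x. M #> x"])
  have K: "subgroup K G" and M: "subgroup M G" using assms by (simp_all add: finite_index_def)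
  show "subgroup (K \<inter> M) G" using K M subgroups_Inter_pair by blast
  show "finite (rcosets M)" using assms by (simp add: finite_index_def)
  show "(\<lambda>x. M #> x) \<in> K \<rightarrow> rcosets M"
    using rcosetsI[OF subgroup.subset[OF M]] subgroup.mem_carrier[OF K] by auto
  show "a \<otimes> inv b \<in> K \<inter> M" if "a \<in> K" "b \<in> K" "M #> a = M #> b" for a b
    using rcos_eq_iff[OF M] that subgroup.mem_carrier[OF K] K
    by (simp add: subgroup.m_closed subgroup.m_inv_closed)
qed simp

lemma finite_index_carrier: "finite_index (carrier G) G"
  by (rule finite_indexI[OF subgroup_self, of "{()}" "\<lambda>_. ()"]) auto

lemma additive_on_one:
  assumes "additive_on G K f" "subgroup K G"
  shows "f \<one> = 0"
proof -
  have "f (\<one> \<otimes> \<one>) = f \<one> + f \<one>"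
    using assms subgroup.one_closed unfolding additive_on_def by blast
  then show ?thesis by simp
qed

lemma additive_on_int_pow:
  assumes "additive_on G K f" "subgroup K G" "g \<in> K"
  shows "f (g [^] (k::int)) = k * f g"
proof (induction k rule: int_induct[where k=0])
  case base
  then show ?case using additive_on_one assms by simp
next
  have g: "g \<in> carrier G" using assms subgroup.mem_carrier by metis
  have P: "g [^] (k::int) \<in> K" for k using subgroup_int_pow_closed assms by auto
  have S: "f (g [^] (k + 1)) = f (g [^] k) + f g" for k :: int
    using assms P[of k] int_pow_mult[OF g, of k 1] g by (simp add: additive_on_def)
  {
    case (step1 i)
    then show ?case using S[of i] by (simp add: algebra_simps)
  next
    case (step2 i)
    then show ?case using S[of "i - 1"] by (simp add: algebra_simps)
  }
qed

lemma additive_on_conj: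
  assumes f: "additive_on G K f" and K: "subgroup K G" and a: "a \<in> K" and b: "b \<in> K"
  shows "f (a \<otimes> b \<otimes> inv a) = f b"
proof -
  have c: "a \<in> carrier G" "b \<in> carrier G" using a b K subgroup.mem_carrier by metis+
  have "f (a \<otimes> b \<otimes> inv a) = f a + f b + f (inv a)"
    using assms by (simp add: additive_on_def subgroup.m_closed subgroup.m_inv_closed)
  moreover have "f (a \<otimes> inv a) = f a + f (inv a)"
    using assms by (simp add: additive_on_def subgroup.m_inv_closed)
  ultimately show ?thesis using additive_on_one[OF f K] c by simp
qed

lemma mem_generate_iff:
  "g \<in> carrier G \<Longrightarrow> h \<in> generate G {g} \<longleftrightarrow> (\<exists>k::int. h = g [^] k)"
  by (auto simp: generate_pow)

text \<open>A homomorphism into the cyclic group that fixes the generator fixes all its powers, so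
  only \<open>\<rho> g = g\<close> has to be checked.\<close>

lemma virtual_retractI:
  assumes L: "finite_index L G" and g: "g \<in> L"
    and \<rho>: "\<And>x. x \<in> L \<Longrightarrow> \<rho> x \<in> generate G {g}"
      "\<And>x y. x \<in> L \<Longrightarrow> y \<in> L \<Longrightarrow> \<rho> (x \<otimes> y) = \<rho> x \<otimes> \<rho> y" "\<rho> g = g"
  shows "virtual_retract (generate G {g}) G"
proof -
  have sL: "subgroup L G" using L by (simp add: finite_index_def)
  have gc: "g \<in> carrier G" using g sL subgroup.mem_carrier by metis
  let ?H = "generate G {g}"
  have sH: "subgroup ?H G" using gc by (intro generate_is_subgroup) auto
  have HL: "?H \<subseteq> L" using g sL by (intro generate_subgroup_incl) auto
  interpret L: group "G\<lparr>carrier := L\<rparr>" by (rule subgroup_imp_group[OF sL])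
  interpret H: group "G\<lparr>carrier := ?H\<rparr>" by (rule subgroup_imp_group[OF sH])
  have hom: "\<rho> \<in> hom (G\<lparr>carrier := L\<rparr>) (G\<lparr>carrier := ?H\<rparr>)"
    using \<rho> by (auto simp: hom_def)
  interpret h: group_hom "G\<lparr>carrier := L\<rparr>" "G\<lparr>carrier := ?H\<rparr>" \<rho>
    using hom by unfold_locales
  have "\<rho> h = h" if "h \<in> ?H" for h
    using that
  proof (induction rule: generate.induct)
    case one
    then show ?case using h.hom_one by simp
  next
    case (incl h)
    then show ?case using \<rho> by simp
  next
    case (inv h)
    then show ?case using h.hom_inv[of g] \<rho>(3) g m_inv_consistent[OF sL g]
        m_inv_consistent[OF sH generate.incl[of g]] by simp
  next
    case (eng h1 h2)
    then show ?case using \<rho> HL by (metis subsetD)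
  qed
  then show ?thesis
    unfolding virtual_retract_def group_retract_def
    using sH L sL HL hom subgroup_incl[OF sH sL HL]
    by (intro conjI exI[of _ L] bexI[of _ \<rho>]) (auto simp: finite_index_def)
qed

text \<open>The retraction sends \<open>x\<close> to \<open>g\<close> to the power
  \<open>F x div F g\<close>. It is a homomorphism where the division is exact, that is on
  \<open>L\<close>, and \<open>L\<close> is cut out of \<open>K\<close> by finitely many residues
  modulo \<open>F g\<close>.\<close>

lemma virtual_retract_if_additive:
  assumes K: "finite_index K G" and g: "g \<in> K" and F: "additive_on G K F" "F g \<noteq> 0"
  shows "virtual_retract (generate G {g}) G"
proof -
  have sK: "subgroup K G" using K by (simp add: finite_index_def)
  have gc: "g \<in> carrier G" using g sK subgroup.mem_carrier by metis
  define L where "L = {x \<in> K. F g dvd F x}"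
  have Fi: "F (inv x) = - F x" if "x \<in> K" for x
    using additive_on_int_pow[OF F(1) sK that, of "-1"] that subgroup.mem_carrier[OF sK]
    by (simp add: int_pow_neg)
  have sL: "subgroup L G"
  proof (rule subgroupI)
    show "L \<subseteq> carrier G" using subgroup.subset[OF sK] by (auto simp: L_def)
    show "L \<noteq> {}" using g by (auto simp: L_def)
    show "inv a \<in> L" if "a \<in> L" for a
      using that Fi sK by (auto simp: L_def subgroup.m_inv_closed)
    show "a \<otimes> b \<in> L" if "a \<in> L" "b \<in> L" for a b
      using that F(1) sK by (auto simp: L_def additive_on_def subgroup.m_closed)
  qed
  have fL: "finite_index L G"
  proof (rule finite_index_trans[OF K sL, of "range (\<lambda>i. i mod F g)" "\<lambda>x. F x mod F g"])
    show "a \<otimes> inv b \<in> L" if "a \<in> K" "b \<in> K" "F a mod F g = F b mod F g" for a b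
    proof -
      have "F (a \<otimes> inv b) = F a - F b"
        using that F(1) Fi sK by (simp add: additive_on_def subgroup.m_inv_closed)
      then show ?thesis
        using that sK by (simp add: L_def subgroup.m_inv_closed subgroup.m_closed mod_eq_dvd_iff)
    qed
  qed (use F finite_range_mod in \<open>auto simp: L_def\<close>)
  show ?thesis
  proof (rule virtual_retractI[OF fL, of g "\<lambda>x. g [^] (F x div F g)"])
    show "g \<in> L" using g by (simp add: L_def)
    show "g [^] (F x div F g) \<in> generate G {g}" for x
      using gc by (auto simp: mem_generate_iff)
    show "g [^] (F (x \<otimes> y) div F g) = g [^] (F x div F g) \<otimes> g [^] (F y div F g)"
      if "x \<in> L" "y \<in> L" for x y
      using that gc F by (simp add: L_def additive_on_def int_pow_mult[symmetric] div_plus_div_distrib_dvd_left)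
    show "g [^] (F g div F g) = g" using F gc by simp
  qed
qed

end

section \<open>Extension from a normal subgroup \<open>H\<close> to its product with a cyclic
  group\<close>

context normal
begin

lemma conj_int_pow_closed:
  assumes "g \<in> carrier G" "k \<in> H"
  shows "g [^] (i::int) \<otimes> k \<otimes> g [^] (-i) \<in> H"
  using inv_op_closed2[of "g [^] i" k] assms by (simp add: int_pow_neg)

text \<open>The elements having an exponent form the product of \<open>H\<close> with the cyclic
  group of \<open>g\<close>. The exponent is determined only up to those \<open>k\<close> for which
  the \<open>k\<close>-th power of \<open>g\<close> lies in \<open>H\<close>.\<close>

definition exponent_of :: "'a \<Rightarrow> 'a \<Rightarrow> int \<Rightarrow> bool" where
  "exponent_of g x i \<longleftrightarrow> x \<in> carrier G \<and> x \<otimes> g [^] (-i) \<in> H"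

text \<open>Both factors on the right lie in \<open>H\<close> when \<open>i\<close> and
  \<open>j\<close> are exponents of \<open>x\<close> and \<open>y\<close>. The identity thus shows
  that exponents add up, and later evaluates an additive function on the \<open>H\<close>-part of a
  product.\<close>

lemma exponent_of_split:
  assumes "g \<in> carrier G" "x \<in> carrier G" "y \<in> carrier G"
  shows "x \<otimes> y \<otimes> g [^] (-(i + j)) =
    (x \<otimes> g [^] (-i)) \<otimes> (g [^] (i::int) \<otimes> (y \<otimes> g [^] (-j)) \<otimes> g [^] (-i))"
proof -
  have "g [^] (-i) \<otimes> (g [^] i \<otimes> z) = z" if "z \<in> carrier G" for z
    using assms that by (simp add: m_assoc[symmetric] int_pow_mult[symmetric])
  moreover have "g [^] (-(i + j)) = g [^] (-j) \<otimes> g [^] (-i)"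
    using assms by (simp add: int_pow_mult[symmetric] algebra_simps)
  ultimately show ?thesis using assms by (simp add: m_assoc)
qed

lemma exponent_of_mult:
  assumes g: "g \<in> carrier G" and "exponent_of g x i" "exponent_of g y j"
  shows "exponent_of g (x \<otimes> y) (i + j)"
  using assms exponent_of_split[of g x y i j] conj_int_pow_closed[OF g]
  by (simp add: exponent_of_def)

lemma exponent_of_inv:
  assumes g: "g \<in> carrier G" and x: "exponent_of g x i"
  shows "exponent_of g (inv x) (-i)"
proof -
  have xc: "x \<in> carrier G" "x \<otimes> g [^] (-i) \<in> H" using x by (auto simp: exponent_of_def)
  have "inv x \<otimes> inv (x \<otimes> g [^] (-i)) \<otimes> inv (inv x) \<in> H"
    using xc by (intro inv_op_closed2) auto
  also have "inv x \<otimes> inv (x \<otimes> g [^] (-i)) \<otimes> inv (inv x) = inv x \<otimes> g [^] (-(-i))"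
    using xc g by (simp add: inv_mult_group m_assoc int_pow_neg)
  finally show ?thesis using xc by (simp add: exponent_of_def)
qed

lemma exponent_of_diff:
  assumes g: "g \<in> carrier G" and "exponent_of g x i" "exponent_of g x j"
  shows "g [^] (i - j) \<in> H"
    "x \<otimes> g [^] (-j) = (x \<otimes> g [^] (-i)) \<otimes> g [^] (i - j)"
proof -
  have x: "x \<in> carrier G" using assms by (simp add: exponent_of_def)
  show eq: "x \<otimes> g [^] (-j) = (x \<otimes> g [^] (-i)) \<otimes> g [^] (i - j)"
    using x g by (simp add: m_assoc int_pow_mult[symmetric])
  have "g [^] (i - j) = inv (x \<otimes> g [^] (-i)) \<otimes> (x \<otimes> g [^] (-j))"
    unfolding eq using x g by (intro inv_solve_left[THEN iffD2]) auto
  then show "g [^] (i - j) \<in> H" using assms by (simp add: exponent_of_def)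
qed

lemma exponent_of_self: "g \<in> carrier G \<Longrightarrow> exponent_of g g 1"
  by (simp add: exponent_of_def int_pow_neg)

lemma finite_index_exponent_of:
  assumes g: "g \<in> carrier G" and H: "finite_index H G"
  shows "finite_index {x. \<exists>i. exponent_of g x i} G"
proof (rule finite_index_superset[OF H])
  show "subgroup {x. \<exists>i. exponent_of g x i} G"
  proof (rule subgroupI)
    show "{x. \<exists>i. exponent_of g x i} \<subseteq> carrier G" by (auto simp: exponent_of_def)
    show "{x. \<exists>i. exponent_of g x i} \<noteq> {}" using exponent_of_self[OF g] by blast
  qed (use exponent_of_mult[OF g] exponent_of_inv[OF g] in blast)+
  show "H \<subseteq> {x. \<exists>i. exponent_of g x i}"
    by (auto simp: exponent_of_def intro!: exI[of _ "0::int"])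
qed

text \<open>The product of \<open>H\<close> and the cyclic group is then semidirect, and the
  retraction is the projection with kernel \<open>H\<close>. For \<open>g\<close> of finite order
  the exponent is ambiguous, but the corresponding power of \<open>g\<close> is not.\<close>

lemma virtual_retract_if_trivial_Int:
  assumes g: "g \<in> carrier G" and H: "finite_index H G"
    and triv: "\<And>i::int. g [^] i \<in> H \<Longrightarrow> g [^] i = \<one>"
  shows "virtual_retract (generate G {g}) G"
proof (rule virtual_retractI[OF finite_index_exponent_of[OF g H],
      of g "\<lambda>x. g [^] (SOME i. exponent_of g x i)"])
  have uniq: "g [^] i = g [^] j" if "exponent_of g x i" "exponent_of g x j" for x i j
  proof -
    have "g [^] (i - j) = \<one>" using exponent_of_diff(1)[OF g that] triv by blast
    then have "g [^] ((i - j) + j) = g [^] j" using g by (simp only: int_pow_mult) simp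
    then show ?thesis by simp
  qed
  show "g [^] (SOME i. exponent_of g g i) = g"
    using uniq[OF someI[of "exponent_of g g", OF exponent_of_self[OF g]] exponent_of_self[OF g]] g
    by simp
  show "g \<in> {x. \<exists>i. exponent_of g x i}" using exponent_of_self[OF g] by blast
  show "g [^] (SOME i. exponent_of g x i) \<in> generate G {g}" for x
    using g mem_generate_iff by blast
  fix x y
  assume "x \<in> {x. \<exists>i. exponent_of g x i}" "y \<in> {x. \<exists>i. exponent_of g x i}"
  then have x: "exponent_of g x (SOME i. exponent_of g x i)"
    and y: "exponent_of g y (SOME i. exponent_of g y i)" by (auto intro: someI_ex)
  from exponent_of_mult[OF g x y] have xy: "exponent_of g (x \<otimes> y) (SOME i. exponent_of g (x \<otimes> y) i)"
    by (auto intro: someI_ex)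
  show "g [^] (SOME i. exponent_of g (x \<otimes> y) i) =
      g [^] (SOME i. exponent_of g x i) \<otimes> g [^] (SOME i. exponent_of g y i)"
    using uniq[OF xy exponent_of_mult[OF g x y]] g by (simp add: int_pow_mult)
qed

text \<open>
  Averaging \<open>f\<close> over the conjugates by \<open>g\<^sup>0, \<dots>, g\<^sup>m\<^sup>-\<^sup>1\<close> makes it invariant under \<open>g\<close>; the average
  then extends from \<open>H\<close> to the subgroup generated by \<open>H\<close> and \<open>g\<close>.
\<close>

lemma virtual_retract_if_normal_additive:
  assumes g: "g \<in> carrier G" and H: "finite_index H G" and f: "additive_on G H f"
    and m: "g [^] (m::nat) \<in> H" "f (g [^] m) \<noteq> 0"
  shows "virtual_retract (generate G {g}) G"
proof -
  define c where "c = f (g [^] m)"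
  define conj where "conj k i = g [^] i \<otimes> k \<otimes> g [^] (-i)" for k and i :: int
  define F where "F k = (\<Sum>j<m. f (conj k (int j)))" for k
  have cH: "conj k i \<in> H" if "k \<in> H" for k i
    using conj_int_pow_closed[OF g that] by (simp add: conj_def)
  have conj_conj: "conj (conj k i) j = conj k (j + i)" if "k \<in> H" for k i j
  proof -
    have "g [^] (- (j + i)) = g [^] (-i) \<otimes> g [^] (-j)"
      using int_pow_mult[OF g, of "-i" "-j"] by (simp add: algebra_simps)
    then show ?thesis
      using g that by (simp add: conj_def m_assoc int_pow_mult)
  qed
  have conj_mult: "conj (a \<otimes> b) i = conj a i \<otimes> conj b i" if "a \<in> H" "b \<in> H" for a b i
  proof -
    have "g [^] (-i) \<otimes> (g [^] i \<otimes> z) = z" if "z \<in> carrier G" for z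
      using g that by (simp add: m_assoc[symmetric] int_pow_mult[symmetric])
    then show ?thesis using g that by (simp add: conj_def m_assoc)
  qed
  have Fadd: "F (a \<otimes> b) = F a + F b" if "a \<in> H" "b \<in> H" for a b
    using f that cH by (simp add: F_def conj_mult sum.distrib additive_on_def)
  \<comment> \<open>Conjugation by \<open>g\<close> moves the window of summation by one. The term
    that enters equals the term that leaves, because \<open>g\<close> to the power \<open>m\<close>
    lies in \<open>H\<close> and \<open>f\<close> is invariant under conjugation by elements of
    \<open>H\<close>.\<close>
  have F1: "F (conj k 1) = F k" if k: "k \<in> H" for k
  proof -
    have "conj k (int m) = g [^] m \<otimes> k \<otimes> inv (g [^] m)"
      using g by (simp add: conj_def int_pow_neg int_pow_int)
    then have fm: "f (conj k (int m)) = f k"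
      using additive_on_conj[OF f subgroup_axioms m(1) k] by simp
    have f0: "f (conj k 0) = f k" using k by (simp add: conj_def)
    have "F (conj k 1) = (\<Sum>j<m. f (conj k (int (Suc j))))"
      by (simp add: F_def conj_conj[OF k] add.commute)
    also have "\<dots> = F k + f (conj k (int m)) - f (conj k 0)"
      unfolding F_def by (induction m) auto
    finally show ?thesis using fm f0 by simp
  qed
  have Finv: "F (conj k i) = F k" if k: "k \<in> H" for k i
  proof (induction i rule: int_induct[where k=0])
    case base
    then show ?case using k by (simp add: conj_def)
  next
    case (step1 i)
    then show ?case using F1[OF cH[OF k], of i] by (simp add: conj_conj[OF k] add.commute)
  next
    case (step2 i)
    then show ?case using F1[OF cH[OF k], of "i - 1"] by (simp add: conj_conj[OF k])
  qed
  \<comment> \<open>Conjugation by \<open>g\<close> fixes its powers, so averaging multiplies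
    \<open>f\<close> by \<open>m\<close> there, and the factor \<open>m\<close> turns the
    \<open>t\<close>-th power of \<open>g\<close> into the \<open>t\<close>-th power of
    \<open>g [^] m\<close>. Hence \<open>c\<close> is the value that any extension of
    \<open>F\<close> must give to \<open>g\<close>.\<close>
  have Fpow: "F (g [^] t) = t * c" if t: "g [^] t \<in> H" for t :: int
  proof -
    have "conj (g [^] t) i = g [^] t" for i
      using g by (simp add: conj_def int_pow_mult[symmetric])
    then have "F (g [^] t) = int m * f (g [^] t)" by (simp add: F_def)
    also have "\<dots> = f ((g [^] t) [^] int m)"
      using additive_on_int_pow[OF f subgroup_axioms t, of "int m"] by simp
    also have "(g [^] t) [^] int m = (g [^] m) [^] t"
      using g by (simp add: int_pow_pow mult.commute flip: int_pow_int)
    also have "f \<dots> = t * c"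
      using additive_on_int_pow[OF f subgroup_axioms m(1), of t] by (simp add: c_def)
    finally show ?thesis .
  qed
  let ?K = "{x. \<exists>i. exponent_of g x i}"
  define E where "E x = (SOME i. exponent_of g x i)" for x
  \<comment> \<open>By \<open>Fpow\<close>, changing the exponent changes the two summands by
    opposite amounts, so every exponent of \<open>x\<close> may be used to compute
    \<open>\<Phi> x\<close>.\<close>
  define \<Phi> where "\<Phi> x = F (x \<otimes> g [^] (- E x)) + E x * c" for x
  have \<Phi>: "\<Phi> x = F (x \<otimes> g [^] (-i)) + i * c" if i: "exponent_of g x i" for x i
  proof -
    have e: "exponent_of g x (E x)" unfolding E_def by (rule someI[of "exponent_of g x", OF i])
    have "F (x \<otimes> g [^] (-i)) = F (x \<otimes> g [^] (- E x)) + F (g [^] (E x - i))"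
      using exponent_of_diff[OF g e i] e by (simp add: Fadd exponent_of_def)
    then show ?thesis
      using Fpow[OF exponent_of_diff(1)[OF g e i]] by (simp add: \<Phi>_def algebra_simps)
  qed
  show ?thesis
  proof (rule virtual_retract_if_additive[OF finite_index_exponent_of[OF g H], of g \<Phi>])
    show "g \<in> ?K" using exponent_of_self[OF g] by blast
    show "additive_on G ?K \<Phi>"
      unfolding additive_on_def
    proof (intro ballI)
      fix x y assume "x \<in> ?K" "y \<in> ?K"
      then obtain i j where x: "exponent_of g x i" and y: "exponent_of g y j" by auto
      then have c: "x \<in> carrier G" "y \<in> carrier G" "x \<otimes> g [^] (-i) \<in> H" "y \<otimes> g [^] (-j) \<in> H"
        by (auto simp: exponent_of_def)
      have "F (x \<otimes> y \<otimes> g [^] (-(i + j))) = F (x \<otimes> g [^] (-i)) + F (conj (y \<otimes> g [^] (-j)) i)"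
        unfolding exponent_of_split[OF g c(1,2)] conj_def[symmetric] using c cH by (simp add: Fadd)
      then show "\<Phi> (x \<otimes> y) = \<Phi> x + \<Phi> y"
        using \<Phi>[OF x] \<Phi>[OF y] \<Phi>[OF exponent_of_mult[OF g x y]] c Finv by (simp add: algebra_simps)
    qed
    have "F \<one> = 0" using Fpow[of 0] by simp
    then have "\<Phi> g = c" using \<Phi>[OF exponent_of_self[OF g]] g by (simp add: int_pow_neg)
    then show "\<Phi> g \<noteq> 0" using m by (simp add: c_def)
  qed
qed

end

section \<open>Actions commuting with a shift\<close>

definition shift :: "int \<Rightarrow> 'x \<times> int \<Rightarrow> 'x \<times> int" where
  "shift k y = (fst y, snd y + k)"

lemma shift_simps [simp]:
  "fst (shift k y) = fst y" "snd (shift k y) = snd y + k" "shift 0 y = y"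
  "shift k (shift l y) = shift (l + k) y" "shift k y \<in> X \<times> UNIV \<longleftrightarrow> y \<in> X \<times> UNIV"
  by (cases y; simp add: shift_def add.assoc)+

text \<open>For finite \<open>X\<close>, the bijective such maps form the wreath product of \<open>\<int>\<close> with the symmetric group of \<open>X\<close>.\<close>

definition shift_map :: "'x set \<Rightarrow> ('x \<times> int \<Rightarrow> 'x \<times> int) \<Rightarrow> bool" where
  "shift_map X f \<longleftrightarrow>
     (\<forall>x\<in>X. fst (f (x, 0)) \<in> X \<and> (\<forall>k. f (x, k) = (fst (f (x, 0)), snd (f (x, 0)) + k)))"

definition shift_action ::
    "('a, 'm) monoid_scheme \<Rightarrow> 'x set \<Rightarrow> ('a \<Rightarrow> 'x \<times> int \<Rightarrow> 'x \<times> int) \<Rightarrow> bool" where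
  "shift_action G X act \<longleftrightarrow>
     (\<forall>a\<in>carrier G. shift_map X (act a)) \<and>
     (\<forall>y\<in>X \<times> UNIV. act \<one>\<^bsub>G\<^esub> y = y) \<and>
     (\<forall>a\<in>carrier G. \<forall>b\<in>carrier G. \<forall>y\<in>X \<times> UNIV. act (a \<otimes>\<^bsub>G\<^esub> b) y = act a (act b y))"

text \<open>Stated as an implication in order to include elements of finite order: the kernel of the
  action meets the cyclic group of \<open>g\<close> trivially. Natural exponents suffice because the
  kernel is closed under inverses.\<close>

definition faithful_on_powers ::
    "('a, 'm) monoid_scheme \<Rightarrow> 'x set \<Rightarrow> ('a \<Rightarrow> 'x \<times> int \<Rightarrow> 'x \<times> int) \<Rightarrow> 'a \<Rightarrow> bool" where
  "faithful_on_powers G X act g \<longleftrightarrow>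
     (\<forall>m::nat. (\<forall>y\<in>X \<times> UNIV. act (g [^]\<^bsub>G\<^esub> m) y = y) \<longrightarrow> g [^]\<^bsub>G\<^esub> m = \<one>\<^bsub>G\<^esub>)"

lemma shift_mapD:
  assumes "shift_map X f" "x \<in> X"
  shows "fst (f (x, 0)) \<in> X" "f (x, k) = (fst (f (x, 0)), snd (f (x, 0)) + k)"
  using assms unfolding shift_map_def by blast+

lemma shift_map_closed:
  assumes "shift_map X f" "y \<in> X \<times> UNIV"
  shows "f y \<in> X \<times> UNIV"
proof -
  obtain x k where y: "y = (x, k)" by (cases y)
  then have x: "x \<in> X" using assms by simp
  show ?thesis
    unfolding y shift_mapD(2)[OF assms(1) x, of k] using shift_mapD(1)[OF assms(1) x] by simp
qed

lemma shift_map_shift: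
  assumes "shift_map X f" "y \<in> X \<times> UNIV"
  shows "f (shift k y) = shift k (f y)"
proof -
  obtain x l where y: "y = (x, l)" by (cases y)
  then have x: "x \<in> X" using assms by simp
  show ?thesis
    unfolding y shift_def fst_conv snd_conv shift_mapD(2)[OF assms(1) x, of l]
      shift_mapD(2)[OF assms(1) x, of "l + k"] by (simp add: add.assoc)
qed

lemma shift_mapI':
  assumes "\<And>y. y \<in> X \<times> UNIV \<Longrightarrow> f y \<in> X \<times> UNIV"
    "\<And>y k. y \<in> X \<times> UNIV \<Longrightarrow> f (shift k y) = shift k (f y)"
  shows "shift_map X f"
  unfolding shift_map_def
proof (intro ballI conjI allI)
  fix x k assume x: "x \<in> X"
  then have "f (x, 0) \<in> X \<times> UNIV" using assms(1) by simp
  then show "fst (f (x, 0)) \<in> X" by (simp add: mem_Times_iff)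
  have "(x, k) = shift k (x, 0)" by (simp add: shift_def)
  then show "f (x, k) = (fst (f (x, 0)), snd (f (x, 0)) + k)"
    using assms(2)[of "(x, 0)" k] x by (simp add: shift_def)
qed

lemma shift_map_id: "shift_map X (\<lambda>y. y)"
  by (intro shift_mapI') auto

lemma shift_map_comp:
  assumes "shift_map X f" "shift_map X h"
  shows "shift_map X (\<lambda>y. f (h y))"
  by (intro shift_mapI') (use assms in \<open>simp_all add: shift_map_closed shift_map_shift\<close>)

lemma shift_map_inv_into:
  assumes t: "bij_betw t (X \<times> UNIV) (X \<times> UNIV)" "shift_map X t"
  shows "shift_map X (inv_into (X \<times> UNIV) t)"
proof (rule shift_mapI')
  let ?i = "inv_into (X \<times> UNIV) t"
  fix y k assume y: "y \<in> X \<times> (UNIV :: int set)"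
  show i: "?i y \<in> X \<times> UNIV"
    using bij_betw_apply[OF bij_betw_inv_into[OF t(1)] y] .
  have "t (shift k (?i y)) = shift k y"
    using shift_map_shift[OF t(2) i] bij_betw_inv_into_right[OF t(1) y] by simp
  moreover have "?i (t (shift k (?i y))) = shift k (?i y)"
    using i by (intro bij_betw_inv_into_left[OF t(1)]) (simp only: shift_simps)
  ultimately show "?i (shift k y) = shift k (?i y)" by simp
qed

lemma shift_mapI:
  assumes "\<And>x k. x \<in> X \<Longrightarrow> f (x, k) = (s x, w x + k)" "\<And>x. x \<in> X \<Longrightarrow> s x \<in> X"
  shows "shift_map X f"
  using assms unfolding shift_map_def by simp

lemma shift_actionD:
  assumes "shift_action G X act"
  shows "a \<in> carrier G \<Longrightarrow> shift_map X (act a)"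
    and "y \<in> X \<times> UNIV \<Longrightarrow> act \<one>\<^bsub>G\<^esub> y = y"
    and "a \<in> carrier G \<Longrightarrow> b \<in> carrier G \<Longrightarrow> y \<in> X \<times> UNIV \<Longrightarrow> act (a \<otimes>\<^bsub>G\<^esub> b) y = act a (act b y)"
  using assms unfolding shift_action_def by blast+

section \<open>Shift actions and virtual retracts\<close>

context group
begin

text \<open>An action amounts to permutations \<open>\<sigma>\<close> of \<open>X\<close> and a
  cocycle \<open>w\<close>. On \<open>N\<close> the permutations are trivial, so the cocycle rule
  for \<open>w\<close> becomes additivity. If no power of \<open>g\<close> in \<open>N\<close> has a
  nonzero translation, such powers act trivially and are trivial by faithfulness.\<close>

theorem virtual_retract_if_shift_action:
  assumes X: "finite X" and act: "shift_action G X act" and g: "g \<in> carrier G"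
    and faithful: "faithful_on_powers G X act g"
  shows "virtual_retract (generate G {g}) G"
proof -
  define \<sigma> where "\<sigma> a x = fst (act a (x, 0))" for a x
  define w where "w a x = snd (act a (x, 0))" for a x
  have act_eq: "act a (x, k) = (\<sigma> a x, w a x + k)" if "a \<in> carrier G" "x \<in> X" for a x k
    unfolding \<sigma>_def w_def by (rule shift_mapD(2)[OF shift_actionD(1)[OF act that(1)] that(2)])
  have \<sigma>: "\<sigma> a x \<in> X" if "a \<in> carrier G" "x \<in> X" for a x
    unfolding \<sigma>_def by (rule shift_mapD(1)[OF shift_actionD(1)[OF act that(1)] that(2)])
  have mult: "\<sigma> (a \<otimes> b) x = \<sigma> a (\<sigma> b x)" "w (a \<otimes> b) x = w a (\<sigma> b x) + w b x"
    if "a \<in> carrier G" "b \<in> carrier G" "x \<in> X" for a b x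
    using shift_actionD(3)[OF act that(1,2), of "(x, 0)"] that by (simp_all add: act_eq \<sigma>)
  have one: "\<sigma> \<one> x = x" "w \<one> x = 0" if "x \<in> X" for x
    using shift_actionD(2)[OF act, of "(x, 0)"] that by (simp_all add: act_eq)
  have inv_l: "\<sigma> (inv a) (\<sigma> a x) = x" "\<sigma> a (\<sigma> (inv a) x) = x" if "a \<in> carrier G" "x \<in> X" for a x
    using mult(1)[of "inv a" a x] mult(1)[of a "inv a" x] that one by auto
  define N where "N = {a \<in> carrier G. \<forall>x\<in>X. \<sigma> a x = x}"
  have sN: "subgroup N G"
  proof (rule subgroupI)
    show "N \<noteq> {}" using one by (auto simp: N_def)
    show "inv a \<in> N" if "a \<in> N" for a
      using that inv_l by (force simp: N_def)
  qed (auto simp: N_def mult)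
  have nN: "N \<lhd> G"
    unfolding normal_inv_iff using sN \<sigma> inv_l by (auto simp: N_def mult)
  have fN: "finite_index N G"
  proof (rule finite_indexI[OF sN, of "X \<rightarrow>\<^sub>E X" "\<lambda>a. restrict (\<sigma> a) X"])
    show "finite (X \<rightarrow>\<^sub>E X)" using X by (simp add: finite_PiE)
    show "(\<lambda>a. restrict (\<sigma> a) X) \<in> carrier G \<rightarrow> X \<rightarrow>\<^sub>E X" using \<sigma> by auto
    fix a b assume ab: "a \<in> carrier G" "b \<in> carrier G" "restrict (\<sigma> a) X = restrict (\<sigma> b) X"
    then have "\<sigma> a x = \<sigma> b x" if "x \<in> X" for x using that by (metis restrict_apply')
    then show "a \<otimes> inv b \<in> N" using ab \<sigma> inv_l by (auto simp: N_def mult)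
  qed

  have add: "additive_on G N (\<lambda>a. w a x)" if "x \<in> X" for x
    using that by (simp add: additive_on_def N_def mult)
  show ?thesis
  proof (cases "\<exists>m x. g [^] (m::nat) \<in> N \<and> x \<in> X \<and> w (g [^] m) x \<noteq> 0")
    case True
    then obtain m x where "g [^] (m::nat) \<in> N" "x \<in> X" "w (g [^] m) x \<noteq> 0" by auto
    then show ?thesis using normal.virtual_retract_if_normal_additive[OF nN g fN add] by simp
  next
    case False
    have nat: "g [^] m = \<one>" if "g [^] (m::nat) \<in> N" for m
    proof -
      have "act (g [^] m) y = y" if "y \<in> X \<times> UNIV" for y
        using that False \<open>g [^] m \<in> N\<close> g by (cases y) (auto simp: act_eq N_def)
      then show ?thesis using faithful unfolding faithful_on_powers_def by blast
    qed
    show ?thesis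
    proof (rule normal.virtual_retract_if_trivial_Int[OF nN g fN])
      fix i :: int assume i: "g [^] i \<in> N"
      show "g [^] i = \<one>"
      proof (cases i rule: int_cases2)
        case (nonneg m)
        then show ?thesis using nat[of m] i by (simp add: int_pow_int)
      next
        case (nonpos m)
        then have "inv (g [^] m) \<in> N" using i g by (simp add: int_pow_neg_int)
        then have "g [^] m \<in> N" using g subgroup.m_inv_closed[OF sN] by fastforce
        then show ?thesis using nat[of m] nonpos g by (simp add: int_pow_neg_int)
      qed
    qed
  qed
qed

text \<open>\<open>N\<close> is the intersection of the conjugates of \<open>M\<close>, which is the
  kernel of right multiplication on the finite set of cosets of \<open>M\<close>.\<close>

lemma finite_index_core:
  assumes M: "finite_index M G"
  obtains N where "N \<subseteq> M" "N \<lhd> G" "finite_index N G"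
proof -
  have sM: "subgroup M G" using M by (simp add: finite_index_def)
  define N where "N = {a \<in> carrier G. \<forall>x\<in>carrier G. x \<otimes> a \<otimes> inv x \<in> M}"
  have sN: "subgroup N G"
  proof (rule subgroupI)
    show "N \<noteq> {}" using subgroup.one_closed[OF sM] by (auto simp: N_def intro!: exI[of _ \<one>])
    fix a assume a: "a \<in> N"
    show "inv a \<in> N"
      unfolding N_def
    proof safe
      fix x assume x: "x \<in> carrier G"
      have "inv (x \<otimes> a \<otimes> inv x) \<in> M" using a x subgroup.m_inv_closed[OF sM] by (auto simp: N_def)
      then show "x \<otimes> inv a \<otimes> inv x \<in> M" using a x by (simp add: N_def inv_mult_group m_assoc)
    qed (use a in \<open>auto simp: N_def\<close>)
    fix b assume b: "b \<in> N"
    show "a \<otimes> b \<in> N"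
      unfolding N_def
    proof safe
      fix x assume x: "x \<in> carrier G"
      have ab: "a \<in> carrier G" "b \<in> carrier G" using a b by (auto simp: N_def)
      have "inv x \<otimes> (x \<otimes> (b \<otimes> inv x)) = b \<otimes> inv x" using ab x by (simp flip: m_assoc)
      then have "(x \<otimes> a \<otimes> inv x) \<otimes> (x \<otimes> b \<otimes> inv x) = x \<otimes> (a \<otimes> b) \<otimes> inv x"
        using ab x by (simp add: m_assoc)
      moreover have "(x \<otimes> a \<otimes> inv x) \<otimes> (x \<otimes> b \<otimes> inv x) \<in> M"
        by (rule subgroup.m_closed[OF sM]) (use a b x in \<open>auto simp: N_def\<close>)
      ultimately show "x \<otimes> (a \<otimes> b) \<otimes> inv x \<in> M" by simp
    qed (use a b in \<open>auto simp: N_def\<close>)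
  qed (auto simp: N_def)
  show ?thesis
  proof (rule that)
    show "N \<subseteq> M"
    proof
      fix a assume "a \<in> N"
      then have "a \<in> carrier G" "\<one> \<otimes> a \<otimes> inv \<one> \<in> M" unfolding N_def by blast+
      then show "a \<in> M" by simp
    qed
    show "N \<lhd> G"
      unfolding normal_inv_iff
    proof (intro conjI ballI sN)
      fix x h assume x: "x \<in> carrier G" and h: "h \<in> N"
      have hc: "h \<in> carrier G" using h by (simp add: N_def)
      have "y \<otimes> (x \<otimes> h \<otimes> inv x) \<otimes> inv y = (y \<otimes> x) \<otimes> h \<otimes> inv (y \<otimes> x)" if "y \<in> carrier G" for y
        using that x hc by (simp add: inv_mult_group m_assoc)
      then show "x \<otimes> h \<otimes> inv x \<in> N" using x h by (simp add: N_def)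
    qed
    show "finite_index N G"
    proof (rule finite_indexI[OF sN, of "(rcosets M) \<rightarrow>\<^sub>E (rcosets M)" "\<lambda>a. \<lambda>C\<in>rcosets M. C #> a"])
      have "C #> a \<in> rcosets M" if "C \<in> rcosets M" "a \<in> carrier G" for C a
        using that coset_mult_assoc[OF subgroup.subset[OF sM]] by (auto simp: RCOSETS_def)
      then show "(\<lambda>a. \<lambda>C\<in>rcosets M. C #> a) \<in> carrier G \<rightarrow> (rcosets M) \<rightarrow>\<^sub>E (rcosets M)" by auto
      show "finite ((rcosets M) \<rightarrow>\<^sub>E (rcosets M))" using M by (simp add: finite_PiE finite_index_def)
    next
      fix a b assume ab: "a \<in> carrier G" "b \<in> carrier G"
        and e: "(\<lambda>C\<in>rcosets M. C #> a) = (\<lambda>C\<in>rcosets M. C #> b)"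
      have "x \<otimes> (a \<otimes> inv b) \<otimes> inv x \<in> M" if x: "x \<in> carrier G" for x
      proof -
        have "M #> x \<in> rcosets M" using x rcosetsI[OF subgroup.subset[OF sM]] by simp
        then have "M #> x #> a = M #> x #> b" using e by (metis restrict_apply')
        then have "M #> (x \<otimes> a) = M #> (x \<otimes> b)"
          using x ab coset_mult_assoc[OF subgroup.subset[OF sM]] by simp
        then have "(x \<otimes> a) \<otimes> inv (x \<otimes> b) \<in> M" using rcos_eq_iff[OF sM] x ab by simp
        then show ?thesis using x ab by (simp add: inv_mult_group m_assoc)
      qed
      then show "a \<otimes> inv b \<in> N" using ab by (simp add: N_def)
    qed
  qed
qed

section \<open>Consequences of (VRC): residual finiteness and induced actions\<close>

lemma VRC_retraction:
  assumes "VRC G" "g \<in> carrier G"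
  obtains K \<rho> where "finite_index K G" "g \<in> K" "\<And>x. x \<in> K \<Longrightarrow> \<rho> x \<in> generate G {g}"
    "\<And>x y. x \<in> K \<Longrightarrow> y \<in> K \<Longrightarrow> \<rho> (x \<otimes> y) = \<rho> x \<otimes> \<rho> y" "\<And>h. h \<in> generate G {g} \<Longrightarrow> \<rho> h = h"
proof -
  have sH: "subgroup (generate G {g}) G" using assms by (intro generate_is_subgroup) auto
  have "G\<lparr>carrier := generate G {g}\<rparr> = subgroup_generated G {g}"
    using assms by (simp add: subgroup_generated_def)
  then have "virtual_retract (generate G {g}) G"
    using assms sH cyclic_group_generated by (simp add: VRC_def)
  then obtain K \<rho> where K: "subgroup K G" "finite (rcosets K)" "generate G {g} \<subseteq> K"
      "\<rho> \<in> hom (G\<lparr>carrier := K\<rparr>) (G\<lparr>carrier := generate G {g}\<rparr>)" "\<forall>h\<in>generate G {g}. \<rho> h = h"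
    by (auto simp: virtual_retract_def group_retract_def)
  show ?thesis
  proof (rule that[of K \<rho>])
    show "g \<in> K" using K(3) generate.incl[of g "{g}" G] by auto
  qed (use K in \<open>auto simp: finite_index_def hom_def\<close>)
qed

text \<open>The retraction onto an infinite cyclic group followed by the exponent, which is unique
  because \<open>g\<close> has infinite order.\<close>

lemma VRC_infinite_order:
  assumes G: "VRC G" and g: "g \<in> carrier G" and inf: "\<And>m::int. g [^] m = \<one> \<Longrightarrow> m = 0"
  obtains K f where "finite_index K G" "additive_on G K f" "g \<in> K" "f g = 1"
proof -
  obtain K \<rho> where K: "finite_index K G" "g \<in> K" "\<And>x. x \<in> K \<Longrightarrow> \<rho> x \<in> generate G {g}"
    "\<And>x y. x \<in> K \<Longrightarrow> y \<in> K \<Longrightarrow> \<rho> (x \<otimes> y) = \<rho> x \<otimes> \<rho> y" "\<And>h. h \<in> generate G {g} \<Longrightarrow> \<rho> h = h"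
    using VRC_retraction[OF G g] by blast
  define f where "f x = (SOME i::int. \<rho> x = g [^] i)" for x
  have inj: "i = j" if "g [^] i = g [^] j" for i j :: int
  proof -
    have "g [^] (i - j) = \<one>" using that g by (simp add: int_pow_diff)
    then show ?thesis using inf by fastforce
  qed
  have f: "f x = i" if "\<rho> x = g [^] i" for x i
  proof -
    have "\<rho> x = g [^] f x" unfolding f_def by (rule someI[of "\<lambda>i. \<rho> x = g [^] i", OF that])
    then show ?thesis using inj that by metis
  qed
  have ex: "\<exists>i::int. \<rho> x = g [^] i" if "x \<in> K" for x
    using K(3)[OF that] g mem_generate_iff by blast
  have \<rho>g: "\<rho> g = g [^] (1::int)" using K(5)[of g] generate.incl[of g "{g}" G] g by simp
  have "f (x \<otimes> y) = f x + f y" if xy: "x \<in> K" "y \<in> K" for x y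
  proof -
    obtain i j :: int where ij: "\<rho> x = g [^] i" "\<rho> y = g [^] j" using ex xy by metis
    then have "\<rho> (x \<otimes> y) = g [^] (i + j)" using K(4)[OF xy] g by (simp add: int_pow_mult)
    then show ?thesis using f ij by metis
  qed
  then show ?thesis using that[of K f] K f[OF \<rho>g] by (simp add: additive_on_def)
qed

lemma finite_generate_if_torsion:
  assumes g: "g \<in> carrier G" and m: "g [^] (m::int) = \<one>" "m \<noteq> 0"
  shows "finite (generate G {g})"
proof -
  have "g [^] k = g [^] (k mod m)" for k :: int
  proof -
    have "g [^] k = g [^] (m * (k div m) + k mod m)" by simp
    also have "\<dots> = (g [^] m) [^] (k div m) \<otimes> g [^] (k mod m)"
      by (simp only: int_pow_mult[OF g] int_pow_pow[OF g])
    finally show ?thesis using g m by simp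
  qed
  then have "generate G {g} \<subseteq> (\<lambda>k::int. g [^] k) ` range (\<lambda>k. k mod m)"
    unfolding generate_pow[OF g] by blast
  then show ?thesis using finite_range_mod[OF m(2)] finite_surj by blast
qed

text \<open>\<open>M\<close> is the kernel of the retraction. Its image is finite, so
  \<open>M\<close> has finite index, and on the cyclic group itself the retraction is
  injective.\<close>

lemma VRC_finite_order:
  assumes G: "VRC G" and g: "g \<in> carrier G" and fin: "g [^] (m::int) = \<one>" "m \<noteq> 0"
  obtains M where "finite_index M G" "M \<inter> generate G {g} = {\<one>}"
proof -
  obtain K \<rho> where K: "finite_index K G" "g \<in> K" "\<And>x. x \<in> K \<Longrightarrow> \<rho> x \<in> generate G {g}"
    "\<And>x y. x \<in> K \<Longrightarrow> y \<in> K \<Longrightarrow> \<rho> (x \<otimes> y) = \<rho> x \<otimes> \<rho> y" "\<And>h. h \<in> generate G {g} \<Longrightarrow> \<rho> h = h"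
    using VRC_retraction[OF G g] by blast
  have sK: "subgroup K G" using K by (simp add: finite_index_def)
  have \<rho>c: "\<rho> x \<in> carrier G" if "x \<in> K" for x
    using K(3)[OF that] generate_in_carrier g by blast
  have one: "\<rho> \<one> = \<one>" using K(5) generate.one by metis
  have \<rho>inv: "\<rho> (inv x) = inv (\<rho> x)" if "x \<in> K" for x
  proof -
    have "\<rho> (inv x) \<otimes> \<rho> x = \<one>"
      using K(4)[of "inv x" x] that sK one subgroup.m_inv_closed subgroup.mem_carrier by fastforce
    then show ?thesis
      using that \<rho>c subgroup.m_inv_closed[OF sK] by (metis inv_equality)
  qed
  define M where "M = {x \<in> K. \<rho> x = \<one>}"
  have sM: "subgroup M G"
    using K(4) one \<rho>inv sK
    by (intro subgroupI)
      (auto simp: M_def subgroup.m_closed subgroup.m_inv_closed dest: subgroup.mem_carrier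
        intro!: exI[of _ \<one>] subgroup.one_closed)
  show ?thesis
  proof (rule that[of M])
    show "finite_index M G"
    proof (rule finite_index_trans[OF K(1) sM, of "generate G {g}" \<rho>])
      show "finite (generate G {g})" by (rule finite_generate_if_torsion[OF g fin])
      show "a \<otimes> inv b \<in> M" if "a \<in> K" "b \<in> K" "\<rho> a = \<rho> b" for a b
        using that K(4) \<rho>inv \<rho>c sK
        by (simp add: M_def subgroup.m_closed subgroup.m_inv_closed)
    qed (use K in \<open>auto simp: M_def\<close>)
    have "generate G {g} \<subseteq> K" using generate_subgroup_incl[of "{g}" K] K(2) sK by simp
    then show "M \<inter> generate G {g} = {\<one>}"
      using K(5) generate.one[of G "{g}"] by (auto simp: M_def)
  qed
qed

text \<open>An element of finite order avoids the kernel of the retraction onto the group it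
  generates. An element of infinite order has value 1 under a homomorphism to the integers and so
  avoids the elements of even value.\<close>

lemma VRC_separate:
  assumes G: "VRC G" and s: "s \<in> carrier G" "s \<noteq> \<one>"
  shows "\<exists>M. finite_index M G \<and> s \<notin> M"
proof (cases "\<exists>m::int. s [^] m = \<one> \<and> m \<noteq> 0")
  case True
  then obtain m :: int where "s [^] m = \<one>" "m \<noteq> 0" by blast
  from VRC_finite_order[OF G s(1) this] obtain M where "finite_index M G" "M \<inter> generate G {s} = {\<one>}" .
  then show ?thesis using s generate.incl[of s "{s}" G] by blast
next
  case False
  then obtain K f where K: "finite_index K G" "additive_on G K f" "s \<in> K" "f s = 1"
    using VRC_infinite_order[OF G s(1)] by metis
  have sK: "subgroup K G" using K by (simp add: finite_index_def)
  have f_inv: "f (inv a) = - f a" if "a \<in> K" for a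
    using additive_on_int_pow[OF K(2) sK that, of "-1"] that subgroup.mem_carrier[OF sK]
    by (simp add: int_pow_neg)
  define M where "M = {x \<in> K. even (f x)}"
  have sM: "subgroup M G"
  proof (rule subgroupI)
    show "M \<subseteq> carrier G" using subgroup.subset[OF sK] by (auto simp: M_def)
    show "M \<noteq> {}"
      using subgroup.one_closed[OF sK] additive_on_one[OF K(2) sK] by (auto simp: M_def)
  qed (use K(2) sK f_inv in \<open>auto simp: M_def additive_on_def subgroup.m_closed subgroup.m_inv_closed\<close>)
  have "finite_index M G"
  proof (rule finite_index_trans[OF K(1) sM, of UNIV "\<lambda>x. even (f x)"])
    show "a \<otimes> inv b \<in> M" if "a \<in> K" "b \<in> K" "even (f a) = even (f b)" for a b
      using that K(2) sK f_inv
      by (auto simp: M_def additive_on_def subgroup.m_closed subgroup.m_inv_closed)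
  qed (auto simp: M_def)
  moreover have "s \<notin> M" using K by (simp add: M_def)
  ultimately show ?thesis by blast
qed

text \<open>The subgroups separating the single elements are intersected. Passing to the normal core
  then excludes all conjugates of elements of \<open>S\<close> as well, which is what a statement
  about all points of a coset space requires.\<close>

lemma VRC_separate_finite:
  assumes G: "VRC G" and S: "finite S" "S \<subseteq> carrier G" "\<one> \<notin> S"
  obtains N where "N \<lhd> G" "finite_index N G" "N \<inter> S = {}"
proof -
  have "\<exists>M. finite_index M G \<and> M \<inter> S = {}"
    using S
  proof (induction S rule: finite_induct)
    case empty
    then show ?case using finite_index_carrier by blast
  next
    case (insert s S)
    then obtain M where M: "finite_index M G" "M \<inter> S = {}" by auto
    obtain M' where M': "finite_index M' G" "s \<notin> M'" using VRC_separate[OF G, of s] insert by auto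
    have "(M \<inter> M') \<inter> insert s S = {}" using M M' by auto
    then show ?case using finite_index_Int[OF M(1) M'(1)] by blast
  qed
  then show ?thesis using finite_index_core that by (metis Int_mono order_refl subset_empty)
qed

text \<open>The action on \<open>X \<times> \<int>\<close> induced from the action of \<open>M\<close> on \<open>\<int>\<close> by translations through \<open>f\<close>.\<close>

lemma induced_shift_action:
  assumes M: "finite_index M G" and f: "additive_on G M f"
  obtains X act x\<^sub>0 where "finite X" "X \<subseteq> carrier G" "shift_action G X act" "x\<^sub>0 \<in> X"
    "\<And>s x. s \<in> carrier G \<Longrightarrow> x \<in> X \<Longrightarrow> fst (act s (x, 0)) = x \<Longrightarrow> inv x \<otimes> s \<otimes> x \<in> M"
    "\<And>h. h \<in> carrier G \<Longrightarrow> act h (x\<^sub>0, 0) = (x\<^sub>0, 0) \<Longrightarrow> h \<in> M \<and> f h = 0"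
proof -
  have sM: "subgroup M G" using M by (simp add: finite_index_def)
  note MG = subgroup.subset[OF sM]
  \<comment> \<open>\<open>M #> inv x\<close> consists of the inverses of the left coset of
    \<open>x\<close>. So \<open>r x\<close> represents that left coset and depends on nothing else.
    Points are representatives rather than cosets, which keeps \<open>X\<close> inside
    \<open>carrier G\<close>.\<close>
  define q where "q C = inv (SOME y. y \<in> C)" for C
  define r where "r x = q (M #> inv x)" for x
  have some: "(SOME y. y \<in> M #> inv x) \<in> M #> inv x" if "x \<in> carrier G" for x
    by (rule someI[of "\<lambda>y. y \<in> M #> inv x"]) (use rcos_self sM that in blast)
  have r: "r x \<in> carrier G" "M #> inv (r x) = M #> inv x" if "x \<in> carrier G" for x
  proof -
    have c: "(SOME y. y \<in> M #> inv x) \<in> carrier G"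
      using some[OF that] r_coset_subset_G[OF MG] that by blast
    then show "r x \<in> carrier G" by (simp add: r_def q_def)
    show "M #> inv (r x) = M #> inv x"
      using repr_independence[OF some[OF that] _ sM] that c by (simp add: r_def q_def)
  qed
  have r_cong: "r x = r y" if "M #> inv x = M #> inv y" for x y
    using that by (simp add: r_def)
  have r_mult: "r (a \<otimes> r z) = r (a \<otimes> z)" if "a \<in> carrier G" "z \<in> carrier G" for a z
  proof (rule r_cong)
    have "M #> inv (a \<otimes> r z) = M #> inv (r z) #> inv a"
      using that r(1) by (simp add: inv_mult_group coset_mult_assoc[OF MG])
    also have "\<dots> = M #> inv (a \<otimes> z)"
      using that r(2)[of z] by (simp add: inv_mult_group coset_mult_assoc[OF MG])
    finally show "M #> inv (a \<otimes> r z) = M #> inv (a \<otimes> z)" .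
  qed
  have rM: "inv (r x) \<otimes> x \<in> M" if "x \<in> carrier G" for x
    using rcos_eq_iff[OF sM, of "inv (r x)" "inv x"] r[OF that] that by simp
  define X where "X = r ` carrier G"
  have XG: "X \<subseteq> carrier G" using r by (auto simp: X_def)
  have rX: "r x = x" if "x \<in> X" for x
  proof -
    obtain y where "y \<in> carrier G" "x = r y" using \<open>x \<in> X\<close> unfolding X_def by blast
    then show ?thesis using r_cong[OF r(2)] by simp
  qed
  have finX: "finite X"
  proof -
    have "r x \<in> q ` (rcosets M)" if "x \<in> carrier G" for x
      unfolding r_def by (intro imageI rcosetsI[OF MG]) (use that in simp)
    then have "X \<subseteq> q ` (rcosets M)" by (auto simp: X_def)
    then show ?thesis using M finite_surj by (auto simp: finite_index_def)
  qed
  \<comment> \<open>The left coset action with its cocycle: \<open>a \<otimes> x\<close> is its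
    representative times an element of \<open>M\<close>, and the value of \<open>f\<close> at that
    element is the translation.\<close>
  define act where "act a y = (r (a \<otimes> fst y), f (inv (r (a \<otimes> fst y)) \<otimes> (a \<otimes> fst y)) + snd y)" for a y
  have action: "shift_action G X act"
    unfolding shift_action_def
  proof (intro conjI ballI)
    fix a assume a: "a \<in> carrier G"
    show "shift_map X (act a)"
    proof (rule shift_mapI)
      show "act a (x, k) = (r (a \<otimes> x), f (inv (r (a \<otimes> x)) \<otimes> (a \<otimes> x)) + k)" for x k
        by (simp add: act_def)
      show "r (a \<otimes> x) \<in> X" if "x \<in> X" for x
        unfolding X_def by (rule imageI) (use a that XG in auto)
    qed
    fix b y assume b: "b \<in> carrier G" and y: "y \<in> X \<times> (UNIV :: int set)"
    let ?x = "fst y"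
    let ?u = "r (b \<otimes> ?x)"
    let ?v = "r (a \<otimes> ?u)"
    have x: "?x \<in> carrier G" using y XG by auto
    have u: "?u \<in> carrier G" and v: "?v \<in> carrier G" using r a b x by auto
    have vu: "?v = r (a \<otimes> b \<otimes> ?x)" using r_mult[of a "b \<otimes> ?x"] a b x by (simp add: m_assoc)
    have "?u \<otimes> (inv ?u \<otimes> (b \<otimes> ?x)) = b \<otimes> ?x" using u b x by (simp flip: m_assoc)
    then have "inv ?v \<otimes> (a \<otimes> b \<otimes> ?x) = (inv ?v \<otimes> (a \<otimes> ?u)) \<otimes> (inv ?u \<otimes> (b \<otimes> ?x))"
      using a b x u v by (simp add: m_assoc)
    then have "f (inv ?v \<otimes> (a \<otimes> b \<otimes> ?x)) = f (inv ?v \<otimes> (a \<otimes> ?u)) + f (inv ?u \<otimes> (b \<otimes> ?x))"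
      using f rM[of "a \<otimes> ?u"] rM[of "b \<otimes> ?x"] a b x u by (simp add: additive_on_def)
    then show "act (a \<otimes> b) y = act a (act b y)"
      using vu by (simp add: act_def)
  next
    fix y assume "y \<in> X \<times> (UNIV :: int set)"
    then show "act \<one> y = y"
      using XG rX additive_on_one[OF f sM] by (cases y) (auto simp: act_def)
  qed
  have fix_pt: "inv x \<otimes> s \<otimes> x \<in> M" if "s \<in> carrier G" "x \<in> X" "fst (act s (x, 0)) = x" for s x
    using rM[of "s \<otimes> x"] that XG by (auto simp: act_def m_assoc)
  have x0: "r \<one> \<in> X" "r \<one> \<in> M"
    using rM[of \<one>] r[of \<one>] subgroup.m_inv_closed[OF sM, of "inv (r \<one>)"] by (auto simp: X_def)
  show ?thesis
  proof (rule that[OF finX XG action x0(1)])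
    fix h assume h: "h \<in> carrier G" and e: "act h (r \<one>, 0) = (r \<one>, 0)"
    \<comment> \<open>The base point \<open>r \<one>\<close> need not be the identity, but it lies
      in \<open>M\<close>. Hence conjugation by it changes neither membership in \<open>M\<close>
      nor the value of \<open>f\<close>.\<close>
    let ?x = "r \<one>" and ?k = "inv (r \<one>) \<otimes> h \<otimes> r \<one>"
    have xc: "?x \<in> carrier G" using r by simp
    have k: "?k \<in> M" using fix_pt[OF h x0(1)] e by simp
    have "?x \<otimes> (inv ?x \<otimes> (h \<otimes> z)) = h \<otimes> z" if "z \<in> carrier G" for z
      using xc h that by (simp flip: m_assoc)
    then have hk: "h = ?x \<otimes> ?k \<otimes> inv ?x" using xc h by (simp add: m_assoc)
    have hM: "h \<in> M"
      by (subst hk) (use k x0 sM in \<open>simp add: subgroup.m_closed subgroup.m_inv_closed\<close>)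
    moreover have "f h = f ?k" by (subst hk) (rule additive_on_conj[OF f sM x0(2) k])
    moreover have "f ?k = 0" using e h xc by (auto simp: act_def m_assoc)
    ultimately show "h \<in> M \<and> f h = 0" by simp
  qed (use fix_pt in auto)
qed

text \<open>The action is induced from a subgroup \<open>M\<close> contained in a normal subgroup
  that avoids \<open>S\<close>, so no conjugate of an element of \<open>S\<close> fixes a point.
  Faithfulness is read off at the single point \<open>x\<^sub>0\<close>. For \<open>g\<close> of
  finite order, \<open>M\<close> also avoids the nontrivial powers of \<open>g\<close> and
  \<open>f\<close> is zero; otherwise \<open>f g = 1\<close> makes every positive power translate
  whenever it fixes \<open>x\<^sub>0\<close> in \<open>X\<close>.\<close>

theorem VRC_shift_action:
  assumes G: "VRC G" and S: "finite S" "S \<subseteq> carrier G" "\<one> \<notin> S" and g: "g \<in> carrier G"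
  obtains X act where "finite X" "X \<noteq> {}" "X \<subseteq> carrier G" "shift_action G X act"
    "\<And>s x. s \<in> S \<Longrightarrow> x \<in> X \<Longrightarrow> fst (act s (x, 0)) \<noteq> x" "faithful_on_powers G X act g"
proof -
  have conj: "s \<in> N" if "N \<lhd> G" "inv x \<otimes> s \<otimes> x \<in> N" "s \<in> carrier G" "x \<in> carrier G" for N s x
  proof -
    have "x \<otimes> (inv x \<otimes> s \<otimes> x) \<otimes> inv x \<in> N"
      using that normal.inv_op_closed2 by metis
    moreover have "x \<otimes> (inv x \<otimes> s \<otimes> x) = s \<otimes> x" using that by (simp flip: m_assoc)
    ultimately have "s \<otimes> x \<otimes> inv x \<in> N" by simp
    then show ?thesis using that by (simp add: m_assoc)
  qed
  have "\<exists>M f. finite_index M G \<and> additive_on G M f \<and>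
    (\<forall>s\<in>S. \<forall>x\<in>carrier G. inv x \<otimes> s \<otimes> x \<notin> M) \<and>
    (\<forall>m::nat. g [^] m \<in> M \<and> f (g [^] m) = 0 \<longrightarrow> g [^] m = \<one>)"
  proof (cases "\<exists>m::int. g [^] m = \<one> \<and> m \<noteq> 0")
    case True
    then have "finite (S \<union> (generate G {g} - {\<one>}))"
      using S finite_generate_if_torsion[OF g] by blast
    moreover have "S \<union> (generate G {g} - {\<one>}) \<subseteq> carrier G" using generate_incl[of "{g}"] g S by blast
    moreover have "\<one> \<notin> S \<union> (generate G {g} - {\<one>})" using S by blast
    ultimately obtain N where N: "N \<lhd> G" "finite_index N G" "N \<inter> (S \<union> (generate G {g} - {\<one>})) = {}"
      by (rule VRC_separate_finite[OF G])
    have "g [^] m \<in> generate G {g}" for m :: nat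
      using mem_generate_iff[OF g] int_pow_int by metis
    then have "\<forall>m::nat. g [^] m \<in> N \<longrightarrow> g [^] m = \<one>" using N(3) by blast
    moreover have "\<forall>s\<in>S. \<forall>x\<in>carrier G. inv x \<otimes> s \<otimes> x \<notin> N" using N S conj by blast
    moreover have "additive_on G N (\<lambda>_. 0)" by (simp add: additive_on_def)
    ultimately show ?thesis using N(2) by blast
  next
    case False
    then obtain K f where K: "finite_index K G" "additive_on G K f" "g \<in> K" "f g = 1"
      using VRC_infinite_order[OF G g] by metis
    obtain N where N: "N \<lhd> G" "finite_index N G" "N \<inter> S = {}" using VRC_separate_finite[OF G S] .
    have "additive_on G (K \<inter> N) f" using K(2) by (auto simp: additive_on_def)
    moreover have "f (g [^] m) = int m" for m :: nat
      using additive_on_int_pow[OF K(2) finite_index_subgroup[OF K(1)] K(3), of "int m"] K(4)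
      by (simp add: int_pow_int)
    then have "\<forall>m::nat. g [^] m \<in> K \<inter> N \<and> f (g [^] m) = 0 \<longrightarrow> g [^] m = \<one>" by simp
    moreover have "\<forall>s\<in>S. \<forall>x\<in>carrier G. inv x \<otimes> s \<otimes> x \<notin> K \<inter> N" using N S conj by blast
    ultimately show ?thesis using finite_index_Int[OF K(1) N(2)] by blast
  qed
  then obtain M f where M: "finite_index M G" "additive_on G M f"
    "\<forall>s\<in>S. \<forall>x\<in>carrier G. inv x \<otimes> s \<otimes> x \<notin> M"
    "\<forall>m::nat. g [^] m \<in> M \<and> f (g [^] m) = 0 \<longrightarrow> g [^] m = \<one>" by blast
  obtain X act x\<^sub>0 where X: "finite X" "X \<subseteq> carrier G" "shift_action G X act" "x\<^sub>0 \<in> X"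
    "\<And>s x. s \<in> carrier G \<Longrightarrow> x \<in> X \<Longrightarrow> fst (act s (x, 0)) = x \<Longrightarrow> inv x \<otimes> s \<otimes> x \<in> M"
    "\<And>h. h \<in> carrier G \<Longrightarrow> act h (x\<^sub>0, 0) = (x\<^sub>0, 0) \<Longrightarrow> h \<in> M \<and> f h = 0"
    using induced_shift_action[OF M(1,2)] by blast
  show ?thesis
  proof (rule that[OF X(1) _ X(2,3)])
    show "X \<noteq> {}" using X(4) by blast
    show "fst (act s (x, 0)) \<noteq> x" if "s \<in> S" "x \<in> X" for s x
      using that X(2,5) M(3) S by blast
    show "faithful_on_powers G X act g"
      unfolding faithful_on_powers_def using X(4,6) M(4) g by blast
  qed
qed

end

section \<open>Matching free actions\<close>

text \<open>Freeness is asked for on \<open>X\<close>, that is, modulo the shift. The product of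
  \<open>E\<close> with the group of shifts then acts freely on
  \<open>X \<times> UNIV\<close>.\<close>

definition free_action :: "('h, 'm) monoid_scheme \<Rightarrow> 'x set \<Rightarrow> ('h \<Rightarrow> 'x \<times> int \<Rightarrow> 'x \<times> int) \<Rightarrow> bool" where
  "free_action E X \<alpha> \<longleftrightarrow>
     shift_action E X \<alpha> \<and> (\<forall>a\<in>carrier E. \<forall>x\<in>X. fst (\<alpha> a (x, 0)) = x \<longrightarrow> a = \<one>\<^bsub>E\<^esub>)"

text \<open>The points \<open>p i\<close> lie in pairwise distinct free orbits of \<open>E \<times> \<int>\<close>.\<close>

definition free_family ::
    "('h, 'm) monoid_scheme \<Rightarrow> ('h \<Rightarrow> 'x \<times> int \<Rightarrow> 'x \<times> int) \<Rightarrow> ('i \<Rightarrow> 'x \<times> int) \<Rightarrow> 'i set \<Rightarrow> bool" where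
  "free_family E \<alpha> p I \<longleftrightarrow> inj_on (\<lambda>(i, a). fst (\<alpha> a (p i))) (I \<times> carrier E)"

lemma shift_action_fst:
  assumes "shift_action G X act" "a \<in> carrier G" "y \<in> X \<times> UNIV"
  shows "fst (act a y) \<in> X" "fst (act a y) = fst (act a (fst y, 0))"
proof -
  obtain x k where y: "y = (x, k)" by (cases y)
  have x: "x \<in> X" using assms y by simp
  note D = shift_mapD[OF shift_actionD(1)[OF assms(1,2)] x]
  show "fst (act a y) \<in> X" "fst (act a y) = fst (act a (fst y, 0))"
    unfolding y D(2)[of k] using D(1) by simp_all
qed

lemma shift_action_fst_translate:
  fixes G (structure)
  assumes G: "group G" and act: "shift_action G X act" and ab: "a \<in> carrier G" "b \<in> carrier G"
    and yz: "y \<in> X \<times> UNIV" "z \<in> X \<times> UNIV" and e: "fst (act a y) = fst (act b z)"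
  shows "fst y = fst (act (inv\<^bsub>G\<^esub> a \<otimes>\<^bsub>G\<^esub> b) z)"
proof -
  interpret group G by (rule G)
  have c: "inv a \<in> carrier G" using ab by simp
  note cl = shift_map_closed[OF shift_actionD(1)[OF act]]
  have "act (inv a) (act a y) = y"
    using shift_actionD(3)[OF act c ab(1) yz(1)] shift_actionD(2)[OF act yz(1)] ab by simp
  then have "fst y = fst (act (inv a) (act a y))" by simp
  also have "\<dots> = fst (act (inv a) (act b z))"
    using shift_action_fst(2)[OF act c cl[OF ab(1) yz(1)]]
      shift_action_fst(2)[OF act c cl[OF ab(2) yz(2)]] e by simp
  also have "\<dots> = fst (act (inv a \<otimes> b) z)"
    using shift_actionD(3)[OF act c ab(2) yz(2)] by simp
  finally show ?thesis .
qed

lemma free_actionD: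
  fixes E (structure)
  assumes E: "group E" and \<alpha>: "free_action E X \<alpha>" and ab: "a \<in> carrier E" "b \<in> carrier E"
    and y: "y \<in> X \<times> UNIV" and e: "fst (\<alpha> a y) = fst (\<alpha> b y)"
  shows "a = b"
proof -
  interpret group E by (rule E)
  have act: "shift_action E X \<alpha>" using \<alpha> by (simp add: free_action_def)
  have c: "inv a \<otimes> b \<in> carrier E" using ab by simp
  have "fst y = fst (\<alpha> (inv a \<otimes> b) y)"
    by (rule shift_action_fst_translate[OF E act ab y y e])
  then have "fst (\<alpha> (inv a \<otimes> b) (fst y, 0)) = fst y"
    using shift_action_fst(2)[OF act c y] by simp
  moreover have "fst y \<in> X" using y by (simp add: mem_Times_iff)
  ultimately have "inv a \<otimes> b = \<one>" using \<alpha> c unfolding free_action_def by blast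
  then show ?thesis using ab by (metis inv_equality inv_inv inv_closed)
qed

text \<open>A common translate of an old and the new point could be moved back by a group element,
  which would put \<open>fst (p j)\<close> into an old orbit.\<close>

lemma free_family_insert:
  fixes E (structure)
  assumes E: "group E" and \<alpha>: "free_action E X \<alpha>" and I: "free_family E \<alpha> p I"
    and p: "\<And>i. i \<in> insert j I \<Longrightarrow> p i \<in> X \<times> UNIV"
    and j: "fst (p j) \<notin> (\<lambda>(i, a). fst (\<alpha> a (p i))) ` (I \<times> carrier E)"
  shows "free_family E \<alpha> p (insert j I)"
  unfolding free_family_def
proof (rule inj_onI, clarify)
  interpret group E by (rule E)
  have act: "shift_action E X \<alpha>" using \<alpha> by (simp add: free_action_def)
  have new: False if "i \<in> I" "a \<in> carrier E" "b \<in> carrier E" "fst (\<alpha> a (p j)) = fst (\<alpha> b (p i))" for i a b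
  proof -
    have "fst (p j) = fst (\<alpha> (inv a \<otimes> b) (p i))"
      by (rule shift_action_fst_translate[OF E act that(2,3) p p that(4)]) (use that in auto)
    then show False using j that by (auto simp: image_iff)
  qed
  fix i a i' b
  assume i: "i \<in> insert j I" and a: "a \<in> carrier E" and i': "i' \<in> insert j I" and b: "b \<in> carrier E"
    and e: "fst (\<alpha> a (p i)) = fst (\<alpha> b (p i'))"
  consider "i \<in> I" "i' \<in> I" | "i = j" "i' = j" | "i \<in> I" "i' = j" | "i = j" "i' \<in> I"
    using i i' by blast
  then show "i = i' \<and> a = b"
  proof cases
    case 1
    then show ?thesis using inj_onD[OF I[unfolded free_family_def], of "(i, a)" "(i', b)"] a b e by simp
  next
    case 2
    then show ?thesis using free_actionD[OF E \<alpha> a b p[OF i]] e by simp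
  next
    case 3
    then show ?thesis using new[of i b a] a b e[symmetric] by simp
  next
    case 4
    then show ?thesis using new[of i' a b] a b e by simp
  qed
qed

text \<open>
  Enlarge \<open>M\<close> to a maximal set of pairs whose first components, and whose second components, lie in
  distinct orbits. As all orbits are free, both components then meet every orbit.
\<close>

lemma equivariant_matching:
  fixes E (structure) and X :: "'x set"
  assumes X: "finite X" and E: "group E" "finite (carrier E)"
    and \<alpha>: "free_action E X \<alpha>" and \<beta>: "free_action E X \<beta>"
    and M: "M \<subseteq> (X \<times> UNIV) \<times> (X \<times> UNIV)"
      "free_family E \<alpha> fst M" "free_family E \<beta> snd M"
  obtains t where "bij_betw t (X \<times> UNIV) (X \<times> UNIV)" "shift_map X t"
    "\<And>p q. (p, q) \<in> M \<Longrightarrow> t p = q"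
    "\<And>a y. a \<in> carrier E \<Longrightarrow> y \<in> X \<times> UNIV \<Longrightarrow> t (\<alpha> a y) = \<beta> a (t y)"
proof -
  interpret group E by (rule E)
  let ?Y = "X \<times> (UNIV :: int set)"
  have act: "shift_action E X \<alpha>" "shift_action E X \<beta>" using \<alpha> \<beta> by (simp_all add: free_action_def)
  define l\<alpha> where "l\<alpha> = (\<lambda>(m, a). fst (\<alpha> a (fst (m :: ('x \<times> int) \<times> 'x \<times> int))))"
  define l\<beta> where "l\<beta> = (\<lambda>(m, a). fst (\<beta> a (snd (m :: ('x \<times> int) \<times> 'x \<times> int))))"
  define P where "P N \<longleftrightarrow> M \<subseteq> N \<and> N \<subseteq> ?Y \<times> ?Y \<and> free_family E \<alpha> fst N \<and> free_family E \<beta> snd N" for N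
  have PM: "P M" using M by (simp add: P_def)
  have lX: "l\<alpha> ` (N \<times> carrier E) \<subseteq> X" "l\<beta> ` (N \<times> carrier E) \<subseteq> X" if "N \<subseteq> ?Y \<times> ?Y" for N
  proof -
    have "l\<alpha> (m, a) \<in> X" "l\<beta> (m, a) \<in> X" if "m \<in> N" "a \<in> carrier E" for m a
      using shift_action_fst(1)[OF act(1) that(2), of "fst m"]
        shift_action_fst(1)[OF act(2) that(2), of "snd m"] \<open>N \<subseteq> ?Y \<times> ?Y\<close> that(1)
      by (auto simp: l\<alpha>_def l\<beta>_def mem_Times_iff)
    then show "l\<alpha> ` (N \<times> carrier E) \<subseteq> X" "l\<beta> ` (N \<times> carrier E) \<subseteq> X" by auto
  qed
  have inj: "inj_on l\<alpha> (N \<times> carrier E)" "inj_on l\<beta> (N \<times> carrier E)" if "P N" for N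
    using that by (simp_all add: P_def free_family_def l\<alpha>_def l\<beta>_def)
  have fin: "finite N" "card N \<le> card X" if N: "P N" for N
  proof -
    have sub: "l\<alpha> ` (N \<times> carrier E) \<subseteq> X" using lX N by (simp add: P_def)
    then have "finite (N \<times> carrier E)" using X inj(1)[OF N] finite_imageD finite_subset by blast
    then show fN: "finite N" using finite_cartesian_productD1[of N "carrier E"] by auto
    have "card N * card (carrier E) \<le> card X"
      using card_mono[OF X sub] card_image[OF inj(1)[OF N]] by (simp add: card_cartesian_product)
    moreover have "card (carrier E) > 0" using E by (auto simp: card_gt_0_iff)
    ultimately show "card N \<le> card X"
      by (metis One_nat_def Suc_leI le_trans mult.right_neutral mult_le_mono2)
  qed
  \<comment> \<open>Injectivity of \<open>l\<alpha>\<close> bounds the number of pairs by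
    \<open>card X\<close>, so a largest \<open>N\<close> exists.\<close>
  obtain N where N: "P N" "\<And>N'. P N' \<Longrightarrow> card N' \<le> card N"
    using ex_has_greatest_nat[of P M card "Suc (card X)"] PM fin(2) by (auto simp: less_Suc_eq_le)
  have NY: "N \<subseteq> ?Y \<times> ?Y" using N by (simp add: P_def)
  \<comment> \<open>Both families cover \<open>card N * card (carrier E)\<close> points of
    \<open>X\<close>. Hence a point missed on one side forces a missed point on the other, and the
    two can be paired.\<close>
  have cards: "card (l\<alpha> ` (N \<times> carrier E)) = card (l\<beta> ` (N \<times> carrier E))"
    using card_image[OF inj(1)[OF N(1)]] card_image[OF inj(2)[OF N(1)]] by simp
  have full: "l\<alpha> ` (N \<times> carrier E) = X \<and> l\<beta> ` (N \<times> carrier E) = X"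
  proof (rule ccontr)
    assume "\<not> (l\<alpha> ` (N \<times> carrier E) = X \<and> l\<beta> ` (N \<times> carrier E) = X)"
    then have "l\<alpha> ` (N \<times> carrier E) \<noteq> X" "l\<beta> ` (N \<times> carrier E) \<noteq> X"
      using cards card_subset_eq[OF X] lX[OF NY] by metis+
    then obtain x x' where x: "x \<in> X" "x \<notin> l\<alpha> ` (N \<times> carrier E)" "x' \<in> X" "x' \<notin> l\<beta> ` (N \<times> carrier E)"
      using lX[OF NY] by blast
    define j where "j = ((x, 0 :: int), (x', 0 :: int))"
    have jN: "j \<notin> N"
    proof
      assume "j \<in> N"
      then have "l\<alpha> (j, \<one>) \<in> l\<alpha> ` (N \<times> carrier E)" by blast
      moreover have "l\<alpha> (j, \<one>) = x"
        using shift_actionD(2)[OF act(1), of "(x, 0)"] x by (simp add: l\<alpha>_def j_def)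
      ultimately show False using x by simp
    qed
    have "P (insert j N)"
      unfolding P_def
    proof (intro conjI)
      show sub: "insert j N \<subseteq> ?Y \<times> ?Y" using x NY by (simp add: j_def)
      show "free_family E \<alpha> fst (insert j N)"
        by (rule free_family_insert[OF E(1) \<alpha>]) (use N(1) sub x in \<open>auto simp: P_def j_def l\<alpha>_def\<close>)
      show "free_family E \<beta> snd (insert j N)"
        by (rule free_family_insert[OF E(1) \<beta>]) (use N(1) sub x in \<open>auto simp: P_def j_def l\<beta>_def\<close>)
    qed (use N(1) in \<open>auto simp: P_def\<close>)
    then show False using N(2)[of "insert j N"] fin(1)[OF N(1)] jN by simp
  qed
  define ix where "ix = inv_into (N \<times> carrier E) l\<alpha>"
  have ix: "ix (l\<alpha> (m, a)) = (m, a)" if "m \<in> N" "a \<in> carrier E" for m a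
    unfolding ix_def by (rule inv_into_f_f[OF inj(1)[OF N(1)]]) (use that in simp)
  \<comment> \<open>The first component of \<open>y\<close> determines the pair \<open>m\<close> and
    the group element \<open>a\<close>. The shift then corrects the integer component, so the value
    of \<open>t\<close> is the one forced by equivariance.\<close>
  define t where "t y = (case ix (fst y) of (m, a) \<Rightarrow> shift (snd y - snd (\<alpha> a (fst m))) (\<beta> a (snd m)))" for y
  have t: "t (shift k (\<alpha> a p)) = shift k (\<beta> a q)" if "(p, q) \<in> N" "a \<in> carrier E" for p q a k
    using ix[OF that] by (simp add: t_def l\<alpha>_def)
  have decomp: "\<exists>p q a k. (p, q) \<in> N \<and> a \<in> carrier E \<and> y = shift k (\<alpha> a p)" if "y \<in> ?Y" for y
  proof -
    have "fst y \<in> l\<alpha> ` (N \<times> carrier E)" using that full by (simp add: mem_Times_iff)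
    then obtain m a where m: "m \<in> N" "a \<in> carrier E" "fst y = fst (\<alpha> a (fst m))" by (auto simp: l\<alpha>_def)
    then have "y = shift (snd y - snd (\<alpha> a (fst m))) (\<alpha> a (fst m))"
      by (simp add: shift_def prod_eq_iff)
    then show ?thesis using m by (metis prod.collapse)
  qed
  have Ypq: "p \<in> ?Y" "q \<in> ?Y" if "(p, q) \<in> N" for p q using that NY by auto
  have cl: "\<alpha> a p \<in> ?Y" "\<beta> a p \<in> ?Y" if "a \<in> carrier E" "p \<in> ?Y" for a p
    using shift_map_closed[OF shift_actionD(1)[OF act(1) that(1)] that(2)]
      shift_map_closed[OF shift_actionD(1)[OF act(2) that(1)] that(2)] .
  have tY: "t y \<in> ?Y" if "y \<in> ?Y" for y
  proof -
    obtain p q a k where *: "(p, q) \<in> N" "a \<in> carrier E" "y = shift k (\<alpha> a p)"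
      using decomp[OF \<open>y \<in> ?Y\<close>] by blast
    show ?thesis
      unfolding *(3) t[OF *(1,2)] shift_simps by (rule cl[OF *(2) Ypq(2)[OF *(1)]])
  qed
  have t_inj: "inj_on t ?Y"
  proof (rule inj_onI)
    fix y z assume y: "y \<in> ?Y" and z: "z \<in> ?Y" and e: "t y = t z"
    obtain p q a k where 1: "(p, q) \<in> N" "a \<in> carrier E" "y = shift k (\<alpha> a p)"
      using decomp[OF y] by blast
    obtain p' q' a' k' where 2: "(p', q') \<in> N" "a' \<in> carrier E" "z = shift k' (\<alpha> a' p')"
      using decomp[OF z] by blast
    have e': "shift k (\<beta> a q) = shift k' (\<beta> a' q')" using e t 1 2 by simp
    then have "fst (shift k (\<beta> a q)) = fst (shift k' (\<beta> a' q'))" by simp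
    then have "l\<beta> ((p, q), a) = l\<beta> ((p', q'), a')" by (simp add: l\<beta>_def)
    then have "((p, q), a) = ((p', q'), a')"
      using inj_onD[OF inj(2)[OF N(1)]] 1 2 by blast
    then show "y = z" using 1 2 e' by (simp add: shift_def)
  qed
  have t_surj: "?Y \<subseteq> t ` ?Y"
  proof
    fix z assume z: "z \<in> ?Y"
    then have "fst z \<in> l\<beta> ` (N \<times> carrier E)" using full by (simp add: mem_Times_iff)
    then obtain p q a where m: "(p, q) \<in> N" "a \<in> carrier E" "fst z = fst (\<beta> a q)" by (auto simp: l\<beta>_def)
    then have "z = t (shift (snd z - snd (\<beta> a q)) (\<alpha> a p))"
      unfolding t[OF m(1,2)] by (simp add: shift_def prod_eq_iff)
    moreover have "shift (snd z - snd (\<beta> a q)) (\<alpha> a p) \<in> ?Y"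
      unfolding shift_simps by (rule cl[OF m(2) Ypq(1)[OF m(1)]])
    ultimately show "z \<in> t ` ?Y" by (rule image_eqI)
  qed
  show ?thesis
  proof (rule that[of t])
    show "bij_betw t ?Y ?Y"
      unfolding bij_betw_def using t_inj t_surj tY by (intro conjI equalityI image_subsetI)
    show "shift_map X t"
    proof (rule shift_mapI'[OF tY])
      show "t (shift k y) = shift k (t y)" for y k
        by (cases "ix (fst y)") (simp add: t_def algebra_simps)
    qed
    show "t p = q" if "(p, q) \<in> M" for p q
    proof -
      have pq: "(p, q) \<in> N" using that N(1) by (auto simp: P_def)
      show ?thesis
        using t[OF pq one_closed, of 0] shift_actionD(2)[OF act(1) Ypq(1)[OF pq]]
          shift_actionD(2)[OF act(2) Ypq(2)[OF pq]] by simp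
    qed
    fix b y assume b: "b \<in> carrier E" and y: "y \<in> ?Y"
    obtain p q a k where *: "(p, q) \<in> N" "a \<in> carrier E" "y = shift k (\<alpha> a p)"
      using decomp[OF y] by blast
    note pq = Ypq[OF *(1)]
    have "\<alpha> b y = shift k (\<alpha> (b \<otimes> a) p)"
      using shift_map_shift[OF shift_actionD(1)[OF act(1) b] cl(1)[OF *(2) pq(1)]]
        shift_actionD(3)[OF act(1) b *(2) pq(1)] *(3) by simp
    then have "t (\<alpha> b y) = shift k (\<beta> (b \<otimes> a) q)" using t[OF *(1)] b * by simp
    also have "\<dots> = \<beta> b (shift k (\<beta> a q))"
      using shift_map_shift[OF shift_actionD(1)[OF act(2) b] cl(2)[OF *(2) pq(2)]]
        shift_actionD(3)[OF act(2) b *(2) pq(2)] by simp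
    also have "shift k (\<beta> a q) = t y" using t[OF *(1,2)] *(3) by simp
    finally show "t (\<alpha> b y) = \<beta> b (t y)" .
  qed
qed

section \<open>A common set for all vertex groups\<close>

text \<open>The \<open>nat\<close> component provides invariant levels.\<close>

definition product_action ::
    "'v \<Rightarrow> ('a \<Rightarrow> 'x \<times> int \<Rightarrow> 'x \<times> int) \<Rightarrow> 'a \<Rightarrow> (('v \<Rightarrow> 'x) \<times> nat) \<times> int \<Rightarrow> (('v \<Rightarrow> 'x) \<times> nat) \<times> int" where
  "product_action v act a = (\<lambda>((q, c), k).
     ((q(v := fst (act a (q v, 0))), c), snd (act a (q v, 0)) + k))"

lemma product_action_level: "snd (fst (product_action v act a y)) = snd (fst y)"
  by (simp add: product_action_def split: prod.splits)

text \<open>Each vertex group moves only the coordinate of its own vertex, while the integer is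
  shared by all. This gives all vertex groups the same point set without any relation between the
  sets \<open>X v\<close>.\<close>

lemma shift_action_product_action:
  assumes act: "shift_action G (X v) act" and v: "v \<in> V"
  shows "shift_action G (PiE V X \<times> C) (product_action v act)"
  unfolding shift_action_def
proof (intro conjI ballI)
  note D = shift_mapD[OF shift_actionD(1)[OF act]]
  have qv: "q v \<in> X v" if "q \<in> PiE V X" for q using that v by auto
  fix a assume a: "a \<in> carrier G"
  show "shift_map (PiE V X \<times> C) (product_action v act a)"
  proof (rule shift_mapI')
    fix y assume "y \<in> (PiE V X \<times> C) \<times> (UNIV :: int set)"
    then obtain q c k where y: "y = ((q, c), k)" "q \<in> PiE V X" "c \<in> C" by auto
    have "q(v := fst (act a (q v, 0))) \<in> PiE V X"
      using y(2) D(1)[OF a qv[OF y(2)]] v by (auto simp: PiE_iff extensional_def)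
    then show "product_action v act a y \<in> (PiE V X \<times> C) \<times> UNIV" using y by (simp add: product_action_def)
  next
    fix y k show "product_action v act a (shift k y) = shift k (product_action v act a y)"
      by (cases y) (auto simp: product_action_def shift_def)
  qed
  fix b y assume b: "b \<in> carrier G" and "y \<in> (PiE V X \<times> C) \<times> (UNIV :: int set)"
  then obtain q c k where y: "y = ((q, c), k)" "q \<in> PiE V X" by auto
  note q = qv[OF y(2)]
  have "act (a \<otimes>\<^bsub>G\<^esub> b) (q v, 0) = act a (act b (q v, 0))"
    using shift_actionD(3)[OF act a b, of "(q v, 0)"] q by simp
  also have "\<dots> = act a (fst (act b (q v, 0)), snd (act b (q v, 0)))" by simp
  also have "\<dots> = (fst (act a (fst (act b (q v, 0)), 0)),
      snd (act a (fst (act b (q v, 0)), 0)) + snd (act b (q v, 0)))"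
    by (rule D(2)[OF a D(1)[OF b q]])
  finally show "product_action v act (a \<otimes>\<^bsub>G\<^esub> b) y = product_action v act a (product_action v act b y)"
    by (simp add: product_action_def y)
next
  fix y assume "y \<in> (PiE V X \<times> C) \<times> (UNIV :: int set)"
  then obtain q c k where y: "y = ((q, c), k)" "q \<in> PiE V X" by auto
  then have "q v \<in> X v" using v by auto
  then show "product_action v act \<one>\<^bsub>G\<^esub> y = y"
    using shift_actionD(2)[OF act, of "(q v, 0)"] by (simp add: product_action_def y)
qed

lemma product_action_fst_eq:
  assumes "fst (product_action v act a (x, k)) = x"
  shows "fst (act a (fst x v, 0)) = fst x v"
proof -
  have "fst (fst (product_action v act a (x, k))) v = fst x v" using assms by simp
  then show ?thesis by (cases x) (simp add: product_action_def)
qed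

lemma faithful_on_powers_product_action:
  assumes f: "faithful_on_powers G (X v) act g" and act: "shift_action G (X v) act"
    and G: "group G" "g \<in> carrier G" and v: "v \<in> V" and X: "\<And>v. v \<in> V \<Longrightarrow> X v \<noteq> {}" and C: "C \<noteq> {}"
  shows "faithful_on_powers G (PiE V X \<times> C) (product_action v act) g"
  unfolding faithful_on_powers_def
proof (intro allI impI)
  fix m :: nat
  assume *: "\<forall>y\<in>(PiE V X \<times> C) \<times> UNIV. product_action v act (g [^]\<^bsub>G\<^esub> m) y = y"
  obtain c where c: "c \<in> C" using C by blast
  have "act (g [^]\<^bsub>G\<^esub> m) y = y" if "y \<in> X v \<times> UNIV" for y
  proof -
    obtain x k where y: "y = (x, k)" "x \<in> X v" using \<open>y \<in> X v \<times> UNIV\<close> by auto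
    \<comment> \<open>A point of one factor is extended to the product by arbitrary choices in the
      other factors, which exist because these are nonempty.\<close>
    define q where "q = (\<lambda>u\<in>V. if u = v then x else SOME z. z \<in> X u)"
    have q: "q \<in> PiE V X" "q v = x"
      using X y v by (auto simp: q_def some_in_eq)
    then have "product_action v act (g [^]\<^bsub>G\<^esub> m) ((q, c), 0) = ((q, c), 0)" using * c by simp
    then have "q(v := fst (act (g [^]\<^bsub>G\<^esub> m) (x, 0))) = q" "snd (act (g [^]\<^bsub>G\<^esub> m) (x, 0)) = 0"
      by (simp_all add: product_action_def q(2))
    then have e: "fst (act (g [^]\<^bsub>G\<^esub> m) (x, 0)) = x" "snd (act (g [^]\<^bsub>G\<^esub> m) (x, 0)) = 0"
      using q(2) by (metis fun_upd_same, simp)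
    have gm: "g [^]\<^bsub>G\<^esub> m \<in> carrier G" using G by (simp add: group.is_monoid monoid.nat_pow_closed)
    show ?thesis
      using shift_mapD(2)[OF shift_actionD(1)[OF act gm] y(2), of k] unfolding y(1) e by simp
  qed
  then show "g [^]\<^bsub>G\<^esub> m = \<one>\<^bsub>G\<^esub>" using f unfolding faithful_on_powers_def by blast
qed

section \<open>Actions of the path group\<close>

fun letter_map ::
    "('v \<Rightarrow> 'g \<Rightarrow> 'y \<Rightarrow> 'y) \<Rightarrow> ('e \<Rightarrow> 'y \<Rightarrow> 'y) \<Rightarrow> ('v, 'e, 'g) letter \<Rightarrow> 'y \<Rightarrow> 'y" where
  "letter_map act T (Vertex_El v g) = act v g"
| "letter_map act T (Edge e) = T e"

context graph_of_groups
begin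

abbreviation word_class :: "('v, 'e, 'g) letter list \<Rightarrow> ('v, 'e, 'g) letter list set" where
  "word_class w \<equiv> path_cong A `` {w}"

lemma word_class_eq: "(x, y) \<in> path_cong A \<Longrightarrow> word_class x = word_class y"
  by (rule equiv_class_eq[OF equiv_path_cong])

lemma word_class_carrier: "w \<in> lists (letters A) \<Longrightarrow> word_class w \<in> carrier (path_group A)"
  unfolding path_group_carrier by blast

text \<open>The universal property of the presentation. \<open>T e\<close> carries the action at the
  head of \<open>e\<close> to the action at its tail; with \<open>T_inv\<close> this equivariance is
  the conjugation relation. \<open>foldr\<close> lets the rightmost letter act first, as a left
  action requires.\<close>

lemma path_group_shift_action:
  fixes X :: "'x set"
  assumes act: "\<And>v. v \<in> verts (base_graph A) \<Longrightarrow> shift_action (vertex_group A v) X (act v)"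
    and T: "\<And>e. e \<in> arcs (base_graph A) \<Longrightarrow> shift_map X (T e)"
    and T_inv: "\<And>e y. e \<in> arcs (base_graph A) \<Longrightarrow> y \<in> X \<times> UNIV \<Longrightarrow> T e (T (einv A e) y) = y"
    and T_equiv: "\<And>e a y. e \<in> arcs (base_graph A) \<Longrightarrow> a \<in> carrier (edge_group A e) \<Longrightarrow>
      y \<in> X \<times> UNIV \<Longrightarrow> T e (act (head (base_graph A) e) (edge_map A e a) y) =
        act (tail (base_graph A) e) (edge_map A (einv A e) a) (T e y)"
  shows "\<exists>Act. shift_action (path_group A) X Act \<and> (\<forall>w\<in>lists (letters A). \<forall>y\<in>X \<times> UNIV.
    Act (word_class w) y = foldr (letter_map act T) w y)"
proof -
  let ?Y = "X \<times> (UNIV :: int set)"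
  let ?F = "foldr (letter_map act T)"
  have letter: "shift_map X (letter_map act T s)" if "s \<in> letters A" for s
    using that shift_actionD(1)[OF act] T by (auto simp: letters_def)
  have word: "shift_map X (?F w)" if "w \<in> lists (letters A)" for w
    using that
  proof (induction w)
    case Nil
    then show ?case using shift_map_id by (simp add: id_def)
  next
    case (Cons s w)
    then show ?case using shift_map_comp[OF letter[of s], of "?F w"] by (simp add: comp_def)
  qed
  have wordY: "?F w y \<in> ?Y" if "w \<in> lists (letters A)" "y \<in> ?Y" for w y
    using shift_map_closed[OF word[OF that(1)] that(2)] .
  have rel: "?F l y = ?F r y" if "(l, r) \<in> path_relations A" and y: "y \<in> ?Y" for l r y
    using that(1)
  proof cases
    case (vertex_one v)
    then show ?thesis using shift_actionD(2)[OF act y] by simp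
  next
    case (vertex_mult v g h)
    then show ?thesis using shift_actionD(3)[OF act _ _ y] by simp
  next
    case (edge_inverse e)
    then show ?thesis using T_inv y by simp
  next
    case (edge_conj e a)
    have "T (einv A e) y \<in> ?Y" using edge_conj y by (intro shift_map_closed[OF T]) auto
    then show ?thesis using edge_conj T_equiv[of e a "T (einv A e) y"] T_inv[of e y] y by simp
  qed
  have cong: "?F x y = ?F x' y" if "(x, x') \<in> path_cong A" "y \<in> ?Y" for x x' y
    using that
  proof (induction rule: path_cong.induct)
    case (step l r x z)
    then show ?case using rel[of l r "?F z y"] wordY by simp
  qed auto
  \<comment> \<open>By \<open>cong\<close>, any word of the class gives the same map on
    \<open>X \<times> UNIV\<close>.\<close>
  define Act where "Act C y = ?F (SOME w. w \<in> C) y" for C y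
  have Act: "Act (word_class w) y = ?F w y" if "w \<in> lists (letters A)" "y \<in> ?Y" for w y
  proof -
    have "w \<in> word_class w" using that by (simp add: path_cong.refl)
    then have "(SOME w'. w' \<in> word_class w) \<in> word_class w" by (rule someI[of "\<lambda>w'. w' \<in> word_class w"])
    then show ?thesis using cong[of w _ y] that by (simp add: Act_def)
  qed
  show ?thesis
  proof (rule exI[of _ Act], intro conjI ballI)
    show "shift_action (path_group A) X Act"
      unfolding shift_action_def
    proof (intro conjI ballI)
      fix C assume "C \<in> carrier (path_group A)"
      then obtain w where w: "w \<in> lists (letters A)" "C = word_class w"
        unfolding path_group_carrier by blast
      show "shift_map X (Act C)"
        by (rule shift_mapI') (use w word[OF w(1)] in
            \<open>simp_all add: Act shift_map_closed shift_map_shift del: mem_Sigma_iff\<close>)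
      fix D y assume "D \<in> carrier (path_group A)" and y: "y \<in> ?Y"
      then obtain w' where w': "w' \<in> lists (letters A)" "D = word_class w'"
        unfolding path_group_carrier by blast
      have "w @ w' \<in> lists (letters A)" using w w' by simp
      then show "Act (C \<otimes>\<^bsub>path_group A\<^esub> D) y = Act C (Act D y)"
        unfolding w(2) w'(2) path_group_mult[OF w(1) w'(1)]
        using w w' y wordY by (simp add: Act del: mem_Sigma_iff append_in_lists_conv)
    next
      fix y assume "y \<in> ?Y"
      then show "Act \<one>\<^bsub>path_group A\<^esub> y = y" unfolding path_group_one using Act[of "[]" y] by simp
    qed
  qed (rule Act)
qed

abbreviation edge_action :: "('v \<Rightarrow> 'g \<Rightarrow> 'y \<Rightarrow> 'y) \<Rightarrow> 'e \<Rightarrow> 'h \<Rightarrow> 'y \<Rightarrow> 'y" where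
  "edge_action act e a \<equiv> act (head (base_graph A) e) (edge_map A e a)"

lemma shift_action_edge_action:
  assumes act: "\<And>v. v \<in> verts (base_graph A) \<Longrightarrow> shift_action (vertex_group A v) X (act v)"
    and e: "e \<in> arcs (base_graph A)"
  shows "shift_action (edge_group A e) X (edge_action act e)"
proof -
  let ?v = "head (base_graph A) e"
  have v: "?v \<in> verts (base_graph A)" using e by simp
  interpret group_hom "edge_group A e" "vertex_group A ?v" "edge_map A e"
    using edge_map[OF e] edge_group[OF e] vertex_group[OF v]
    by (auto simp: group_hom_def group_hom_axioms_def mon_def)
  show ?thesis
    using act[OF v] unfolding shift_action_def by simp
qed

text \<open>Matchings exist for each edge separately, but those of an edge and its inverse must be
  mutually inverse. So one is chosen per pair of opposite edges; the symmetry \<open>M_inv\<close>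
  makes its inverse respect the pairs prescribed on the other edge.\<close>

lemma edge_matchings:
  fixes X :: "'x set"
  assumes X: "finite X"
    and act: "\<And>v. v \<in> verts (base_graph A) \<Longrightarrow> shift_action (vertex_group A v) X (act v)"
    and fin: "\<And>e. e \<in> arcs (base_graph A) \<Longrightarrow> finite (carrier (edge_group A e))"
    and free: "\<And>e a x. e \<in> arcs (base_graph A) \<Longrightarrow> a \<in> carrier (edge_group A e) \<Longrightarrow> x \<in> X \<Longrightarrow>
      fst (edge_action act e a (x, 0)) = x \<Longrightarrow> a = \<one>\<^bsub>edge_group A e\<^esub>"
    and M: "\<And>e. e \<in> arcs (base_graph A) \<Longrightarrow> M e \<subseteq> (X \<times> UNIV) \<times> (X \<times> UNIV)"
    and M_inv: "\<And>e. e \<in> arcs (base_graph A) \<Longrightarrow> M (einv A e) = (M e)\<inverse>"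
    and M_free: "\<And>e. e \<in> arcs (base_graph A) \<Longrightarrow> free_family (edge_group A e) (edge_action act e) fst (M e)"
  obtains T where "\<And>e. e \<in> arcs (base_graph A) \<Longrightarrow> shift_map X (T e)"
    "\<And>e y. e \<in> arcs (base_graph A) \<Longrightarrow> y \<in> X \<times> UNIV \<Longrightarrow> T e (T (einv A e) y) = y"
    "\<And>e a y. e \<in> arcs (base_graph A) \<Longrightarrow> a \<in> carrier (edge_group A e) \<Longrightarrow> y \<in> X \<times> UNIV \<Longrightarrow>
      T e (edge_action act e a y) =
        act (tail (base_graph A) e) (edge_map A (einv A e) a) (T e y)"
    "\<And>e p q. e \<in> arcs (base_graph A) \<Longrightarrow> (p, q) \<in> M e \<Longrightarrow> T e p = q"
proof -
  let ?Y = "X \<times> (UNIV :: int set)"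
  define Q where "Q e t \<longleftrightarrow> bij_betw t ?Y ?Y \<and> shift_map X t \<and> (\<forall>p q. (p, q) \<in> M e \<longrightarrow> t p = q) \<and>
    (\<forall>a\<in>carrier (edge_group A e). \<forall>y\<in>?Y.
      t (edge_action act e a y) = edge_action act (einv A e) a (t y))" for e t
  have free_act: "free_action (edge_group A e) X (edge_action act e)" if "e \<in> arcs (base_graph A)" for e
    using free[OF that] shift_action_edge_action[OF act that] unfolding free_action_def by blast
  have Q_ex: "\<exists>t. Q e t" if e: "e \<in> arcs (base_graph A)" for e
  proof -
    have e': "einv A e \<in> arcs (base_graph A)" using e by simp
    have f': "free_action (edge_group A e) X (edge_action act (einv A e))"
      using free_act[OF e'] edge_group_einv[OF e] by simp
    \<comment> \<open>Second components for \<open>e\<close> are first components for the inverse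
      edge, where \<open>M_free\<close> applies.\<close>
    have "free_family (edge_group A e) (edge_action act (einv A e)) snd (M e)"
      unfolding free_family_def
    proof (rule inj_onI)
      fix u u' assume u: "u \<in> M e \<times> carrier (edge_group A e)" "u' \<in> M e \<times> carrier (edge_group A e)"
        and eq: "(\<lambda>(m, a). fst (edge_action act (einv A e) a (snd m))) u =
          (\<lambda>(m, a). fst (edge_action act (einv A e) a (snd m))) u'"
      obtain p q a p' q' a' where "u = ((p, q), a)" "u' = ((p', q'), a')" by (metis prod.collapse)
      then show "u = u'"
        using inj_onD[OF M_free[OF e', unfolded free_family_def], of "((q, p), a)" "((q', p'), a')"]
          u eq M_inv[OF e] edge_group_einv[OF e] by simp
    qed
    then show ?thesis
    proof (rule equivariant_matching[OF X edge_group[OF e] fin[OF e] free_act[OF e] f' M[OF e] M_free[OF e]])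
      fix t assume "bij_betw t ?Y ?Y" "shift_map X t" "\<And>p q. (p, q) \<in> M e \<Longrightarrow> t p = q"
        "\<And>a y. a \<in> carrier (edge_group A e) \<Longrightarrow> y \<in> ?Y \<Longrightarrow>
          t (edge_action act e a y) = edge_action act (einv A e) a (t y)"
      then have "Q e t" unfolding Q_def by blast
      then show ?thesis by blast
    qed
  qed
  have Q_inv: "Q (einv A e) (inv_into ?Y t)" if e: "e \<in> arcs (base_graph A)" and Q: "Q e t" for e t
    unfolding Q_def
  proof (intro conjI allI impI ballI)
    have t: "bij_betw t ?Y ?Y" "shift_map X t" using Q by (auto simp: Q_def)
    show "bij_betw (inv_into ?Y t) ?Y ?Y" by (rule bij_betw_inv_into[OF t(1)])
    show "shift_map X (inv_into ?Y t)" by (rule shift_map_inv_into[OF t])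
    show "inv_into ?Y t p = q" if "(p, q) \<in> M (einv A e)" for p q
    proof -
      have "(q, p) \<in> M e" using that M_inv[OF e] by simp
      then have "t q = p" "q \<in> ?Y" using Q M[OF e] by (auto simp: Q_def)
      then show ?thesis using bij_betw_inv_into_left[OF t(1)] by metis
    qed
    fix a y assume a: "a \<in> carrier (edge_group A (einv A e))" and y: "y \<in> ?Y"
    have ae: "a \<in> carrier (edge_group A e)" using a edge_group_einv[OF e] by simp
    let ?z = "inv_into ?Y t y"
    have z: "?z \<in> ?Y" using bij_betw_apply[OF bij_betw_inv_into[OF t(1)] y] .
    have "edge_action act e a ?z \<in> ?Y"
      by (rule shift_map_closed[OF shift_actionD(1)[OF shift_action_edge_action[OF act e] ae] z])
    moreover have "t (edge_action act e a ?z) = edge_action act (einv A e) a y"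
      using Q ae z bij_betw_inv_into_right[OF t(1) y] unfolding Q_def by metis
    ultimately show "inv_into ?Y t (edge_action act (einv A e) a y) =
        edge_action act (einv A (einv A e)) a ?z"
      using bij_betw_inv_into_left[OF t(1)] by (metis arev_arev)
  qed
  define t where "t e = (SOME t. Q e t)" for e
  \<comment> \<open>The choice is made from the unordered set of the two opposite edges, so both
    make the same choice.\<close>
  define orient where "orient e = (SOME x. x \<in> {e, einv A e})" for e
  define T where "T e = (if orient e = e then t e else inv_into ?Y (t (einv A e)))" for e
  have Qt: "Q e (t e)" if "e \<in> arcs (base_graph A)" for e
    unfolding t_def using someI_ex[OF Q_ex[OF that]] .
  have orient: "orient e = e \<or> orient e = einv A e" for e
    using someI[of "\<lambda>x. x \<in> {e, einv A e}" e] by (auto simp: orient_def)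
  have orient_inv: "orient (einv A e) = orient e" for e
    by (simp add: orient_def insert_commute)
  have QT: "Q e (T e)" if e: "e \<in> arcs (base_graph A)" for e
    using Qt[OF e] Q_inv[of "einv A e" "t (einv A e)"] Qt[of "einv A e"] e by (simp add: T_def)
  have T_inv: "T e (T (einv A e) y) = y" if e: "e \<in> arcs (base_graph A)" and y: "y \<in> ?Y" for e y
  proof (cases "orient e = e")
    case True
    have "bij_betw (t e) ?Y ?Y" using Qt[OF e] by (simp add: Q_def)
    from bij_betw_inv_into_right[OF this y] show ?thesis
      using True arev_neq[OF e] by (simp add: T_def orient_inv)
  next
    case False
    have "bij_betw (t (einv A e)) ?Y ?Y" using Qt[of "einv A e"] e by (simp add: Q_def)
    from bij_betw_inv_into_left[OF this y] show ?thesis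
      using False orient[of e] by (simp add: T_def orient_inv)
  qed
  show ?thesis
  proof (rule that[of T, OF _ T_inv])
    show "T e (edge_action act e a y) =
        act (tail (base_graph A) e) (edge_map A (einv A e) a) (T e y)"
      if "e \<in> arcs (base_graph A)" "a \<in> carrier (edge_group A e)" "y \<in> ?Y" for e a y
    proof -
      have "\<forall>a\<in>carrier (edge_group A e). \<forall>y\<in>?Y.
          T e (edge_action act e a y) = edge_action act (einv A e) a (T e y)"
        using QT[OF that(1)] unfolding Q_def by blast
      from bspec[OF bspec[OF this that(2)] that(3)] show ?thesis using that(1) by simp
    qed
  qed (use QT in \<open>auto simp: Q_def\<close>)
qed

section \<open>Cyclic faithfulness\<close>

text \<open>The whole path group acts, not only the fundamental group at one vertex, so conjugation
  by words that are not closed paths is available. The type of the points is that of the product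
  sets with levels.\<close>

definition cyclically_faithful :: "('v, 'e, 'g) letter list set \<Rightarrow> bool" where
  "cyclically_faithful x \<longleftrightarrow>
     (\<exists>(X :: (('v \<Rightarrow> 'g) \<times> nat) set) act.
        finite X \<and> shift_action (path_group A) X act \<and> faithful_on_powers (path_group A) X act x)"

text \<open>The two words represent conjugate elements, with conjugator
  \<open>word_class w'\<close>. The same action serves for both, since acting trivially and being
  trivial are invariant under conjugation.\<close>

lemma cyclically_faithful_swap:
  assumes w: "w \<in> lists (letters A)" "w' \<in> lists (letters A)"
    and f: "cyclically_faithful (word_class (w @ w'))"
  shows "cyclically_faithful (word_class (w' @ w))"
proof -
  interpret P: group "path_group A" by (rule group_path_group)
  obtain X :: "(('v \<Rightarrow> 'g) \<times> nat) set" and act where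
    X: "finite X" "shift_action (path_group A) X act"
      "faithful_on_powers (path_group A) X act (word_class (w @ w'))"
    using f unfolding cyclically_faithful_def by blast
  let ?a = "word_class w" and ?b = "word_class w'"
  have c: "?a \<in> carrier (path_group A)" "?b \<in> carrier (path_group A)"
    using w word_class_carrier by auto
  have pow: "(?b \<otimes>\<^bsub>path_group A\<^esub> ?a) [^]\<^bsub>path_group A\<^esub> (m::nat) \<otimes>\<^bsub>path_group A\<^esub> ?b =
      ?b \<otimes>\<^bsub>path_group A\<^esub> (?a \<otimes>\<^bsub>path_group A\<^esub> ?b) [^]\<^bsub>path_group A\<^esub> m" for m
  proof (induction m)
    case 0
    then show ?case using c by simp
  next
    case (Suc m)
    have "(?b \<otimes>\<^bsub>path_group A\<^esub> ?a) [^]\<^bsub>path_group A\<^esub> Suc m \<otimes>\<^bsub>path_group A\<^esub> ?b =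
        ((?b \<otimes>\<^bsub>path_group A\<^esub> ?a) [^]\<^bsub>path_group A\<^esub> m \<otimes>\<^bsub>path_group A\<^esub> ?b) \<otimes>\<^bsub>path_group A\<^esub> (?a \<otimes>\<^bsub>path_group A\<^esub> ?b)"
      using c by (simp add: P.m_assoc)
    then show ?case unfolding Suc.IH using c by (simp add: P.m_assoc)
  qed
  have "faithful_on_powers (path_group A) X act (?b \<otimes>\<^bsub>path_group A\<^esub> ?a)"
    unfolding faithful_on_powers_def
  proof (intro allI impI)
    fix m :: nat
    let ?u = "(?a \<otimes>\<^bsub>path_group A\<^esub> ?b) [^]\<^bsub>path_group A\<^esub> m"
    let ?v = "(?b \<otimes>\<^bsub>path_group A\<^esub> ?a) [^]\<^bsub>path_group A\<^esub> m"
    have uv: "?u \<in> carrier (path_group A)" "?v \<in> carrier (path_group A)" using c by auto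
    assume triv: "\<forall>y\<in>X \<times> UNIV. act ?v y = y"
    have "act ?u y = y" if y: "y \<in> X \<times> UNIV" for y
    proof -
      note cl = shift_map_closed[OF shift_actionD(1)[OF X(2)]]
      have "act ?b (act ?u y) = act (?b \<otimes>\<^bsub>path_group A\<^esub> ?u) y"
        using shift_actionD(3)[OF X(2) c(2) uv(1) y] by simp
      also have "\<dots> = act ?v (act ?b y)"
        using shift_actionD(3)[OF X(2) uv(2) c(2) y] pow by simp
      also have "\<dots> = act ?b y" by (rule bspec[OF triv cl[OF c(2) y]])
      finally have e: "act ?b (act ?u y) = act ?b y" .
      have i: "act (inv\<^bsub>path_group A\<^esub> ?b) (act ?b z) = z" if z: "z \<in> X \<times> UNIV" for z
        using shift_actionD(3)[OF X(2) P.inv_closed[OF c(2)] c(2) z] shift_actionD(2)[OF X(2) z]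
          P.l_inv[OF c(2)] by simp
      show ?thesis using i[OF y] i[OF cl[OF uv(1) y]] e by simp
    qed
    then have "?u = \<one>\<^bsub>path_group A\<^esub>"
      using X(3) path_group_mult[OF w] unfolding faithful_on_powers_def by auto
    then have "?v \<otimes>\<^bsub>path_group A\<^esub> ?b = ?b" unfolding pow using c by simp
    then show "?v = \<one>\<^bsub>path_group A\<^esub>" using P.r_cancel_one[OF c(2) uv(2)] by simp
  qed
  then show ?thesis
    using X(1,2) path_group_mult[OF w(2,1)] unfolding cyclically_faithful_def by auto
qed

text \<open>The word of a path without its leading vertex element. In this form a cyclic rotation of
  a closed path is a rotation of the list of pairs.\<close>

definition cyclic_word :: "('e \<times> 'g) list \<Rightarrow> ('v, 'e, 'g) letter list" where
  "cyclic_word c = concat (map (\<lambda>(e, h). [Edge e, Vertex_El (head (base_graph A) e) h]) c)"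

lemma cyclic_word_simps [simp]:
  "cyclic_word [] = []"
  "cyclic_word ((e, h) # c) = Edge e # Vertex_El (head (base_graph A) e) h # cyclic_word c"
  "cyclic_word (c @ d) = cyclic_word c @ cyclic_word d"
  by (simp_all add: cyclic_word_def)

definition cycle_letters :: "('e \<times> 'g) set" where
  "cycle_letters = (SIGMA e : arcs (base_graph A). carrier (vertex_group A (head (base_graph A) e)))"

lemma cyclic_word_letters: "set c \<subseteq> cycle_letters \<Longrightarrow> cyclic_word c \<in> lists (letters A)"
proof (induction c)
  case (Cons x c)
  then show ?case by (cases x) (auto simp: cycle_letters_def letters_def)
qed simp

text \<open>Indices are read modulo the length, so the condition is cyclic: no rotation of the word
  contains the left side of a conjugation relation.\<close>

definition reduced_cycle :: "('e \<times> 'g) list \<Rightarrow> bool" where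
  "reduced_cycle c \<longleftrightarrow> (\<forall>i<length c.
     fst (c ! (Suc i mod length c)) = einv A (fst (c ! i)) \<longrightarrow>
     snd (c ! i) \<notin> edge_map A (fst (c ! i)) ` carrier (edge_group A (fst (c ! i))))"

end

section \<open>Actions adapted to elliptic elements and to reduced cycles\<close>

locale VRC_graph_of_groups = finite_graph_of_groups A
  for A :: "('v, 'e, 'g, 'h) graph_of_groups_data" +
  assumes finite_edge_group: "e \<in> arcs (base_graph A) \<Longrightarrow> finite (carrier (edge_group A e))"
    and VRC_vertex_group: "v \<in> verts (base_graph A) \<Longrightarrow> VRC (vertex_group A v)"
begin

definition edge_image :: "'e \<Rightarrow> 'g set" where
  "edge_image e = edge_map A e ` carrier (edge_group A e)"

lemma finite_edge_image: "e \<in> arcs (base_graph A) \<Longrightarrow> finite (edge_image e)"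
  by (simp add: edge_image_def finite_edge_group)

lemma edge_image_subgroup:
  assumes e: "e \<in> arcs (base_graph A)"
  shows "subgroup (edge_image e) (vertex_group A (head (base_graph A) e))"
proof -
  let ?v = "head (base_graph A) e"
  have v: "?v \<in> verts (base_graph A)" using e by simp
  interpret group_hom "edge_group A e" "vertex_group A ?v" "edge_map A e"
    using edge_map[OF e] edge_group[OF e] vertex_group[OF v]
    by (auto simp: group_hom_def group_hom_axioms_def mon_def)
  show ?thesis unfolding edge_image_def by (rule img_is_subgroup)
qed

text \<open>The parameters serve the two kinds of elements: faithfulness on the powers of
  \<open>g v\<close> handles vertex elements, while \<open>S\<close> and the \<open>n\<close> levels
  above a common point \<open>q\<^sub>0\<close> give room for prescribing a reduced cycle. Freeness
  of the edge groups is needed for both.\<close>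

lemma vertex_actions:
  assumes S: "\<And>v. v \<in> verts (base_graph A) \<Longrightarrow> finite (S v) \<and> S v \<subseteq> carrier (vertex_group A v)"
    and g: "\<And>v. v \<in> verts (base_graph A) \<Longrightarrow> g v \<in> carrier (vertex_group A v)"
    and n: "(n :: nat) > 0"
  obtains X :: "(('v \<Rightarrow> 'g) \<times> nat) set" and act q\<^sub>0 where
    "finite X"
    "\<And>v. v \<in> verts (base_graph A) \<Longrightarrow> shift_action (vertex_group A v) X (act v)"
    "\<And>v s x. v \<in> verts (base_graph A) \<Longrightarrow> s \<in> S v \<Longrightarrow> x \<in> X \<Longrightarrow> fst (act v s (x, 0)) = x \<Longrightarrow>
      s = \<one>\<^bsub>vertex_group A v\<^esub>"
    "\<And>e a x. e \<in> arcs (base_graph A) \<Longrightarrow> a \<in> carrier (edge_group A e) \<Longrightarrow> x \<in> X \<Longrightarrow>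
      fst (edge_action act e a (x, 0)) = x \<Longrightarrow> a = \<one>\<^bsub>edge_group A e\<^esub>"
    "\<And>v. v \<in> verts (base_graph A) \<Longrightarrow> faithful_on_powers (vertex_group A v) X (act v) (g v)"
    "\<And>v a y. snd (fst (act v a y)) = snd (fst y)"
    "\<And>c. c < n \<Longrightarrow> (q\<^sub>0, c) \<in> X"
proof -
  let ?V = "verts (base_graph A)"
  \<comment> \<open>Nontrivial elements of edge groups must move all points too. The identity is
    removed because it fixes everything.\<close>
  define S' where "S' v = (S v \<union> \<Union> (edge_image ` {e \<in> arcs (base_graph A). head (base_graph A) e = v})) -
    {\<one>\<^bsub>vertex_group A v\<^esub>}" for v
  have S': "finite (S' v)" "S' v \<subseteq> carrier (vertex_group A v)" "\<one>\<^bsub>vertex_group A v\<^esub> \<notin> S' v"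
    if v: "v \<in> ?V" for v
  proof -
    show "finite (S' v)" using S[OF v] finite_edge_image by (auto simp: S'_def)
    have "edge_image e \<subseteq> carrier (vertex_group A (head (base_graph A) e))" if "e \<in> arcs (base_graph A)" for e
      by (rule subgroup.subset[OF edge_image_subgroup[OF that]])
    then show "S' v \<subseteq> carrier (vertex_group A v)" using S[OF v] by (auto simp: S'_def)
  qed (simp add: S'_def)
  define P where "P v Z act \<longleftrightarrow> finite Z \<and> Z \<noteq> {} \<and> shift_action (vertex_group A v) Z act \<and>
      (\<forall>s\<in>S' v. \<forall>x\<in>Z. fst (act s (x, 0)) \<noteq> x) \<and> faithful_on_powers (vertex_group A v) Z act (g v)"
    for v and Z :: "'g set" and act
  have "\<exists>Z act. P v Z act" if v: "v \<in> ?V" for v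
    unfolding P_def
    by (rule group.VRC_shift_action[OF vertex_group[OF v] VRC_vertex_group[OF v] S'[OF v] g[OF v]]) blast
  then obtain X\<^sub>0 act\<^sub>0 where "\<And>v. v \<in> ?V \<Longrightarrow> P v (X\<^sub>0 v) (act\<^sub>0 v)" by metis
  then have
    X0: "\<And>v. v \<in> ?V \<Longrightarrow> finite (X\<^sub>0 v)" "\<And>v. v \<in> ?V \<Longrightarrow> X\<^sub>0 v \<noteq> {}"
      "\<And>v. v \<in> ?V \<Longrightarrow> shift_action (vertex_group A v) (X\<^sub>0 v) (act\<^sub>0 v)"
      "\<And>v s x. v \<in> ?V \<Longrightarrow> s \<in> S' v \<Longrightarrow> x \<in> X\<^sub>0 v \<Longrightarrow> fst (act\<^sub>0 v s (x, 0)) \<noteq> x"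
      "\<And>v. v \<in> ?V \<Longrightarrow> faithful_on_powers (vertex_group A v) (X\<^sub>0 v) (act\<^sub>0 v) (g v)"
    unfolding P_def by blast+
  define X where "X = PiE ?V X\<^sub>0 \<times> {..<n}"
  define act where "act v = product_action v (act\<^sub>0 v)" for v
  have nofix: "s = \<one>\<^bsub>vertex_group A v\<^esub>"
    if v: "v \<in> ?V" and s: "s \<in> S' v \<union> {\<one>\<^bsub>vertex_group A v\<^esub>}" and x: "x \<in> X" and e: "fst (act v s (x, 0)) = x"
    for v s x
  proof -
    have "fst (act\<^sub>0 v s (fst x v, 0)) = fst x v" using product_action_fst_eq e unfolding act_def by metis
    moreover have "fst x v \<in> X\<^sub>0 v" using x v by (auto simp: X_def)
    ultimately show ?thesis using X0(4)[OF v, of s] s by blast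
  qed
  obtain q where q: "q \<in> PiE ?V X\<^sub>0" using X0(2) PiE_eq_empty_iff[of ?V X\<^sub>0] by blast
  show ?thesis
  proof (rule that[of X act q])
    show "finite X" unfolding X_def using X0(1) by (intro finite_cartesian_product finite_PiE) auto
    show "shift_action (vertex_group A v) X (act v)" if "v \<in> ?V" for v
      unfolding X_def act_def by (rule shift_action_product_action[where X = X\<^sub>0, OF X0(3)[OF that] that])
    show "s = \<one>\<^bsub>vertex_group A v\<^esub>"
      if "v \<in> ?V" "s \<in> S v" "x \<in> X" "fst (act v s (x, 0)) = x" for v s x
      using nofix[OF that(1) _ that(3,4)] that(2) by (auto simp: S'_def)
    show "a = \<one>\<^bsub>edge_group A e\<^esub>"
      if e: "e \<in> arcs (base_graph A)" and a: "a \<in> carrier (edge_group A e)" and x: "x \<in> X"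
        and fix_x: "fst (edge_action act e a (x, 0)) = x" for e a x
    proof -
      let ?v = "head (base_graph A) e"
      have v: "?v \<in> ?V" using e by simp
      interpret group_hom "edge_group A e" "vertex_group A ?v" "edge_map A e"
        using edge_map[OF e] edge_group[OF e] vertex_group[OF v]
        by (auto simp: group_hom_def group_hom_axioms_def mon_def)
      have "edge_map A e a = \<one>\<^bsub>vertex_group A ?v\<^esub>"
        using nofix[OF v _ x fix_x] a e by (auto simp: S'_def edge_image_def)
      then show ?thesis
        using edge_map[OF e] a inj_onD[of "edge_map A e" "carrier (edge_group A e)" a "\<one>\<^bsub>edge_group A e\<^esub>"]
        by (simp add: mon_def)
    qed
    show "faithful_on_powers (vertex_group A v) X (act v) (g v)" if "v \<in> ?V" for v
      unfolding X_def act_def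
      by (rule faithful_on_powers_product_action[where X = X\<^sub>0, OF X0(5)[OF that] X0(3)[OF that] vertex_group[OF that] g[OF that] that X0(2)])
        (use n in auto)
    show "snd (fst (act v a y)) = snd (fst y)" for v a y
      unfolding act_def by (rule product_action_level)
    show "(q, c) \<in> X" if "c < n" for c using q that by (simp add: X_def)
  qed
qed

text \<open>Nothing is prescribed on the edges and one level is enough. If a power of the class acts
  trivially, faithfulness at \<open>v\<close> makes that power of \<open>g\<close> trivial in the
  vertex group, hence also in the path group.\<close>

lemma cyclically_faithful_elliptic:
  assumes v: "v \<in> verts (base_graph A)" and g: "g \<in> carrier (vertex_group A v)"
  shows "cyclically_faithful (word_class [Vertex_El v g])"
proof -
  interpret V: group "vertex_group A v" using v by (rule vertex_group)
  define g' where "g' u = (if u = v then g else \<one>\<^bsub>vertex_group A u\<^esub>)" for u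
  have g': "g' u \<in> carrier (vertex_group A u)" if "u \<in> verts (base_graph A)" for u
    using g vertex_group[OF that] by (simp add: g'_def group.is_monoid)
  obtain X :: "(('v \<Rightarrow> 'g) \<times> nat) set" and act where X: "finite X"
    and act: "\<And>v. v \<in> verts (base_graph A) \<Longrightarrow> shift_action (vertex_group A v) X (act v)"
    and free: "\<And>e a x. e \<in> arcs (base_graph A) \<Longrightarrow> a \<in> carrier (edge_group A e) \<Longrightarrow> x \<in> X \<Longrightarrow>
      fst (edge_action act e a (x, 0)) = x \<Longrightarrow> a = \<one>\<^bsub>edge_group A e\<^esub>"
    and faithful: "\<And>v. v \<in> verts (base_graph A) \<Longrightarrow> faithful_on_powers (vertex_group A v) X (act v) (g' v)"
    by (rule vertex_actions[of "\<lambda>_. {}" g' 1]) (use g' in auto)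
  obtain T where T: "\<And>e. e \<in> arcs (base_graph A) \<Longrightarrow> shift_map X (T e)"
    "\<And>e y. e \<in> arcs (base_graph A) \<Longrightarrow> y \<in> X \<times> UNIV \<Longrightarrow> T e (T (einv A e) y) = y"
    "\<And>e a y. e \<in> arcs (base_graph A) \<Longrightarrow> a \<in> carrier (edge_group A e) \<Longrightarrow> y \<in> X \<times> UNIV \<Longrightarrow>
      T e (edge_action act e a y) = act (tail (base_graph A) e) (edge_map A (einv A e) a) (T e y)"
    by (rule edge_matchings[where act = act and M = "\<lambda>_. {}", OF X act finite_edge_group free])
      (auto simp: free_family_def)
  obtain Act where Act: "shift_action (path_group A) X Act"
    "\<And>w y. w \<in> lists (letters A) \<Longrightarrow> y \<in> X \<times> UNIV \<Longrightarrow>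
      Act (word_class w) y = foldr (letter_map act T) w y"
    using path_group_shift_action[where act = act and T = T, OF act T] by blast
  let ?c = "\<lambda>g. word_class [Vertex_El v g]"
  have L: "[Vertex_El v h] \<in> lists (letters A)" if "h \<in> carrier (vertex_group A v)" for h
    using v that by (auto simp: letters_def)
  have one: "?c \<one>\<^bsub>vertex_group A v\<^esub> = \<one>\<^bsub>path_group A\<^esub>"
    using word_class_eq[OF path_cong.step[OF path_relations.vertex_one[OF v], of "[]" "[]"]]
    by (simp add: path_group_one)
  have mult: "?c h \<otimes>\<^bsub>path_group A\<^esub> ?c k = ?c (h \<otimes>\<^bsub>vertex_group A v\<^esub> k)"
    if "h \<in> carrier (vertex_group A v)" "k \<in> carrier (vertex_group A v)" for h k
    using word_class_eq[OF path_cong.step[OF path_relations.vertex_mult[OF v that], of "[]" "[]"]]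
    by (simp add: path_group_mult[OF L[OF that(1)] L[OF that(2)]])
  have pow: "?c g [^]\<^bsub>path_group A\<^esub> m = ?c (g [^]\<^bsub>vertex_group A v\<^esub> m)" for m :: nat
    by (induction m) (use g one mult in simp_all)
  have "faithful_on_powers (path_group A) X Act (?c g)"
    unfolding faithful_on_powers_def
  proof (intro allI impI)
    fix m :: nat
    assume *: "\<forall>y\<in>X \<times> UNIV. Act (?c g [^]\<^bsub>path_group A\<^esub> m) y = y"
    have "act v (g [^]\<^bsub>vertex_group A v\<^esub> m) y = y" if y: "y \<in> X \<times> UNIV" for y
      using bspec[OF * y] Act(2)[OF L[of "g [^]\<^bsub>vertex_group A v\<^esub> m"] y] g unfolding pow by simp
    then have "g [^]\<^bsub>vertex_group A v\<^esub> m = \<one>\<^bsub>vertex_group A v\<^esub>"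
      using faithful[OF v] by (simp add: faithful_on_powers_def g'_def)
    then show "?c g [^]\<^bsub>path_group A\<^esub> m = \<one>\<^bsub>path_group A\<^esub>" using pow one by simp
  qed
  then show ?thesis using X Act(1) unfolding cyclically_faithful_def by blast
qed

text \<open>
  The edges are matched along the cycle so that it moves the point \<open>y\<close> at the last level once around
  all levels and then shifts it by one. Reducedness says exactly that the pairs to be matched lie in
  distinct orbits of the edge groups.
\<close>

lemma cyclically_faithful_reduced_cycle:
  assumes c: "set c \<subseteq> cycle_letters" "c \<noteq> []" "reduced_cycle c"
  shows "cyclically_faithful (word_class (cyclic_word c))"
proof -
  define n where "n = length c"
  have n: "n > 0" using c by (simp add: n_def)
  define E where "E i = fst (c ! i)" for i
  define g where "g i = snd (c ! i)" for i
  define hd where "hd = head (base_graph A)"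
  define nx where "nx i = Suc i mod n" for i
  have ci: "c ! i = (E i, g i)" for i by (simp add: E_def g_def)
  have Eg: "E i \<in> arcs (base_graph A)" "g i \<in> carrier (vertex_group A (hd (E i)))" if "i < n" for i
  proof -
    have "(E i, g i) \<in> cycle_letters" using c(1) that nth_mem[of i c] by (auto simp: ci n_def)
    then show "E i \<in> arcs (base_graph A)" "g i \<in> carrier (vertex_group A (hd (E i)))"
      by (auto simp: cycle_letters_def hd_def)
  qed
  have red: "g i \<notin> edge_image (E i)" if "i < n" "E (nx i) = einv A (E i)" for i
    using c(3) that by (simp add: reduced_cycle_def edge_image_def E_def g_def nx_def n_def)
  \<comment> \<open>If such an element \<open>b \<otimes> g i\<close> fixed a point of
    \<open>X\<close>, the point and its image under \<open>g i\<close> could lie in the same orbit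
    of the edge group, and both could not be prescribed independently.\<close>
  define S where "S v = (\<Union>i\<in>{i. i < n \<and> hd (E i) = v}.
    (\<lambda>b. b \<otimes>\<^bsub>vertex_group A v\<^esub> g i) ` edge_image (E i))" for v
  have S: "finite (S v) \<and> S v \<subseteq> carrier (vertex_group A v)" if v: "v \<in> verts (base_graph A)" for v
  proof
    show "finite (S v)" using finite_edge_image Eg by (auto simp: S_def)
    interpret V: group "vertex_group A v" using v by (rule vertex_group)
    have "b \<otimes>\<^bsub>vertex_group A v\<^esub> g i \<in> carrier (vertex_group A v)"
      if "i < n" "hd (E i) = v" "b \<in> edge_image (E i)" for b i
      using subgroup.subset[OF edge_image_subgroup[OF Eg(1)[OF that(1)]]] Eg(2)[OF that(1)] that
      by (intro V.m_closed) (auto simp: hd_def)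
    then show "S v \<subseteq> carrier (vertex_group A v)" by (auto simp: S_def)
  qed
  have one: "\<one>\<^bsub>vertex_group A v\<^esub> \<in> carrier (vertex_group A v)" if "v \<in> verts (base_graph A)" for v
    using vertex_group[OF that] by (simp add: group.is_monoid)
  obtain X :: "(('v \<Rightarrow> 'g) \<times> nat) set" and act q where X: "finite X"
    and act: "\<And>v. v \<in> verts (base_graph A) \<Longrightarrow> shift_action (vertex_group A v) X (act v)"
    and nofix: "\<And>v s x. v \<in> verts (base_graph A) \<Longrightarrow> s \<in> S v \<Longrightarrow> x \<in> X \<Longrightarrow> fst (act v s (x, 0)) = x \<Longrightarrow>
      s = \<one>\<^bsub>vertex_group A v\<^esub>"
    and free: "\<And>e a x. e \<in> arcs (base_graph A) \<Longrightarrow> a \<in> carrier (edge_group A e) \<Longrightarrow> x \<in> X \<Longrightarrow>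
      fst (edge_action act e a (x, 0)) = x \<Longrightarrow> a = \<one>\<^bsub>edge_group A e\<^esub>"
    and level: "\<And>v a y. snd (fst (act v a y)) = snd (fst y)"
    and q: "\<And>c. c < n \<Longrightarrow> (q, c) \<in> X"
    by (rule vertex_actions[of S "\<lambda>v. \<one>\<^bsub>vertex_group A v\<^esub>" n]) (use S one n in auto)
  let ?Y = "X \<times> (UNIV :: int set)"
  \<comment> \<open>Words act from the right. \<open>g i\<close> takes \<open>y i\<close> to
    \<open>z i\<close> on level \<open>i\<close>, and the edge \<open>E i\<close> is to take
    \<open>z i\<close> to \<open>y' i\<close>, which is one level lower. From level 0 it returns to
    level \<open>n - 1\<close> with integer 1, which is where the translation comes from.\<close>
  define y where "y i = ((q, i), 0 :: int)" for i :: nat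
  define z where "z i = act (hd (E i)) (g i) (y i)" for i
  define y' where "y' i = (if i = 0 then shift 1 (y (n - 1)) else y (i - 1))" for i
  have hdv: "hd e \<in> verts (base_graph A)" if "e \<in> arcs (base_graph A)" for e using that by (simp add: hd_def)
  have yY: "y i \<in> ?Y" "y' i \<in> ?Y" "z i \<in> ?Y" if "i < n" for i
  proof -
    show y: "y i \<in> ?Y" using q[OF that] by (simp add: y_def)
    show "y' i \<in> ?Y" using q[of "n - 1"] q[of "i - 1"] that n by (auto simp: y'_def y_def shift_def)
    show "z i \<in> ?Y"
      unfolding z_def using shift_map_closed[OF shift_actionD(1)[OF act[OF hdv[OF Eg(1)]] Eg(2)] y] that by simp
  qed
  have fst_y': "fst (y' (nx i)) = fst (y i)" if "i < n" for i
  proof (cases "Suc i = n")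
    case True
    then show ?thesis by (auto simp: nx_def y'_def)
  next
    case False
    then show ?thesis using that by (simp add: nx_def y'_def)
  qed
  have nx_ex: "\<exists>j<n. i = nx j" if "i < n" for i
  proof (cases i)
    case 0
    then show ?thesis using n by (intro exI[of _ "n - 1"]) (simp add: nx_def)
  next
    case (Suc j)
    then show ?thesis using that by (intro exI[of _ j]) (simp add: nx_def)
  qed
  have lev: "snd (fst (y i)) = i" "snd (fst (z i)) = i" for i by (simp_all add: z_def level y_def)
  define M where "M e = {(z i, y' i) | i. i < n \<and> E i = e} \<union> {(y' i, z i) | i. i < n \<and> E i = einv A e}" for e
  have MY: "M e \<subseteq> ?Y \<times> ?Y" for e unfolding M_def using yY by blast
  have M_inv: "M (einv A e) = (M e)\<inverse>" for e by (auto simp: M_def)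
  have M_free: "free_family (edge_group A e) (edge_action act e) fst (M e)"
    if e: "e \<in> arcs (base_graph A)" for e
  proof -
    let ?E = "edge_group A e"
    have group_E: "group ?E" using edge_group[OF e] .
    interpret E: group ?E by (rule group_E)
    let ?v = "hd e"
    have v: "?v \<in> verts (base_graph A)" by (rule hdv[OF e])
    interpret V: group "vertex_group A ?v" by (rule vertex_group[OF v])
    have \<alpha>: "shift_action ?E X (edge_action act e)" by (rule shift_action_edge_action[OF act e])
    have \<alpha>f: "free_action ?E X (edge_action act e)" using \<alpha> free[OF e] unfolding free_action_def by blast
    \<comment> \<open>The one coincidence not excluded by levels: a backtrack along
      \<open>e\<close>. It would make \<open>?s\<close>, an edge group element times
      \<open>g i\<close>, fix \<open>fst (y i)\<close>. So \<open>?s\<close> would be trivial and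
      \<open>g i\<close> would lie in the edge image, against \<open>red\<close>.\<close>
    have mixed: False
      if i: "i < n" "E i = e" and j: "E (nx i) = einv A e"
        and ab: "a \<in> carrier ?E" "b \<in> carrier ?E"
        and eq: "fst (edge_action act e a (z i)) = fst (edge_action act e b (y' (nx i)))" for i a b
    proof -
      let ?a = "inv\<^bsub>?E\<^esub> b \<otimes>\<^bsub>?E\<^esub> a"
      let ?s = "edge_map A e ?a \<otimes>\<^bsub>vertex_group A ?v\<^esub> g i"
      have nxi: "nx i < n" using n by (simp add: nx_def)
      have ac: "?a \<in> carrier ?E" using ab by simp
      have bc: "edge_map A e ?a \<in> carrier (vertex_group A ?v)" using edge_map_closed[OF e ac] by (simp add: hd_def)
      have gc: "g i \<in> carrier (vertex_group A ?v)" using Eg(2)[OF i(1)] i by simp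
      have "fst (y' (nx i)) = fst (edge_action act e ?a (z i))"
        by (rule shift_action_fst_translate[OF group_E \<alpha> ab(2,1) yY(2)[OF nxi] yY(3)[OF i(1)] eq[symmetric]])
      also have "\<dots> = fst (act ?v ?s (y i))"
        using shift_actionD(3)[OF act[OF v] bc gc yY(1)[OF i(1)]] i(2) by (simp add: z_def hd_def)
      finally have "fst (act ?v ?s (fst (y i), 0)) = fst (y i)"
        using fst_y'[OF i(1)] by (simp add: y_def)
      moreover have "?s \<in> S ?v" using i ac by (auto simp: S_def edge_image_def)
      moreover have "fst (y i) \<in> X" using yY(1)[OF i(1)] by (simp add: mem_Times_iff)
      ultimately have "?s = \<one>\<^bsub>vertex_group A ?v\<^esub>" using nofix[OF v] by blast
      then have "g i = inv\<^bsub>vertex_group A ?v\<^esub> (edge_map A e ?a)"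
        using V.inv_equality[OF _ gc bc] V.inv_inv[OF gc] by metis
      moreover have "inv\<^bsub>vertex_group A ?v\<^esub> (edge_map A e ?a) \<in> edge_image e"
        using subgroup.m_inv_closed[OF edge_image_subgroup[OF e], of "edge_map A e ?a"] ac
        by (auto simp: edge_image_def hd_def)
      ultimately show False using red[OF i(1)] i j by simp
    qed
    have pairs: "(p, r) = (p', r') \<and> a = b"
      if pr: "(p, r) \<in> M e" "(p', r') \<in> M e" and ab: "a \<in> carrier ?E" "b \<in> carrier ?E"
        and eq: "fst (edge_action act e a p) = fst (edge_action act e b p')" for p r p' r' a b
    proof -
      have levp: "snd (fst p) = snd (fst p')" using eq level by metis
      have same: "a = b" if "p = p'"
        using free_actionD[OF group_E \<alpha>f ab, of p'] MY[of e] pr eq that by auto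
      \<comment> \<open>Indexing by \<open>nx i\<close> puts \<open>y'\<close> on level
        \<open>i\<close>, also across the end of the cycle, since the shift by one does not affect
        first components. Equal levels then mean equal indices in all four cases.\<close>
      have lev': "snd (fst (y' (nx i))) = i" if "i < n" for i using fst_y'[OF that] lev by simp
      have cases: "(\<exists>i<n. E i = e \<and> p = z i \<and> r = y' i) \<or>
          (\<exists>j<n. E (nx j) = einv A e \<and> p = y' (nx j) \<and> r = z (nx j))" if "(p, r) \<in> M e" for p r
      proof -
        have "(\<exists>i<n. E i = e \<and> p = z i \<and> r = y' i) \<or> (\<exists>i<n. E i = einv A e \<and> p = y' i \<and> r = z i)"
          using that unfolding M_def by blast
        then show ?thesis using nx_ex by metis
      qed
      show ?thesis
        using cases[OF pr(1)] cases[OF pr(2)]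
      proof (elim disjE exE conjE)
        fix i j assume *: "i < n" "p = z i" "r = y' i" "j < n" "p' = z j" "r' = y' j"
        then have "i = j" using levp lev by simp
        then show ?thesis using * same by simp
      next
        fix i j assume *: "i < n" "p = y' (nx i)" "r = z (nx i)" "j < n" "p' = y' (nx j)" "r' = z (nx j)"
        then have "i = j" using levp lev' by simp
        then show ?thesis using * same by simp
      next
        fix i j assume *: "i < n" "E i = e" "p = z i" "j < n" "E (nx j) = einv A e" "p' = y' (nx j)"
        then have "i = j" using levp lev lev' by simp
        then show ?thesis using mixed[of i a b] * ab eq by simp
      next
        fix i j assume *: "i < n" "E i = e" "p' = z i" "j < n" "E (nx j) = einv A e" "p = y' (nx j)"
        then have "i = j" using levp lev lev' by simp
        then show ?thesis using mixed[of i b a] * ab eq by simp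
      qed
    qed
    show ?thesis
      unfolding free_family_def
    proof (rule inj_onI)
      fix u u' assume u: "u \<in> M e \<times> carrier ?E" "u' \<in> M e \<times> carrier ?E"
        and eq: "(\<lambda>(m, a). fst (edge_action act e a (fst m))) u = (\<lambda>(m, a). fst (edge_action act e a (fst m))) u'"
      obtain p r a p' r' b where *: "u = ((p, r), a)" "u' = ((p', r'), b)" by (metis prod.collapse)
      then show "u = u'" using pairs[of p r p' r' a b] u eq by simp
    qed
  qed
  obtain T where T: "\<And>e. e \<in> arcs (base_graph A) \<Longrightarrow> shift_map X (T e)"
    "\<And>e y. e \<in> arcs (base_graph A) \<Longrightarrow> y \<in> X \<times> UNIV \<Longrightarrow> T e (T (einv A e) y) = y"
    "\<And>e a y. e \<in> arcs (base_graph A) \<Longrightarrow> a \<in> carrier (edge_group A e) \<Longrightarrow> y \<in> X \<times> UNIV \<Longrightarrow>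
      T e (edge_action act e a y) = act (tail (base_graph A) e) (edge_map A (einv A e) a) (T e y)"
    and TM: "\<And>e p q. e \<in> arcs (base_graph A) \<Longrightarrow> (p, q) \<in> M e \<Longrightarrow> T e p = q"
    by (rule edge_matchings[where act = act and M = M, OF X act finite_edge_group free MY M_inv M_free]) auto
  obtain Act where Act: "shift_action (path_group A) X Act"
    "\<And>w y. w \<in> lists (letters A) \<Longrightarrow> y \<in> X \<times> UNIV \<Longrightarrow>
      Act (word_class w) y = foldr (letter_map act T) w y"
    using path_group_shift_action[where act = act and T = T, OF act T] by blast
  \<comment> \<open>The suffix of the cycle from position \<open>i\<close> on moves the point from
    the last level down to \<open>y' i\<close>; at \<open>i = 0\<close> this is the starting point
    shifted by one.\<close>
  have F: "foldr (letter_map act T) (cyclic_word (drop i c)) (y (n - 1)) = y' i" if "i < n" for i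
    using that
  proof (induction "n - i" arbitrary: i)
    case (Suc k)
    have d: "drop i c = (E i, g i) # drop (Suc i) c"
      using Suc.prems by (simp add: Cons_nth_drop_Suc n_def flip: ci)
    have "foldr (letter_map act T) (cyclic_word (drop (Suc i) c)) (y (n - 1)) = y i"
    proof (cases "Suc i = n")
      case True
      then have "n - 1 = i" "drop (Suc i) c = []" by (auto simp: n_def)
      then show ?thesis by simp
    next
      case False
      then have "foldr (letter_map act T) (cyclic_word (drop (Suc i) c)) (y (n - 1)) = y' (Suc i)"
        using Suc by auto
      then show ?thesis by (simp add: y'_def)
    qed
    moreover have "T (E i) (z i) = y' i" using TM[OF Eg(1)] Suc.prems unfolding M_def by blast
    ultimately show ?case by (simp add: d z_def hd_def)
  qed simp
  let ?x = "word_class (cyclic_word c)"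
  have L: "cyclic_word c \<in> lists (letters A)" by (rule cyclic_word_letters[OF c(1)])
  have x: "?x \<in> carrier (path_group A)" by (rule word_class_carrier[OF L])
  interpret P: group "path_group A" by (rule group_path_group)
  have last: "y (n - 1) \<in> ?Y" using n by (intro yY) simp
  have step: "Act ?x (y (n - 1)) = shift 1 (y (n - 1))"
    using F[OF n] Act(2)[OF L last] by (simp add: y'_def)
  have pow: "Act (?x [^]\<^bsub>path_group A\<^esub> m) (y (n - 1)) = shift (int m) (y (n - 1))" for m :: nat
  proof (induction m)
    case 0
    then show ?case using shift_actionD(2)[OF Act(1) last] by simp
  next
    case (Suc m)
    have xm: "?x [^]\<^bsub>path_group A\<^esub> m \<in> carrier (path_group A)" using x by simp
    have "Act (?x [^]\<^bsub>path_group A\<^esub> Suc m) (y (n - 1)) = Act (?x [^]\<^bsub>path_group A\<^esub> m) (shift 1 (y (n - 1)))"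
      using shift_actionD(3)[OF Act(1) xm x last] step by simp
    also have "\<dots> = shift 1 (shift (int m) (y (n - 1)))"
      using shift_map_shift[OF shift_actionD(1)[OF Act(1) xm] last] Suc.IH by simp
    finally show ?case by (simp add: add.commute)
  qed
  have "faithful_on_powers (path_group A) X Act ?x"
    unfolding faithful_on_powers_def
  proof (intro allI impI)
    fix m :: nat
    assume *: "\<forall>y\<in>?Y. Act (?x [^]\<^bsub>path_group A\<^esub> m) y = y"
    have "shift (int m) (y (n - 1)) = y (n - 1)" using bspec[OF * last] unfolding pow .
    then have "m = 0" by (simp add: shift_def y_def)
    then show "?x [^]\<^bsub>path_group A\<^esub> m = \<one>\<^bsub>path_group A\<^esub>" by simp
  qed
  then show ?thesis using X Act(1) unfolding cyclically_faithful_def by blast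
qed

end

section \<open>Cyclic reduction of closed paths\<close>

context graph_of_groups
begin

fun edge_path :: "'v \<Rightarrow> ('e \<times> 'g) list \<Rightarrow> 'v \<Rightarrow> bool" where
  "edge_path u [] w \<longleftrightarrow> u = w"
| "edge_path u ((e, h) # c) w \<longleftrightarrow> (e, h) \<in> cycle_letters \<and> tail (base_graph A) e = u \<and>
     edge_path (head (base_graph A) e) c w"

lemma edge_path_append: "edge_path u (c @ d) w \<longleftrightarrow> (\<exists>v. edge_path u c v \<and> edge_path v d w)"
  by (induction c arbitrary: u) auto

lemma edge_path_letters: "edge_path u c w \<Longrightarrow> set c \<subseteq> cycle_letters"
proof (induction c arbitrary: u)
  case (Cons x c)
  obtain e k where "x = (e, k)" by (cases x)
  then show ?case using Cons.IH[of "head (base_graph A) e"] Cons.prems by simp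
qed simp

lemma is_path_edge_path: "is_path A u g c w \<Longrightarrow> edge_path u c w"
proof (induction c arbitrary: u g)
  case Nil
  then show ?case by (simp add: is_path_Nil)
next
  case (Cons x c)
  obtain e k where x: "x = (e, k)" by (cases x)
  from Cons.prems have *: "e \<in> arcs (base_graph A)" "tail (base_graph A) e = u"
    "is_path A (head (base_graph A) e) k c w" by (simp_all add: x is_path_Cons)
  have "k \<in> carrier (vertex_group A (head (base_graph A) e))" using *(3) by (simp add: is_path_def)
  then show ?case using * Cons.IH[OF *(3)] by (simp add: x cycle_letters_def)
qed

lemma word_class_congruence:
  assumes "(l, r) \<in> path_relations A" "x \<in> lists (letters A)" "y \<in> lists (letters A)"
  shows "word_class (x @ l @ y) = word_class (x @ r @ y)"
  by (rule word_class_eq[OF path_cong.step[OF assms]])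

end

context VRC_graph_of_groups
begin

text \<open>Conjugation moves the leading vertex element to the end, where it is absorbed by the
  last vertex element of the cycle. The length is unchanged, and the empty cycle leaves a vertex
  element.\<close>

lemma cyclically_faithful_Vertex_El:
  assumes k: "k \<in> carrier (vertex_group A v)" "v \<in> verts (base_graph A)" and c: "edge_path v c v"
    and IH: "\<And>d. length d = length c \<Longrightarrow> edge_path v d v \<Longrightarrow> d \<noteq> [] \<Longrightarrow>
      cyclically_faithful (word_class (cyclic_word d))"
  shows "cyclically_faithful (word_class (Vertex_El v k # cyclic_word c))"
proof (cases c rule: rev_cases)
  case Nil
  then show ?thesis using cyclically_faithful_elliptic k by simp
next
  case (snoc d x)
  obtain f l where x: "x = (f, l)" by (cases x)
  have d: "edge_path v d (tail (base_graph A) f)" and f: "(f, l) \<in> cycle_letters" "head (base_graph A) f = v"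
    using c by (auto simp: snoc x edge_path_append)
  have l: "f \<in> arcs (base_graph A)" "l \<in> carrier (vertex_group A v)" using f by (auto simp: cycle_letters_def)
  interpret V: group "vertex_group A v" using k(2) by (rule vertex_group)
  have lk: "l \<otimes>\<^bsub>vertex_group A v\<^esub> k \<in> carrier (vertex_group A v)" using l k by simp
  have dL: "cyclic_word d \<in> lists (letters A)" by (rule cyclic_word_letters[OF edge_path_letters[OF d]])
  have cL: "cyclic_word c \<in> lists (letters A)" by (rule cyclic_word_letters[OF edge_path_letters[OF c]])
  have kL: "[Vertex_El v k] \<in> lists (letters A)" using k by (auto simp: letters_def)
  have "word_class ((cyclic_word d @ [Edge f]) @ [Vertex_El v l, Vertex_El v k] @ []) =
      word_class ((cyclic_word d @ [Edge f]) @ [Vertex_El v (l \<otimes>\<^bsub>vertex_group A v\<^esub> k)] @ [])"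
    using dL l by (intro word_class_congruence path_relations.vertex_mult k l) (auto simp: letters_def)
  then have "word_class (cyclic_word c @ [Vertex_El v k]) =
      word_class (cyclic_word (d @ [(f, l \<otimes>\<^bsub>vertex_group A v\<^esub> k)]))"
    by (simp add: snoc x f)
  moreover have "edge_path v (d @ [(f, l \<otimes>\<^bsub>vertex_group A v\<^esub> k)]) v"
    using d f l lk by (auto simp: edge_path_append cycle_letters_def)
  ultimately have "cyclically_faithful (word_class (cyclic_word c @ [Vertex_El v k]))"
    using IH[of "d @ [(f, l \<otimes>\<^bsub>vertex_group A v\<^esub> k)]"] by (simp add: snoc)
  from cyclically_faithful_swap[OF cL kL this] show ?thesis by simp
qed

text \<open>A cycle that is not reduced has a rotation beginning with \<open>e\<close>, an element
  of the edge image, and the inverse of \<open>e\<close>. The conjugation relation turns this into a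
  vertex element and leaves a cycle with two edges fewer.\<close>

lemma cyclically_faithful_cycle:
  assumes "edge_path v c v" "c \<noteq> []"
  shows "cyclically_faithful (word_class (cyclic_word c))"
  using assms
proof (induction c arbitrary: v rule: length_induct)
  case (1 c)
  have cL: "set c \<subseteq> cycle_letters" using edge_path_letters 1 by blast
  show ?case
  proof (cases "reduced_cycle c")
    case True
    then show ?thesis using cyclically_faithful_reduced_cycle[OF cL] 1 by blast
  next
    case False
    then obtain i where i: "i < length c" "fst (c ! (Suc i mod length c)) = einv A (fst (c ! i))"
      "snd (c ! i) \<in> edge_map A (fst (c ! i)) ` carrier (edge_group A (fst (c ! i)))"
      by (auto simp: reduced_cycle_def)
    have arc: "fst (c ! i) \<in> arcs (base_graph A)"
      using cL nth_mem[OF i(1)] by (force simp: cycle_letters_def)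
    \<comment> \<open>In a cycle of length one the successor of the edge is the edge itself, and no
      edge equals its inverse.\<close>
    have "length c \<noteq> 1"
    proof
      assume "length c = 1"
      then show False using i arev_neq[OF arc] by simp
    qed
    then have len: "length c \<ge> 2" using i(1) by linarith
    \<comment> \<open>The backtrack may straddle the end of the list; rotation by \<open>i\<close>
      brings it to the front.\<close>
    have rot: "drop i c @ take i c = rotate i c" using i(1) by (simp add: rotate_drop_take)
    have "0 < length c" using i(1) by linarith
    then have r0: "rotate i c ! 0 = c ! i" using nth_rotate[of 0 c i] i(1) by simp
    have r1: "rotate i c ! 1 = c ! (Suc i mod length c)" using nth_rotate[of 1 c i] len by simp
    obtain x y r where xyr: "rotate i c = x # y # r"
      using len by (metis One_nat_def Suc_1 Suc_le_length_iff length_rotate)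
    define e where "e = fst (c ! i)"
    obtain a where a: "a \<in> carrier (edge_group A e)" "snd (c ! i) = edge_map A e a"
      using i(3) by (auto simp: e_def)
    define h where "h = snd y"
    have x: "x = (e, edge_map A e a)" using r0 a by (simp add: xyr e_def prod_eq_iff)
    have y: "y = (einv A e, h)" using r1 i(2) by (simp add: xyr e_def h_def prod_eq_iff)
    have e: "e \<in> arcs (base_graph A)" using arc by (simp add: e_def)
    obtain u where "edge_path v (take i c) u" "edge_path u (drop i c) v"
      using 1(2) by (metis append_take_drop_id edge_path_append)
    then have "edge_path u (rotate i c) u" unfolding rot[symmetric] edge_path_append by blast
    then have u: "u = tail (base_graph A) e" and h: "h \<in> carrier (vertex_group A u)" and r: "edge_path u r u"
      using e by (auto simp: xyr x y cycle_letters_def)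
    have uv: "u \<in> verts (base_graph A)" using u e by simp
    interpret U: group "vertex_group A u" using uv by (rule vertex_group)
    define b where "b = edge_map A (einv A e) a"
    have b: "b \<in> carrier (vertex_group A u)"
      using edge_map_closed[of "einv A e" a] e a edge_group_einv[OF e] by (simp add: b_def u)
    have rL: "cyclic_word r \<in> lists (letters A)" by (rule cyclic_word_letters[OF edge_path_letters[OF r]])
    have hL: "[Vertex_El u h] @ cyclic_word r \<in> lists (letters A)"
      using rL h uv by (auto simp: letters_def)
    have "word_class (cyclic_word (rotate i c)) = word_class ([] @ [Edge e,
        Vertex_El (head (base_graph A) e) (edge_map A e a), Edge (einv A e)] @ [Vertex_El u h] @ cyclic_word r)"
      using e u by (simp add: xyr x y)
    also have "\<dots> = word_class ([] @ [Vertex_El u b] @ [Vertex_El u h] @ cyclic_word r)"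
      unfolding u b_def using hL a e
      by (intro word_class_congruence path_relations.edge_conj) (auto simp: u)
    also have "\<dots> = word_class ([] @ [Vertex_El u b, Vertex_El u h] @ cyclic_word r)" by simp
    also have "\<dots> = word_class ([] @ [Vertex_El u (b \<otimes>\<^bsub>vertex_group A u\<^esub> h)] @ cyclic_word r)"
      by (intro word_class_congruence path_relations.vertex_mult uv b h rL) simp
    finally have eq: "word_class (cyclic_word (rotate i c)) =
        word_class (Vertex_El u (b \<otimes>\<^bsub>vertex_group A u\<^esub> h) # cyclic_word r)" by simp
    have short: "length r < length c" using arg_cong[OF xyr, of length] by simp
    have "cyclically_faithful (word_class (cyclic_word (rotate i c)))"
      unfolding eq
      by (rule cyclically_faithful_Vertex_El[OF U.m_closed[OF b h] uv r]) (use 1(1) short in metis)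
    then have "cyclically_faithful (word_class (cyclic_word (drop i c) @ cyclic_word (take i c)))"
      unfolding rot[symmetric] by simp
    moreover have "cyclic_word (drop i c) \<in> lists (letters A)" "cyclic_word (take i c) \<in> lists (letters A)"
      using cL by (meson cyclic_word_letters order_trans set_drop_subset set_take_subset)+
    ultimately have "cyclically_faithful (word_class (cyclic_word (take i c) @ cyclic_word (drop i c)))"
      using cyclically_faithful_swap by blast
    also have "cyclic_word (take i c) @ cyclic_word (drop i c) = cyclic_word c"
      by (metis append_take_drop_id cyclic_word_simps(3))
    finally show ?thesis .
  qed
qed

theorem cyclically_faithful_closed_path:
  assumes "is_path A v g c v"
  shows "cyclically_faithful (word_class (path_word A v g c))"
proof -
  have g: "g \<in> carrier (vertex_group A v)" using assms by (simp add: is_path_def)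
  have "cyclically_faithful (word_class (Vertex_El v g # cyclic_word c))"
    by (rule cyclically_faithful_Vertex_El[OF g is_path_start[OF assms] is_path_edge_path[OF assms]])
      (rule cyclically_faithful_cycle)
  then show ?thesis by (simp add: path_word_def cyclic_word_def)
qed

end

theorem corollary6p5:
  fixes A :: "('v, 'e, 'g, 'h) graph_of_groups_data"
    and v\<^sub>0 :: 'v
    and G :: "'a monoid"
  assumes "finite_graph_of_groups A"
    and "\<And>e. e \<in> arcs (base_graph A) \<Longrightarrow> finite (carrier (edge_group A e))"
    and "\<And>v. v \<in> verts (base_graph A) \<Longrightarrow> VRC (vertex_group A v)"
    and "v\<^sub>0 \<in> verts (base_graph A)"
    and "group G"
    and "G \<cong> fundamental_group A v\<^sub>0"
  shows "VRC G"
proof -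
  interpret finite_graph_of_groups A by (rule assms(1))
  interpret VRC_graph_of_groups A by unfold_locales (use assms(2,3) in auto)
  interpret G: group G by (rule assms(5))
  interpret P: group "path_group A" by (rule group_path_group)
  have sub: "subgroup (carrier (fundamental_group A v\<^sub>0)) (path_group A)"
    by (rule subgroup_fundamental_group[OF assms(4)])
  obtain \<phi> where \<phi>: "\<phi> \<in> iso G (fundamental_group A v\<^sub>0)" using assms(6) by (auto simp: is_iso_def)
  have \<phi>_hom: "\<phi> \<in> hom G (path_group A)"
  proof (rule homI)
    show "\<phi> x \<in> carrier (path_group A)" if "x \<in> carrier G" for x
      using \<phi> that subgroup.mem_carrier[OF sub] by (auto simp: iso_def hom_def)
    show "\<phi> (x \<otimes>\<^bsub>G\<^esub> y) = \<phi> x \<otimes>\<^bsub>path_group A\<^esub> \<phi> y" if "x \<in> carrier G" "y \<in> carrier G" for x y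
      using \<phi> that by (simp add: iso_def hom_def fundamental_group_def)
  qed
  have \<phi>_inj: "inj_on \<phi> (carrier G)" using \<phi> by (simp add: iso_def bij_betw_def)
  interpret \<phi>: group_hom G "path_group A" \<phi> by unfold_locales (rule \<phi>_hom)
  have retract: "virtual_retract (generate G {g}) G" if g: "g \<in> carrier G" for g
  proof -
    have "\<phi> g \<in> carrier (fundamental_group A v\<^sub>0)" using \<phi> g by (auto simp: iso_def hom_def)
    then obtain h c where hc: "\<phi> g = path_cong A `` {path_word A v\<^sub>0 h c}" "is_path A v\<^sub>0 h c v\<^sub>0"
      by (auto simp: fundamental_group_def)
    obtain X :: "(('v \<Rightarrow> 'g) \<times> nat) set" and act where X: "finite X" "shift_action (path_group A) X act"
      "faithful_on_powers (path_group A) X act (\<phi> g)"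
      using cyclically_faithful_closed_path[OF hc(2)] unfolding cyclically_faithful_def hc(1) by blast
    \<comment> \<open>The action of the path group is pulled back along the embedding
      \<open>\<phi>\<close>. Injectivity of \<open>\<phi>\<close> turns triviality of a power in the
      path group into triviality in \<open>G\<close>.\<close>
    have "shift_action G X (\<lambda>a. act (\<phi> a))"
      using X(2) unfolding shift_action_def by simp
    moreover have "faithful_on_powers G X (\<lambda>a. act (\<phi> a)) g"
      unfolding faithful_on_powers_def
    proof (intro allI impI)
      fix m :: nat
      assume "\<forall>y\<in>X \<times> UNIV. act (\<phi> (g [^]\<^bsub>G\<^esub> m)) y = y"
      then have "\<phi> g [^]\<^bsub>path_group A\<^esub> m = \<one>\<^bsub>path_group A\<^esub>"
        using X(3) g unfolding faithful_on_powers_def \<phi>.hom_nat_pow[OF g] by blast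
      then have "\<phi> (g [^]\<^bsub>G\<^esub> m) = \<phi> \<one>\<^bsub>G\<^esub>" using g by (simp add: \<phi>.hom_nat_pow)
      then show "g [^]\<^bsub>G\<^esub> m = \<one>\<^bsub>G\<^esub>" using inj_onD[OF \<phi>_inj] g by simp
    qed
    ultimately show ?thesis using G.virtual_retract_if_shift_action[OF X(1)] g by blast
  qed
  show ?thesis
    unfolding VRC_def
  proof (intro allI impI, elim conjE)
    fix H assume H: "subgroup H G" "cyclic_group (G\<lparr>carrier := H\<rparr>)"
    interpret H: group "G\<lparr>carrier := H\<rparr>" by (rule G.subgroup_imp_group[OF H(1)])
    obtain g where g: "g \<in> H" "H = range (\<lambda>n::int. g [^]\<^bsub>G\<lparr>carrier := H\<rparr>\<^esub> n)"
      using H(2) unfolding H.cyclic_group by auto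
    have gc: "g \<in> carrier G" using g(1) subgroup.mem_carrier[OF H(1)] by blast
    have "H = generate G {g}"
      using g G.int_pow_consistent[OF H(1) g(1)] by (auto simp: G.generate_pow[OF gc])
    then show "virtual_retract H G" using retract[OF gc] by simp
  qed
qed

end
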